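(* Let $d\ge1$, let $\|\cdot\|$ be a norm on $\mathbb{R}^d$, let $\alpha>0$, and let $(\Theta_t)_{t\in\mathbb{Z}}$ be a stochastic process with values in $[0,\infty)^d$ such that $0<\sum_{t\in\mathbb{Z}}\|\Theta_t\|^\alpha<\infty$ almost surely. Let $(U_i,T_i,(\Theta_t^{(i)})_{t\in\mathbb{Z}})_{i\in\mathbb{N}}$ be an enumeration of the points of a Poisson point process on $(0,\infty)\times\mathbb{Z}\times([0,\infty)^d)^{\mathbb{Z}}$ with intensity $\alpha u^{-\alpha-1}\,du\otimes\lambda(dt)\otimes P^{(\Theta_t)_{t\in\mathbb{Z}}}(d\theta)$, where $\lambda$ is the counting measure on $\mathbb{Z}$ and $P^{(\Theta_t)_{t\in\mathbb{Z}}}$ is the law of $(\Theta_t)_{t\in\mathbb{Z}}$. Then the stochastic process $$(Z_t)_{t\in\mathbb{Z}}=\left(\bigvee_{i\in\mathbb{N}}U_i\,\frac{\Theta^{(i)}_{t+T_i}}{\|(\Theta^{(i)}_l)_{l\in\mathbb{Z}}\|_\alpha}\right)_{t\in\mathbb{Z}}$$ (maxima taken componentwise) is an almost surely finite, stationary process that is max-stable with index $\alpha$. Furthermore, it is regularly varying with spectral tail process $(\Theta^{RS}_t)_{t\in\mathbb{Z}}$, where $(\Theta^{RS}_t)_{t\in\mathbb{Z}}$ is a time series with $$(\Theta^{RS}_t)_{t\in\mathbb{Z}}\overset{d}{=}\left(\frac{\Theta_{t+K(\Theta)}}{\|\Theta_{K(\Theta)}\|}\right)_{t\in\mathbb{Z}}$$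 and $K(\Theta)$ is a random integer with conditional probability mass function $$P(K(\Theta)=k\mid(\Theta_t)_{t\in\mathbb{Z}})=\frac{\|\Theta_k\|^\alpha}{\sum_{t\in\mathbb{Z}}\|\Theta_t\|^\alpha},\qquad k\in\mathbb{Z}.$$
   Context: Notation: $\|(\theta_t)_{t\in\mathbb{Z}}\|_\alpha:=\left(\sum_{t\in\mathbb{Z}}\|\theta_t\|^\alpha\right)^{1/\alpha}$ (also for $\alpha<1$). Max-stable with index $\alpha$: a process $(X_t)_{t\in\mathbb{Z}}$ with values in $[0,\infty)^d$ such that for all $k\in\mathbb{N}$, $s\le t$, $x_s,\dots,x_t\in[0,\infty]^d$, $(P(X_s\le x_s,\dots,X_t\le x_t))^k=P(X_s\le k^{-1/\alpha}x_s,\dots,X_t\le k^{-1/\alpha}x_t)$, inequalities being componentwise. Regularly varying time series: all finite-dimensional distributions are multivariate regularly varying. Spectral tail process: for a stationary $\mathbb{R}^d$-valued time series $(X_t)_{t\in\mathbb{Z}}$, a time series $(\Theta_t)_{t\in\mathbb{Z}}$ such that for all integers $s\le t$, the conditional law of $(X_s/\|X_0\|,\dots,X_t/\|X_0\|)$ given $\|X_0\|>x$ converges weakly to the law of $(\Theta_s,\dots,\Theta_t)$ as $x\to\infty$. *)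

theory Defs
  imports "HOL-Probability.Probability"
begin

text \<open>
  Vectors live in \<^typ>\<open>real ^ 'n\<close>. The norm is an arbitrary function \<open>N\<close> satisfying the norm axioms,
  unrelated to the Euclidean \<^const>\<open>norm\<close> of that type.
\<close>

definition is_norm :: "(real ^ 'n \<Rightarrow> real) \<Rightarrow> bool" where
  "is_norm N \<longleftrightarrow>
     (\<forall>x. 0 \<le> N x) \<and> (\<forall>x. N x = 0 \<longleftrightarrow> x = 0) \<and>
     (\<forall>c x. N (c *\<^sub>R x) = \<bar>c\<bar> * N x) \<and> (\<forall>x y. N (x + y) \<le> N x + N y)"

text \<open>
  \<^const>\<open>infsum\<close> is \<open>0\<close> on non-summable families, so \<open>alpha_norm\<close> is \<open>0\<close> instead of \<open>\<infinity>\<close> there.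
\<close>

definition alpha_norm :: "(real ^ 'n \<Rightarrow> real) \<Rightarrow> real \<Rightarrow> (int \<Rightarrow> real ^ 'n) \<Rightarrow> real" where
  "alpha_norm N \<alpha> \<theta> = (\<Sum>\<^sub>\<infinity>t. N (\<theta> t) powr \<alpha>) powr (1 / \<alpha>)"


subsection \<open>Processes and weak convergence\<close>

definition nonneg_borel :: "(real ^ 'n) measure" where
  "nonneg_borel = restrict_space borel {x. \<forall>j. 0 \<le> x $ j}"

abbreviation path_space :: "(int \<Rightarrow> real ^ 'n) measure" where
  "path_space \<equiv> PiM UNIV (\<lambda>_. borel)"

abbreviation nonneg_path_space :: "(int \<Rightarrow> real ^ 'n) measure" where
  "nonneg_path_space \<equiv> PiM UNIV (\<lambda>_. nonneg_borel)"

definition process :: "'a measure \<Rightarrow> (int \<Rightarrow> 'a \<Rightarrow> real ^ 'n) \<Rightarrow> bool" where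
  "process M X \<longleftrightarrow> prob_space M \<and> (\<lambda>\<omega> t. X t \<omega>) \<in> M \<rightarrow>\<^sub>M path_space"

definition nonneg_process :: "'a measure \<Rightarrow> (int \<Rightarrow> 'a \<Rightarrow> real ^ 'n) \<Rightarrow> bool" where
  "nonneg_process M X \<longleftrightarrow> prob_space M \<and> (\<lambda>\<omega> t. X t \<omega>) \<in> M \<rightarrow>\<^sub>M nonneg_path_space"

definition process_law :: "'a measure \<Rightarrow> (int \<Rightarrow> 'a \<Rightarrow> real ^ 'n) \<Rightarrow> (int \<Rightarrow> real ^ 'n) measure" where
  "process_law M X = distr M path_space (\<lambda>\<omega> t. X t \<omega>)"

definition stationary :: "'a measure \<Rightarrow> (int \<Rightarrow> 'a \<Rightarrow> real ^ 'n) \<Rightarrow> bool" where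
  "stationary M X \<longleftrightarrow>
     process M X \<and> (\<forall>h. process_law M (\<lambda>t. X (t + h)) = process_law M X)"

text \<open>
  Weak convergence of finite measures. Test functions are only required to be continuous on the space
  of the limit measure: for measures on \<^term>\<open>PiM I (\<lambda>_. borel)\<close> with finite \<open>I\<close> this space
  consists of the functions that are \<^const>\<open>undefined\<close> outside \<open>I\<close>, which with the product topology
  is the ordinary finite power of the coordinate space.
\<close>

definition weakly_converges ::
  "('i \<Rightarrow> 'b::topological_space measure) \<Rightarrow> 'b measure \<Rightarrow> 'i filter \<Rightarrow> bool" where
  "weakly_converges \<mu> \<nu> F \<longleftrightarrow>
     (\<forall>f :: 'b \<Rightarrow> real. continuous_on (space \<nu>) f \<and> bounded (f ` space \<nu>) \<longrightarrow>
        ((\<lambda>i. \<integral>x. f x \<partial>\<mu> i) \<longlongrightarrow> (\<integral>x. f x \<partial>\<nu>)) F)"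


subsection \<open>Poisson point processes\<close>

text \<open>
  The point process is given through an enumeration \<open>p\<close> of its points, that is, as the random
  measure \<open>\<Sum>\<^sub>i \<delta>\<^bsub>p i\<^esub>\<close>.
\<close>

definition point_count :: "(nat \<Rightarrow> 'a \<Rightarrow> 'e) \<Rightarrow> 'e set \<Rightarrow> 'a \<Rightarrow> ennreal" where
  "point_count p B \<omega> = (\<Sum>i. indicator B (p i \<omega>))"

definition poisson_point_process :: "'a measure \<Rightarrow> 'e measure \<Rightarrow> (nat \<Rightarrow> 'a \<Rightarrow> 'e) \<Rightarrow> bool" where
  "poisson_point_process M \<mu> p \<longleftrightarrow>
     prob_space M \<and>
     (\<forall>i. p i \<in> M \<rightarrow>\<^sub>M \<mu>) \<and>
     (\<forall>B\<in>sets \<mu>. emeasure \<mu> B < \<infinity> \<longrightarrow>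
        (\<forall>n. measure M {\<omega> \<in> space M. point_count p B \<omega> = of_nat n} =
               measure \<mu> B ^ n / fact n * exp (- measure \<mu> B))) \<and>
     (\<forall>B\<in>sets \<mu>. emeasure \<mu> B = \<infinity> \<longrightarrow> (AE \<omega> in M. point_count p B \<omega> = \<infinity>)) \<and>
     (\<forall>(J :: nat set) B. finite J \<and> (\<forall>k\<in>J. B k \<in> sets \<mu>) \<and> disjoint_family_on B J \<longrightarrow>
        prob_space.indep_vars M (\<lambda>_. borel) (\<lambda>k. point_count p (B k)) J)"

definition pareto_intensity :: "real \<Rightarrow> real measure" where
  "pareto_intensity \<alpha> =
     density (restrict_space lborel {0<..}) (\<lambda>u. ennreal (\<alpha> * u powr (- \<alpha> - 1)))"

definition intensity ::
  "real \<Rightarrow> 'a measure \<Rightarrow> (int \<Rightarrow> 'a \<Rightarrow> real ^ 'n) \<Rightarrow> (real \<times> int \<times> (int \<Rightarrow> real ^ 'n)) measure" where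
  "intensity \<alpha> M \<Theta> =
     pareto_intensity \<alpha> \<Otimes>\<^sub>M (count_space UNIV \<Otimes>\<^sub>M distr M nonneg_path_space (\<lambda>\<omega> t. \<Theta> t \<omega>))"


subsection \<open>The max-stable process\<close>

text \<open>The componentwise supremum is taken in \<open>[0, \<infinity>]\<close>, so that its finiteness is a genuine claim.\<close>

definition max_process_ext ::
  "(real ^ 'n \<Rightarrow> real) \<Rightarrow> real \<Rightarrow> (nat \<Rightarrow> 'a \<Rightarrow> real) \<Rightarrow> (nat \<Rightarrow> 'a \<Rightarrow> int) \<Rightarrow>
     (nat \<Rightarrow> 'a \<Rightarrow> int \<Rightarrow> real ^ 'n) \<Rightarrow> int \<Rightarrow> 'a \<Rightarrow> ennreal ^ 'n" where
  "max_process_ext N \<alpha> U T \<theta> t \<omega> =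
     (\<chi> j. SUP i. ennreal (U i \<omega> * (\<theta> i \<omega> (t + T i \<omega>) $ j / alpha_norm N \<alpha> (\<theta> i \<omega>))))"

text \<open>\<^const>\<open>enn2real\<close> sends \<open>\<infinity>\<close> to \<open>0\<close>.\<close>

definition max_process ::
  "(real ^ 'n \<Rightarrow> real) \<Rightarrow> real \<Rightarrow> (nat \<Rightarrow> 'a \<Rightarrow> real) \<Rightarrow> (nat \<Rightarrow> 'a \<Rightarrow> int) \<Rightarrow>
     (nat \<Rightarrow> 'a \<Rightarrow> int \<Rightarrow> real ^ 'n) \<Rightarrow> int \<Rightarrow> 'a \<Rightarrow> real ^ 'n" where
  "max_process N \<alpha> U T \<theta> t \<omega> = (\<chi> j. enn2real (max_process_ext N \<alpha> U T \<theta> t \<omega> $ j))"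

definition max_stable :: "'a measure \<Rightarrow> real \<Rightarrow> (int \<Rightarrow> 'a \<Rightarrow> real ^ 'n) \<Rightarrow> bool" where
  "max_stable M \<alpha> X \<longleftrightarrow>
     nonneg_process M X \<and>
     (\<forall>(k::nat) s t (x :: int \<Rightarrow> ennreal ^ 'n). 1 \<le> k \<and> s \<le> t \<longrightarrow>
        measure M {\<omega> \<in> space M. \<forall>u\<in>{s..t}. \<forall>j. ennreal (X u \<omega> $ j) \<le> x u $ j} ^ k =
        measure M {\<omega> \<in> space M. \<forall>u\<in>{s..t}. \<forall>j.
          ennreal (X u \<omega> $ j) \<le> ennreal (real k powr (- 1 / \<alpha>)) * (x u $ j)})"


subsection \<open>Regular variation and spectral tail processes\<close>

text \<open>
  The maximum over \<open>I\<close> of the norms of the blocks is a norm on the vectors of blocks indexed by \<open>I\<close>.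
  Regular variation, and its index, do not depend on the norm chosen there.
\<close>

definition block_norm :: "(real ^ 'n \<Rightarrow> real) \<Rightarrow> int set \<Rightarrow> (int \<Rightarrow> real ^ 'n) \<Rightarrow> real" where
  "block_norm N I y = (MAX u\<in>I. N (y u))"

text \<open>
  Multivariate regular variation with index \<open>\<alpha>\<close> of \<open>Y = (Y u)\<^bsub>u \<in> I\<^esub>\<close>, in polar form: there is a
  probability measure \<open>S\<close> on the unit sphere such that, as \<open>x \<rightarrow> \<infinity>\<close> and for every \<open>r > 0\<close>, the measures
  \<open>P(\<parallel>Y\<parallel> > r x, Y / \<parallel>Y\<parallel> \<in> \<sqdot>) / P(\<parallel>Y\<parallel> > x)\<close> converge weakly to \<open>r\<^bsup>-\<alpha>\<^esup> S\<close>.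
\<close>

definition mv_regularly_varying ::
  "'a measure \<Rightarrow> (real ^ 'n \<Rightarrow> real) \<Rightarrow> real \<Rightarrow> int set \<Rightarrow> (int \<Rightarrow> 'a \<Rightarrow> real ^ 'n) \<Rightarrow> bool" where
  "mv_regularly_varying M N \<alpha> I Y \<longleftrightarrow>
     (let R = (\<lambda>\<omega>. block_norm N I (\<lambda>u. Y u \<omega>)) in
      (\<forall>x. 0 < measure M {\<omega> \<in> space M. x < R \<omega>}) \<and>
      (\<exists>S. prob_space S \<and> sets S = sets (PiM I (\<lambda>_. borel)) \<and> (AE y in S. block_norm N I y = 1) \<and>
        (\<forall>r>0. weakly_converges
           (\<lambda>x. distr
              (density M (\<lambda>\<omega>. ennreal
                 (indicator {\<omega> \<in> space M. r * x < R \<omega>} \<omega> / measure M {\<omega> \<in> space M. x < R \<omega>})))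
              (PiM I (\<lambda>_. borel)) (\<lambda>\<omega>. \<lambda>u\<in>I. (1 / R \<omega>) *\<^sub>R Y u \<omega>))
           (density S (\<lambda>_. ennreal (r powr (- \<alpha>))))
           at_top)))"

definition regularly_varying ::
  "'a measure \<Rightarrow> (real ^ 'n \<Rightarrow> real) \<Rightarrow> real \<Rightarrow> (int \<Rightarrow> 'a \<Rightarrow> real ^ 'n) \<Rightarrow> bool" where
  "regularly_varying M N \<alpha> X \<longleftrightarrow>
     process M X \<and> (\<forall>I. finite I \<and> I \<noteq> {} \<longrightarrow> mv_regularly_varying M N \<alpha> I X)"

text \<open>Positivity of the conditioning events is required so that the conditional laws are meaningful.\<close>

definition spectral_tail_process ::
  "'a measure \<Rightarrow> (real ^ 'n \<Rightarrow> real) \<Rightarrow> (int \<Rightarrow> 'a \<Rightarrow> real ^ 'n) \<Rightarrow>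
     'b measure \<Rightarrow> (int \<Rightarrow> 'b \<Rightarrow> real ^ 'n) \<Rightarrow> bool" where
  "spectral_tail_process M N X P \<Theta> \<longleftrightarrow>
     stationary M X \<and> process P \<Theta> \<and>
     (\<forall>x. 0 < measure M {\<omega> \<in> space M. x < N (X 0 \<omega>)}) \<and>
     (\<forall>s t. s \<le> t \<longrightarrow>
        weakly_converges
          (\<lambda>x. distr (uniform_measure M {\<omega> \<in> space M. x < N (X 0 \<omega>)})
             (PiM {s..t} (\<lambda>_. borel)) (\<lambda>\<omega>. \<lambda>u\<in>{s..t}. (1 / N (X 0 \<omega>)) *\<^sub>R X u \<omega>))
          (distr P (PiM {s..t} (\<lambda>_. borel)) (\<lambda>\<omega>. \<lambda>u\<in>{s..t}. \<Theta> u \<omega>))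
          at_top)"

definition random_shift ::
  "'a measure \<Rightarrow> (real ^ 'n \<Rightarrow> real) \<Rightarrow> real \<Rightarrow> (int \<Rightarrow> 'a \<Rightarrow> real ^ 'n) \<Rightarrow> ('a \<Rightarrow> int) \<Rightarrow> bool" where
  "random_shift M N \<alpha> \<Theta> K \<longleftrightarrow>
     K \<in> M \<rightarrow>\<^sub>M count_space UNIV \<and>
     (\<forall>k. AE \<omega> in M.
        real_cond_exp M (vimage_algebra (space M) (\<lambda>\<omega> t. \<Theta> t \<omega>) nonneg_path_space)
          (indicator {\<omega> \<in> space M. K \<omega> = k}) \<omega> =
        N (\<Theta> k \<omega>) powr \<alpha> / (\<Sum>\<^sub>\<infinity>t. N (\<Theta> t \<omega>) powr \<alpha>))"

end

theory Submission
  imports Defs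
begin

text \<open>
  Write the points of the Poisson process as storms \<open>F(u, t, \<theta>) = (u / \<parallel>\<theta>\<parallel>\<^sub>\<alpha>) \<theta>(\<sqdot> + t)\<close>, so that \<open>Z\<close> is their
  pointwise supremum. The event \<open>Z \<le> x\<close> says that there is no point in \<open>{not F \<le> x}\<close>, hence has probability
  \<open>exp (- \<mu>{not F \<le> x})\<close>. The intensity \<open>\<mu>\<close> is homogeneous of degree \<open>-\<alpha>\<close> in \<open>u\<close> and invariant under
  shifts of \<open>t\<close>, which gives finiteness, max-stability and stationarity.

  For the tails, let \<open>g\<close> be bounded, almost everywhere continuous, and zero near the origin. Up to events of
  order \<open>x\<^bsup>-2\<alpha>\<^esup>\<close> at most one storm is of order \<open>x\<close>, so \<open>g(Z / x)\<close> may be replaced by \<open>\<Sum>\<^sub>i g(F\<^sub>i / x)\<close>, whose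
  expectation is \<open>x\<^bsup>-\<alpha>\<^esup> \<integral> g(F) d\<mu>\<close> by Campbell's formula. Thus \<open>x\<^bsup>\<alpha>\<^esup> E g(Z / x) \<longrightarrow> \<integral> g(F) d\<mu>\<close>. Taking for \<open>g\<close> functions
  of the direction, cut off at a radius, yields regular variation, and for the radius \<open>N(y 0)\<close> the integral over
  \<open>u\<close> produces exactly the weights \<open>\<parallel>\<Theta>\<^sub>k\<parallel>\<^sup>\<alpha> / \<Sum>\<^sub>t \<parallel>\<Theta>\<^sub>t\<parallel>\<^sup>\<alpha>\<close> of the random shift.
\<close>

text \<open>A sharp radial cut-off is discontinuous exactly where the block norm equals the radius.
  The norm of a storm is u times a function of (t, \<theta>) and the Pareto intensity has no atoms,
  so this set is null; hence the comparison of Z with its largest storm uses the local oscillation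
  of g, not uniform continuity. The error depends on an auxiliary scale e: the oscillation of g at
  scale e, plus configurations with two rescaled storms above e/2. The mass of storms above e/2 may
  blow up as e tends to 0, so x goes to infinity first, at fixed e. The second error carries the
  number c of large storms as a weight, since the sum of g over the storms can be of size C c; still
  E[c; c \<ge> 2] = m - m exp(-m) is of order m^2 for a Poisson c with mean m. Dividing by the
  \<alpha>-norm gives the storms with N(F s) > r mass exactly r^(-\<alpha>). This bounds all masses,
  makes the limit constants positive and normalises the limit at a single time to a probability.
  Both tail statements come from one object: \<mu> restricted to storms whose norm over a window I
  exceeds 1, with the direction recorded over a window J. I = J gives the spectral measure, I = {0}
  the spectral tail process.\<close>

text \<open>As integrals against counting measure, sums of nonnegative terms obey Tonelli and
  reindexing without summability conditions. On a non-summable family both sides are 0: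
  \<open>infsum\<close> by default, the right side because
  \<open>enn2real \<infinity> = 0\<close>.\<close>

lemma infsum_eq_enn2real_nn_integral:
  fixes f :: "'a \<Rightarrow> real"
  assumes "\<And>x. 0 \<le> f x"
  shows "(\<Sum>\<^sub>\<infinity>x. f x) = enn2real (\<integral>\<^sup>+x. ennreal (f x) \<partial>count_space UNIV)"
    and "f summable_on UNIV \<longleftrightarrow> (\<integral>\<^sup>+x. ennreal (f x) \<partial>count_space UNIV) < \<infinity>"
proof -
  have abs: "f summable_on UNIV \<longleftrightarrow> Infinite_Set_Sum.abs_summable_on f UNIV"
    unfolding abs_summable_equivalent[symmetric] by (rule summable_on_iff_abs_summable_on_real)
  also have "\<dots> \<longleftrightarrow> integrable (count_space UNIV) f"
    by (simp add: Infinite_Set_Sum.abs_summable_on_def)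
  also have "\<dots> \<longleftrightarrow> (\<integral>\<^sup>+x. ennreal (f x) \<partial>count_space UNIV) < \<infinity>"
    using assms by (simp add: integrable_iff_bounded)
  finally show iff: "f summable_on UNIV \<longleftrightarrow> (\<integral>\<^sup>+x. ennreal (f x) \<partial>count_space UNIV) < \<infinity>" .
  show "(\<Sum>\<^sub>\<infinity>x. f x) = enn2real (\<integral>\<^sup>+x. ennreal (f x) \<partial>count_space UNIV)"
  proof (cases "f summable_on UNIV")
    case True
    then have a: "Infinite_Set_Sum.abs_summable_on f UNIV" using abs by blast
    then have "(\<integral>\<^sup>+x. ennreal (f x) \<partial>count_space UNIV) = ennreal (infsetsum f UNIV)"
      using assms by (intro nn_integral_conv_infsetsum) auto
    moreover have "infsetsum f UNIV = (\<Sum>\<^sub>\<infinity>x. f x)"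
      using a by (rule infsetsum_infsum)
    ultimately show ?thesis using assms by (simp add: infsum_nonneg)
  next
    case False
    then show ?thesis using iff by (simp add: infsum_not_exists less_top[symmetric])
  qed
qed

section \<open>Norms on Euclidean space\<close>

text \<open>Expansion in the standard basis and the triangle inequality. Storms are compared
  coordinate by coordinate, and this bound converts small coordinates into small N.\<close>

lemma is_norm_le_Sup_coordinates:
  assumes "is_norm N"
  shows "\<exists>C>0. \<forall>(x::real^'n) d. (\<forall>j. \<bar>x $ j\<bar> \<le> d) \<longrightarrow> N x \<le> C * d"
proof (intro exI conjI allI impI)
  \<comment> \<open>The summand 1 makes positivity of the constant immediate; it serves as a
    denominator later.\<close>
  let ?C = "(\<Sum>j\<in>UNIV. N (axis j 1 :: real^'n)) + 1"
  have N: "\<And>x. 0 \<le> N x" "\<And>c x. N (c *\<^sub>R x) = \<bar>c\<bar> * N x" "\<And>x y. N (x + y) \<le> N x + N y" "N 0 = 0"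
    using assms by (auto simp: is_norm_def)
  have sum_le: "N (\<Sum>j\<in>A. f j) \<le> (\<Sum>j\<in>A. N (f j))" if "finite A" for A :: "'n set" and f
    using that
  proof induction
    case (insert a A) then show ?case using N(3)[of "f a" "sum f A"] by simp
  qed (simp add: N)
  show "0 < ?C" using N(1) by (simp add: sum_nonneg add_nonneg_pos)
  fix x :: "real^'n" and d assume d: "\<forall>j. \<bar>x $ j\<bar> \<le> d"
  then have d0: "0 \<le> d" using order_trans[OF abs_ge_zero] by blast
  have "x = (\<Sum>j\<in>UNIV. (x $ j) *\<^sub>R axis j 1)"
    by (simp add: basis_expansion scalar_mult_eq_scaleR[symmetric])
  then have "N x \<le> (\<Sum>j\<in>UNIV. N ((x $ j) *\<^sub>R (axis j 1 :: real^'n)))"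
    using sum_le[of UNIV "\<lambda>j. (x $ j) *\<^sub>R (axis j 1 :: real^'n)"] by simp
  also have "\<dots> \<le> (\<Sum>j\<in>UNIV. d * N (axis j 1 :: real^'n))"
    using d N(1) by (intro sum_mono) (auto simp: N(2) intro!: mult_right_mono)
  also have "\<dots> \<le> ?C * d" using d0 by (simp add: sum_distrib_left[symmetric] algebra_simps)
  finally show "N x \<le> ?C * d" .
qed

lemma is_norm_continuous_on:
  fixes N :: "real^'n \<Rightarrow> real"
  assumes "is_norm N"
  shows "continuous_on A N"
proof -
  obtain C where C: "C > 0" "\<And>(x::real^'n) d. (\<forall>j. \<bar>x $ j\<bar> \<le> d) \<Longrightarrow> N x \<le> C * d"
    using is_norm_le_Sup_coordinates[OF assms] by blast
  have N: "\<And>x y. N (x + y) \<le> N x + N y" using assms by (auto simp: is_norm_def)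
  have le: "N x \<le> N y + C * dist x y" for x y
  proof -
    have "N x \<le> N y + N (x - y)" using N[of y "x - y"] by simp
    also have "N (x - y) \<le> C * norm (x - y)"
      by (rule C(2)) (metis component_le_norm_cart)
    finally show ?thesis by (simp add: dist_norm)
  qed
  have "C-lipschitz_on A N"
  proof (rule lipschitz_onI)
    fix x y assume "x \<in> A" "y \<in> A"
    show "dist (N x) (N y) \<le> C * dist x y"
      using le[of x y] le[of y x] by (simp add: dist_real_def dist_commute abs_le_iff)
  qed (use C in simp)
  then show ?thesis by (rule lipschitz_on_continuous_on)
qed

text \<open>Compactness of the Euclidean unit sphere: N attains its minimum there, which is positive
  by definiteness, and its reciprocal is the constant.\<close>

lemma is_norm_coordinate_le:
  fixes N :: "real^'n \<Rightarrow> real"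
  assumes "is_norm N"
  shows "\<exists>c>0. \<forall>x j. \<bar>x $ j\<bar> \<le> c * N x"
proof -
  have N: "\<And>x. 0 \<le> N x" "\<And>x. N x = 0 \<longleftrightarrow> x = 0" "\<And>c x. N (c *\<^sub>R x) = \<bar>c\<bar> * N x"
    using assms by (auto simp: is_norm_def)
  have "\<exists>x\<in>sphere 0 1. \<forall>y\<in>sphere (0::real^'n) 1. N x \<le> N y"
    by (rule continuous_attains_inf) (auto intro: is_norm_continuous_on assms)
  then obtain x0 :: "real^'n" where x0: "norm x0 = 1" "\<And>y. norm y = 1 \<Longrightarrow> N x0 \<le> N y" by auto
  have pos: "N x0 > 0" using x0(1) N(1)[of x0] N(2)[of x0] by (cases "N x0 = 0") auto
  have "\<bar>x $ j\<bar> \<le> (1 / N x0) * N x" for x j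
  proof (cases "x = 0")
    case False
    have "N x0 \<le> N ((1 / norm x) *\<^sub>R x)" using False by (intro x0(2)) simp
    also have "\<dots> = N x / norm x" by (subst N(3)) simp
    finally have "norm x * N x0 \<le> N x" using False by (simp add: field_simps)
    moreover have "\<bar>x $ j\<bar> \<le> norm x" by (rule component_le_norm_cart)
    ultimately have "\<bar>x $ j\<bar> * N x0 \<le> N x"
      using pos by (meson mult_right_mono order.trans less_imp_le)
    then show ?thesis using pos by (simp add: pos_le_divide_eq)
  qed (use N(1) pos in simp)
  then show ?thesis using pos by (intro exI[of _ "1 / N x0"]) auto
qed

section \<open>The Pareto intensity\<close>

lemma sets_pareto_intensity [measurable_cong]:
  "sets (pareto_intensity \<alpha>) = sets (restrict_space borel {0<..})"
  unfolding pareto_intensity_def by (simp add: sets_restrict_space)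

lemma space_pareto_intensity [simp]: "space (pareto_intensity \<alpha>) = {0<..}"
  unfolding pareto_intensity_def by (simp add: space_restrict_space)

lemma measurable_pareto_intensity_borel:
  "f \<in> borel \<rightarrow>\<^sub>M L \<Longrightarrow> f \<in> pareto_intensity \<alpha> \<rightarrow>\<^sub>M L"
  by (subst measurable_cong_sets[OF sets_pareto_intensity refl]) (rule measurable_restrict_space1)

lemma sigma_finite_pareto_intensity: "sigma_finite_measure (pareto_intensity \<alpha>)"
proof -
  interpret sigma_finite_measure "restrict_space lborel {0<..} :: real measure"
    by (rule sigma_finite_measure_restrict_space) (auto intro: lborel.sigma_finite_measure_axioms)
  have "(\<lambda>u. ennreal (\<alpha> * u powr (- \<alpha> - 1))) \<in> borel_measurable (restrict_space lborel {0<..})"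
    by (intro measurable_restrict_space1) measurable
  then show ?thesis
    unfolding pareto_intensity_def by (subst sigma_finite_iff_density_finite) auto
qed

lemma nn_integral_pareto_intensity:
  assumes [measurable]: "f \<in> borel_measurable borel"
  shows "(\<integral>\<^sup>+u. f u \<partial>pareto_intensity \<alpha>)
    = (\<integral>\<^sup>+u. ennreal (\<alpha> * u powr (- \<alpha> - 1)) * f u * indicator {0<..} u \<partial>lborel)"
proof -
  have "(\<lambda>u. ennreal (\<alpha> * u powr (- \<alpha> - 1))) \<in> borel_measurable (restrict_space lborel {0<..})"
    "f \<in> borel_measurable (restrict_space lborel {0<..})"
    by (auto intro!: measurable_restrict_space1)
  then show ?thesis
    unfolding pareto_intensity_def
    by (simp add: nn_integral_density nn_integral_restrict_space)
qed

text \<open>The substitution u -> c u contributes c from Lebesgue measure and c^(-\<alpha>-1) from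
  the density. Every homogeneity of degree -\<alpha> below goes back to this.\<close>

lemma nn_integral_pareto_intensity_scale:
  assumes [measurable]: "f \<in> borel_measurable borel" and c: "0 < c"
  shows "(\<integral>\<^sup>+u. f (c * u) \<partial>pareto_intensity \<alpha>) = ennreal (c powr \<alpha>) * (\<integral>\<^sup>+u. f u \<partial>pareto_intensity \<alpha>)"
proof -
  have "(\<integral>\<^sup>+u. f u \<partial>pareto_intensity \<alpha>)
      = ennreal c * (\<integral>\<^sup>+u. ennreal (\<alpha> * (c * u) powr (- \<alpha> - 1)) * f (c * u) * indicator {0<..} (c * u) \<partial>lborel)"
    using c by (subst nn_integral_pareto_intensity, simp,
        subst nn_integral_real_affine[where c=c and t=0]) auto
  also have "\<dots> = ennreal c * (\<integral>\<^sup>+u. ennreal (c powr (- \<alpha> - 1)) *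
      (ennreal (\<alpha> * u powr (- \<alpha> - 1)) * f (c * u) * indicator {0<..} u) \<partial>lborel)"
  proof (rule arg_cong[where f="(*) (ennreal c)"], rule nn_integral_cong)
    fix u :: real
    have "ennreal (\<alpha> * (c * u) powr (- \<alpha> - 1)) = ennreal (c powr (- \<alpha> - 1)) * ennreal (\<alpha> * u powr (- \<alpha> - 1))"
      if "u > 0"
    proof -
      have "\<alpha> * (c * u) powr (- \<alpha> - 1) = c powr (- \<alpha> - 1) * (\<alpha> * u powr (- \<alpha> - 1))"
        using that c by (simp add: powr_mult)
      then show ?thesis by (simp only: ennreal_mult' powr_ge_zero)
    qed
    then show "ennreal (\<alpha> * (c * u) powr (- \<alpha> - 1)) * f (c * u) * indicator {0<..} (c * u) =
      ennreal (c powr (- \<alpha> - 1)) * (ennreal (\<alpha> * u powr (- \<alpha> - 1)) * f (c * u) * indicator {0<..} u)"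
      using c by (cases "u > 0") (auto simp: mult_ac zero_less_mult_iff)
  qed
  also have "\<dots> = (ennreal c * ennreal (c powr (- \<alpha> - 1))) * (\<integral>\<^sup>+u. f (c * u) \<partial>pareto_intensity \<alpha>)"
    by (subst nn_integral_cmult) (simp_all add: nn_integral_pareto_intensity mult_ac)
  also have "ennreal c * ennreal (c powr (- \<alpha> - 1)) = ennreal (c powr (- \<alpha>))"
    using c by (subst ennreal_mult'[symmetric]) (auto simp: powr_diff)
  finally have "ennreal (c powr \<alpha>) * (\<integral>\<^sup>+u. f u \<partial>pareto_intensity \<alpha>) =
      (ennreal (c powr \<alpha>) * ennreal (c powr (- \<alpha>))) * (\<integral>\<^sup>+u. f (c * u) \<partial>pareto_intensity \<alpha>)"
    by (simp add: mult_ac)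
  also have "ennreal (c powr \<alpha>) * ennreal (c powr (- \<alpha>)) = 1"
    using c by (subst ennreal_mult'[symmetric]) (auto simp: powr_minus)
  finally show ?thesis by simp
qed

lemma emeasure_pareto_intensity_singleton: "emeasure (pareto_intensity \<alpha>) {a} = 0"
proof (cases "0 < a")
  case True
  then have "{a} \<in> sets (pareto_intensity \<alpha>)"
    unfolding sets_pareto_intensity by (subst sets_restrict_space_iff) auto
  then have "emeasure (pareto_intensity \<alpha>) {a} = (\<integral>\<^sup>+u. indicator {a} u \<partial>pareto_intensity \<alpha>)"
    by simp
  also have "\<dots> = (\<integral>\<^sup>+u. ennreal (\<alpha> * a powr (- \<alpha> - 1)) * indicator {a} u \<partial>lborel)"
    using True by (subst nn_integral_pareto_intensity) (auto intro!: nn_integral_cong simp: indicator_def)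
  also have "\<dots> = 0" by (subst nn_integral_cmult) auto
  finally show ?thesis .
next
  case False
  \<comment> \<open>The space is the open half-line, so this singleton is not measurable and
    \<open>emeasure\<close> returns its default 0.\<close>
  have "{a} \<notin> sets (pareto_intensity \<alpha>)"
    using False sets.sets_into_space[of "{a}" "pareto_intensity \<alpha>"] by auto
  then show ?thesis by (rule emeasure_notin_sets)
qed

lemma pareto_intensity_tail:
  assumes \<alpha>: "0 < \<alpha>" and r: "0 < r" and b: "0 \<le> b"
  shows "(\<integral>\<^sup>+u. indicator {u. r < u * b} u \<partial>pareto_intensity \<alpha>) = ennreal ((b / r) powr \<alpha>)"
proof (cases "b = 0")
  case False
  \<comment> \<open>The cut-off point in u. Closing the half-line at \<open>?a\<close> costs a null
    set, and \<open>max u ?a\<close> keeps the integrand away from the singularity at 0 without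
    changing it on the half-line.\<close>
  let ?a = "r / b"
  have a: "?a > 0" using False r b by simp
  have "(\<integral>\<^sup>+u. indicator {u. r < u * b} u \<partial>pareto_intensity \<alpha>)
      = (\<integral>\<^sup>+u. ennreal (\<alpha> * max u ?a powr (- \<alpha> - 1)) * indicator {?a..} u \<partial>lborel)"
  proof (subst nn_integral_pareto_intensity)
    show "(\<integral>\<^sup>+u. ennreal (\<alpha> * u powr (- \<alpha> - 1)) * indicator {u. r < u * b} u * indicator {0<..} u \<partial>lborel)
      = (\<integral>\<^sup>+u. ennreal (\<alpha> * max u ?a powr (- \<alpha> - 1)) * indicator {?a..} u \<partial>lborel)"
    proof (rule nn_integral_cong_AE)
      show "AE u in lborel. ennreal (\<alpha> * u powr (- \<alpha> - 1)) * indicator {u. r < u * b} u * indicator {0<..} u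
        = ennreal (\<alpha> * max u ?a powr (- \<alpha> - 1)) * indicator {?a..} u"
        using AE_lborel_singleton[of ?a]
      proof eventually_elim
        case (elim u)
        have "r < u * b \<longleftrightarrow> ?a < u" using False b by (simp add: field_simps)
        then show ?case using elim a by (cases "?a < u") (auto simp: indicator_def max_def)
      qed
    qed
  qed measurable
  also have "\<dots> = ennreal (0 - (- (?a powr (- \<alpha>))))"
  proof (rule nn_integral_FTC_atLeast)
    fix x assume x: "?a \<le> x"
    then have "x > 0" using a by simp
    then have "((\<lambda>x. - (x powr - \<alpha>)) has_real_derivative \<alpha> * x powr (- \<alpha> - 1)) (at x)"
      by (auto intro!: derivative_eq_intros)
    then show "((\<lambda>x. - (x powr - \<alpha>)) has_real_derivative \<alpha> * max x ?a powr (- \<alpha> - 1)) (at x)"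
      using x by (simp add: max_def)
  next
    show "((\<lambda>x. - (x powr - \<alpha>)) \<longlongrightarrow> 0) at_top"
      using tendsto_neg_powr[of "-\<alpha>" "\<lambda>x. x" at_top] \<alpha>
      by (subst tendsto_minus_cancel_left[symmetric]) (simp add: filterlim_ident)
  qed (use \<alpha> in auto)
  also have "\<dots> = ennreal ((b / r) powr \<alpha>)"
    using r b False by (simp add: powr_minus powr_divide field_simps)
  finally show ?thesis .
qed (use r in simp)

section \<open>Poisson point processes\<close>

text \<open>The function exp(-m) on [0, \<infinity>]. The case split is forced, since
  \<open>enn2real \<infinity> = 0\<close> would turn infinite mass into probability 1.\<close>

definition void_prob :: "ennreal \<Rightarrow> real" where
  "void_prob m = (if m = \<infinity> then 0 else exp (- enn2real m))"

lemma void_prob_of_nat_mult: "1 \<le> k \<Longrightarrow> void_prob (of_nat k * m) = void_prob m ^ k"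
  by (auto simp: void_prob_def enn2real_mult ennreal_mult_eq_top_iff exp_of_nat_mult[symmetric])

context
  fixes M :: "'a measure" and \<mu> :: "'e measure" and p :: "nat \<Rightarrow> 'a \<Rightarrow> 'e"
  assumes ppp: "poisson_point_process M \<mu> p"
begin

interpretation prob_space M
  using ppp by (simp add: poisson_point_process_def)

lemma poisson_point_measurable: "p i \<in> M \<rightarrow>\<^sub>M \<mu>"
  using ppp by (simp add: poisson_point_process_def)

lemma point_count_measurable:
  assumes [measurable]: "B \<in> sets \<mu>"
  shows "point_count p B \<in> borel_measurable M"
proof -
  note [measurable] = poisson_point_measurable
  show ?thesis unfolding point_count_def by measurable
qed

lemma prob_point_count_eq:
  assumes "B \<in> sets \<mu>" "emeasure \<mu> B < \<infinity>"
  shows "prob {\<omega> \<in> space M. point_count p B \<omega> = of_nat n} = measure \<mu> B ^ n / fact n * exp (- measure \<mu> B)"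
  using ppp assms by (simp add: poisson_point_process_def)

lemma AE_point_count_infinite:
  assumes "B \<in> sets \<mu>" "emeasure \<mu> B = \<infinity>"
  shows "AE \<omega> in M. point_count p B \<omega> = \<infinity>"
  using ppp assms by (simp add: poisson_point_process_def)

text \<open>A Poisson process prescribes the probabilities of the finite counts only. These sum to 1
  by the exponential series, which leaves nothing for the value \<infinity>.\<close>

lemma AE_point_count_nat:
  assumes B [measurable]: "B \<in> sets \<mu>" and fin: "emeasure \<mu> B < \<infinity>"
  shows "AE \<omega> in M. \<exists>n. point_count p B \<omega> = of_nat n"
proof -
  note [measurable] = point_count_measurable[OF B]
  let ?m = "measure \<mu> B"
  let ?A = "\<lambda>n. {\<omega> \<in> space M. point_count p B \<omega> = of_nat n}"
  have "(\<lambda>n. ?m ^ n /\<^sub>R fact n * exp (- ?m)) sums (exp ?m * exp (- ?m))"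
    by (intro sums_mult2 exp_converges)
  then have "(\<lambda>n. prob (?A n)) sums 1"
    by (simp add: prob_point_count_eq[OF B fin] exp_minus divide_inverse mult_ac)
  moreover have "(\<lambda>n. prob (?A n)) sums prob (\<Union>n. ?A n)"
    by (rule finite_measure_UNION) (auto simp: disjoint_family_on_def)
  ultimately have "prob (\<Union>n. ?A n) = 1" by (rule sums_unique2[rotated])
  then have "AE \<omega> in M. \<omega> \<in> (\<Union>n. ?A n)" by (subst (asm) prob_eq_1) auto
  then show ?thesis by eventually_elim auto
qed

lemma nn_integral_point_count:
  assumes B [measurable]: "B \<in> sets \<mu>"
  shows "(\<integral>\<^sup>+\<omega>. point_count p B \<omega> \<partial>M) = emeasure \<mu> B"
proof (cases "emeasure \<mu> B = \<infinity>")
  case True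
  have "(\<integral>\<^sup>+\<omega>. point_count p B \<omega> \<partial>M) = (\<integral>\<^sup>+\<omega>. \<infinity> \<partial>M)"
    using AE_point_count_infinite[OF B True] by (rule nn_integral_cong_AE)
  then show ?thesis using True by (simp add: emeasure_space_1)
next
  case False
  note [measurable] = point_count_measurable[OF B]
  from False have fin: "emeasure \<mu> B < \<infinity>" by (simp add: less_top[symmetric])
  let ?m = "measure \<mu> B"
  let ?A = "\<lambda>n. {\<omega> \<in> space M. point_count p B \<omega> = of_nat n}"
  have "(\<integral>\<^sup>+\<omega>. point_count p B \<omega> \<partial>M) = (\<integral>\<^sup>+\<omega>. (\<Sum>n. of_nat n * indicator (?A n) \<omega>) \<partial>M)"
  proof (rule nn_integral_cong_AE)
    show "AE \<omega> in M. point_count p B \<omega> = (\<Sum>n. of_nat n * indicator (?A n) \<omega>)"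
      using AE_point_count_nat[OF B fin] AE_space
    proof eventually_elim
      case (elim \<omega>)
      then obtain k where k: "point_count p B \<omega> = of_nat k" by auto
      have "(\<Sum>n. of_nat n * indicator (?A n) \<omega>) = (\<Sum>n\<in>{k}. of_nat n * indicator (?A n) \<omega> :: ennreal)"
        using k by (intro suminf_finite) auto
      then show ?case using k elim by simp
    qed
  qed
  also have "\<dots> = (\<Sum>n. of_nat n * emeasure M (?A n))"
    by (subst nn_integral_suminf) (auto simp: nn_integral_cmult)
  also have "\<dots> = (\<Sum>n. ennreal (real n * (?m ^ n / fact n * exp (- ?m))))"
    by (simp only: emeasure_eq_measure prob_point_count_eq[OF B fin])
       (simp add: ennreal_mult[symmetric] ennreal_of_nat_eq_real_of_nat)
  also have "\<dots> = ennreal ?m"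
  proof -
    \<comment> \<open>Term n of the exponential series becomes term n + 1 of the Poisson mean; term
      0 of the mean vanishes.\<close>
    have "(\<lambda>n. ?m * exp (- ?m) * (?m ^ n /\<^sub>R fact n)) sums (?m * exp (- ?m) * exp ?m)"
      by (intro sums_mult exp_converges)
    moreover have "?m * exp (- ?m) * (?m ^ n /\<^sub>R fact n) = real (Suc n) * (?m ^ Suc n / fact (Suc n) * exp (- ?m))" for n
    proof -
      have "(fact (Suc n) :: real) = real (Suc n) * fact n" by (rule fact_Suc)
      then show ?thesis by (simp add: divide_inverse mult_ac del: of_nat_Suc fact_Suc)
    qed
    moreover have "?m * exp (- ?m) * exp ?m = ?m" by (simp add: exp_minus)
    ultimately have "(\<lambda>n. real (Suc n) * (?m ^ Suc n / fact (Suc n) * exp (- ?m))) sums ?m"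
      by (simp only:)
    then have "(\<lambda>n. real n * (?m ^ n / fact n * exp (- ?m))) sums ?m"
      by (subst (asm) sums_Suc_iff) simp
    then show ?thesis by (intro suminf_ennreal_eq) auto
  qed
  also have "\<dots> = emeasure \<mu> B" using False by (simp add: emeasure_eq_ennreal_measure)
  finally show ?thesis .
qed

text \<open>For integers, c restricted to c \<ge> 2 is c minus the indicator of c = 1, so the value
  is the mean minus P(c = 1). It is at most the square of the mean, which is why two simultaneous
  large storms are negligible.\<close>

lemma nn_integral_point_count_ge_2:
  assumes B [measurable]: "B \<in> sets \<mu>" and fin: "emeasure \<mu> B < \<infinity>"
  shows "(\<integral>\<^sup>+\<omega>. point_count p B \<omega> * indicator {2..} (point_count p B \<omega>) \<partial>M)
    = ennreal (measure \<mu> B - measure \<mu> B * exp (- measure \<mu> B))"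
    (is "?L = _")
proof -
  note [measurable] = point_count_measurable[OF B]
  let ?m = "measure \<mu> B"
  let ?A = "{\<omega> \<in> space M. point_count p B \<omega> = of_nat 1}"
  have "ennreal ?m = (\<integral>\<^sup>+\<omega>. point_count p B \<omega> \<partial>M)"
    using fin by (simp add: nn_integral_point_count emeasure_eq_ennreal_measure less_top)
  also have "\<dots> = (\<integral>\<^sup>+\<omega>. point_count p B \<omega> * indicator {2..} (point_count p B \<omega>) + indicator ?A \<omega> \<partial>M)"
  proof (rule nn_integral_cong_AE)
    show "AE \<omega> in M. point_count p B \<omega>
      = point_count p B \<omega> * indicator {2..} (point_count p B \<omega>) + indicator ?A \<omega>"
      using AE_point_count_nat[OF B fin] AE_space
    proof eventually_elim
      case (elim \<omega>)
      then obtain k where k: "point_count p B \<omega> = of_nat k" by auto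
      have two: "(2::ennreal) \<le> of_nat k \<longleftrightarrow> 2 \<le> k"
        using of_nat_le_iff[of 2 k, where 'a=ennreal] by simp
      consider "k = 0" | "k = 1" | "k \<ge> 2" by linarith
      then show ?case using elim k two by cases (auto simp: indicator_def)
    qed
  qed
  also have "\<dots> = ?L + emeasure M ?A"
    by (subst nn_integral_add) auto
  also have "emeasure M ?A = ennreal (?m * exp (- ?m))"
    using prob_point_count_eq[OF B fin, of 1] by (simp add: emeasure_eq_measure)
  finally have eq: "ennreal ?m = ?L + ennreal (?m * exp (- ?m))" .
  have "?L = ennreal ?m - ennreal (?m * exp (- ?m))"
    unfolding eq by simp
  then show ?thesis by (simp add: ennreal_minus)
qed

lemma prob_no_points:
  assumes B [measurable]: "B \<in> sets \<mu>"
  shows "prob {\<omega> \<in> space M. \<forall>i. p i \<omega> \<notin> B} = void_prob (emeasure \<mu> B)"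
proof -
  note [measurable] = point_count_measurable[OF B]
  have eq: "{\<omega> \<in> space M. \<forall>i. p i \<omega> \<notin> B} = {\<omega> \<in> space M. point_count p B \<omega> = of_nat 0}"
    by (auto simp: point_count_def suminf_eq_zero_iff[OF summableI] indicator_def fun_eq_iff split: if_splits)
  show ?thesis
  proof (cases "emeasure \<mu> B = \<infinity>")
    case True
    have "AE \<omega> in M. \<not> point_count p B \<omega> = of_nat 0"
      using AE_point_count_infinite[OF B True] by eventually_elim auto
    then have "prob {\<omega> \<in> space M. point_count p B \<omega> = of_nat 0} = 0"
      by (subst prob_eq_0) auto
    then show ?thesis unfolding eq using True by (simp add: void_prob_def)
  next
    case False
    then show ?thesis unfolding eq
      using prob_point_count_eq[OF B, of 0] by (simp add: void_prob_def measure_def less_top)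
  qed
qed

text \<open>Counting measure on the indices times the probability measure, mapped by (i, \<omega>)
  -> \<open>p i \<omega>\<close>, assigns to each measurable set its mean number of points. It
  therefore equals \<mu>, and the formula is a change of variables.\<close>

lemma campbell:
  assumes [measurable]: "h \<in> borel_measurable \<mu>"
  shows "(\<integral>\<^sup>+\<omega>. (\<Sum>i. h (p i \<omega>)) \<partial>M) = (\<integral>\<^sup>+x. h x \<partial>\<mu>)"
proof -
  note [measurable] = poisson_point_measurable
  let ?C = "count_space (UNIV :: nat set)"
  have m [measurable]: "(\<lambda>(i, \<omega>). p i \<omega>) \<in> ?C \<Otimes>\<^sub>M M \<rightarrow>\<^sub>M \<mu>"
    by (rule measurable_pair_measure_countable1) auto
  have it: "(\<integral>\<^sup>+x. g x \<partial>distr (?C \<Otimes>\<^sub>M M) \<mu> (\<lambda>(i, \<omega>). p i \<omega>)) = (\<integral>\<^sup>+\<omega>. (\<Sum>i. g (p i \<omega>)) \<partial>M)"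
    if [measurable]: "g \<in> borel_measurable \<mu>" for g
    by (simp add: nn_integral_distr nn_integral_fst[symmetric] nn_integral_count_space_nat
        nn_integral_suminf[symmetric])
  have "distr (?C \<Otimes>\<^sub>M M) \<mu> (\<lambda>(i, \<omega>). p i \<omega>) = \<mu>"
  proof (rule measure_eqI)
    fix B assume "B \<in> sets (distr (?C \<Otimes>\<^sub>M M) \<mu> (\<lambda>(i, \<omega>). p i \<omega>))"
    then have B [measurable]: "B \<in> sets \<mu>" by simp
    have "emeasure (distr (?C \<Otimes>\<^sub>M M) \<mu> (\<lambda>(i, \<omega>). p i \<omega>)) B = (\<integral>\<^sup>+\<omega>. point_count p B \<omega> \<partial>M)"
      using it[of "indicator B"] by (simp add: point_count_def)
    then show "emeasure (distr (?C \<Otimes>\<^sub>M M) \<mu> (\<lambda>(i, \<omega>). p i \<omega>)) B = emeasure \<mu> B"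
      by (simp add: nn_integral_point_count)
  qed simp
  with it[of h] show ?thesis by simp
qed

end

section \<open>Path spaces and the intensity of the storms\<close>

lemma borel_measurable_nn_integral_count_space:
  fixes f :: "'i::countable \<Rightarrow> 'a \<Rightarrow> ennreal"
  assumes "\<And>t. f t \<in> borel_measurable L"
  shows "(\<lambda>x. \<integral>\<^sup>+t. f t x \<partial>count_space UNIV) \<in> borel_measurable L"
proof -
  interpret sigma_finite_measure "count_space UNIV :: 'i measure"
    by (rule sigma_finite_measure_count_space)
  show ?thesis
  proof (rule borel_measurable_nn_integral)
    show "(\<lambda>(x, t). f t x) \<in> borel_measurable (L \<Otimes>\<^sub>M count_space UNIV)"
      using assms measurable_compose_countable[of "\<lambda>t x. f t (fst x)" "L \<Otimes>\<^sub>M count_space UNIV" borel snd]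
      by (simp add: split_beta')
  qed
qed

lemma borel_measurable_vec_nth_fun [measurable]: "(\<lambda>x::real^'n. x $ j) \<in> borel_measurable borel"
  by (intro borel_measurable_continuous_onI continuous_intros)

lemma space_nonneg_borel [simp]: "space nonneg_borel = {x::real^'n. \<forall>j. 0 \<le> x $ j}"
  by (simp add: nonneg_borel_def space_restrict_space)

lemma space_nonneg_path_space: "\<theta> \<in> space nonneg_path_space \<longleftrightarrow> (\<forall>t j. 0 \<le> \<theta> t $ j)"
  by (auto simp: space_PiM PiE_def Pi_def)

lemma measurable_nonneg_path_spaceI:
  assumes "\<And>t. (\<lambda>x. f x t) \<in> L \<rightarrow>\<^sub>M borel" "\<And>x t j. x \<in> space L \<Longrightarrow> 0 \<le> f x t $ j"
  shows "f \<in> L \<rightarrow>\<^sub>M nonneg_path_space"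
  unfolding nonneg_borel_def
  by (rule measurable_PiM_single'[where f="\<lambda>t x. f x t", simplified])
     (use assms in \<open>auto intro!: measurable_restrict_space2 simp: space_restrict_space\<close>)

lemma measurable_nonneg_path_component [measurable]:
  "(\<lambda>\<theta>. \<theta> t) \<in> nonneg_path_space \<rightarrow>\<^sub>M (borel :: (real^'n) measure)"
proof -
  have "(\<lambda>\<theta>. \<theta> t) \<in> nonneg_path_space \<rightarrow>\<^sub>M (nonneg_borel :: (real^'n) measure)" by measurable
  then show ?thesis unfolding nonneg_borel_def by (subst (asm) measurable_restrict_space2_iff) auto
qed

lemma measurable_nonneg_path_to_path:
  "(\<lambda>\<theta>. \<theta>) \<in> nonneg_path_space \<rightarrow>\<^sub>M (path_space :: (int \<Rightarrow> real^'n) measure)"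
  by (rule measurable_PiM_single'[where f="\<lambda>t \<theta>. \<theta> t", simplified]) auto

locale storm_process =
  fixes N :: "real ^ 'n \<Rightarrow> real" and \<alpha> :: real and M :: "'a measure"
    and \<Theta> :: "int \<Rightarrow> 'a \<Rightarrow> real ^ 'n"
  assumes norm: "is_norm N"
    and \<alpha>: "0 < \<alpha>"
    and \<Theta>: "nonneg_process M \<Theta>"
    and summable: "AE \<omega> in M. (\<lambda>t. N (\<Theta> t \<omega>) powr \<alpha>) summable_on UNIV \<and>
                     0 < (\<Sum>\<^sub>\<infinity>t. N (\<Theta> t \<omega>) powr \<alpha>)"
begin

sublocale M: prob_space M
  using \<Theta> by (simp add: nonneg_process_def)

lemma norm_nonneg [simp]: "0 \<le> N x"
  and norm_zero [simp]: "N 0 = 0"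
  and norm_scaleR: "N (c *\<^sub>R x) = \<bar>c\<bar> * N x"
  using norm by (auto simp: is_norm_def)

lemma norm_measurable [measurable]: "N \<in> borel_measurable borel"
  by (intro borel_measurable_continuous_onI is_norm_continuous_on norm)

lemma \<Theta>_measurable [measurable]: "(\<lambda>\<omega> t. \<Theta> t \<omega>) \<in> M \<rightarrow>\<^sub>M nonneg_path_space"
  using \<Theta> by (simp add: nonneg_process_def)

text \<open>The sum is kept in [0, \<infinity>], so that measurability and shift invariance hold for
  every path; finiteness and positivity enter only almost surely.\<close>

definition alpha_sum :: "(int \<Rightarrow> real ^ 'n) \<Rightarrow> ennreal" where
  "alpha_sum \<theta> = (\<integral>\<^sup>+t. ennreal (N (\<theta> t) powr \<alpha>) \<partial>count_space UNIV)"

lemma infsum_eq_alpha_sum: "(\<Sum>\<^sub>\<infinity>t. N (\<theta> t) powr \<alpha>) = enn2real (alpha_sum \<theta>)"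
  unfolding alpha_sum_def by (rule infsum_eq_enn2real_nn_integral) simp

lemma alpha_sum_measurable [measurable]: "alpha_sum \<in> borel_measurable nonneg_path_space"
  unfolding alpha_sum_def[abs_def] by (rule borel_measurable_nn_integral_count_space) measurable

lemma alpha_sum_measurable_path [measurable]: "alpha_sum \<in> borel_measurable path_space"
  unfolding alpha_sum_def[abs_def] by (rule borel_measurable_nn_integral_count_space) measurable

lemma alpha_norm_eq: "alpha_norm N \<alpha> \<theta> = enn2real (alpha_sum \<theta>) powr (1 / \<alpha>)"
  by (simp add: alpha_norm_def infsum_eq_alpha_sum)

lemma alpha_norm_measurable [measurable]: "alpha_norm N \<alpha> \<in> borel_measurable nonneg_path_space"
  unfolding alpha_norm_eq[abs_def] by measurable

lemma alpha_norm_nonneg [simp]: "0 \<le> alpha_norm N \<alpha> \<theta>"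
  by (simp add: alpha_norm_def)

lemma alpha_sum_shift: "(\<integral>\<^sup>+t. ennreal (N (\<theta> (s + t)) powr \<alpha>) \<partial>count_space UNIV) = alpha_sum \<theta>"
  unfolding alpha_sum_def
  by (rule nn_integral_bij_count_space[where g="\<lambda>t. s + t"])
     (auto intro!: bij_betw_byWitness[where f'="\<lambda>t. t - s"])

lemma AE_alpha_sum: "AE \<omega> in M. 0 < alpha_sum (\<lambda>t. \<Theta> t \<omega>) \<and> alpha_sum (\<lambda>t. \<Theta> t \<omega>) < \<infinity>"
  using summable
proof eventually_elim
  case (elim \<omega>)
  have "alpha_sum (\<lambda>t. \<Theta> t \<omega>) < \<infinity>"
    using elim infsum_eq_enn2real_nn_integral(2)[of "\<lambda>t. N (\<Theta> t \<omega>) powr \<alpha>"]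
    by (simp add: alpha_sum_def)
  moreover have "0 < enn2real (alpha_sum (\<lambda>t. \<Theta> t \<omega>))"
    using elim infsum_eq_alpha_sum[of "\<lambda>t. \<Theta> t \<omega>"] by simp
  ultimately show ?case by (simp add: enn2real_positive_iff)
qed

definition storm :: "real \<times> int \<times> (int \<Rightarrow> real ^ 'n) \<Rightarrow> int \<Rightarrow> real ^ 'n" where
  "storm = (\<lambda>(u, t, \<theta>) s. (u / alpha_norm N \<alpha> \<theta>) *\<^sub>R \<theta> (s + t))"

abbreviation "\<mu> \<equiv> intensity \<alpha> M \<Theta>"

lemma storm_scale: "storm (c * u, q) s = c *\<^sub>R storm (u, q) s"
  by (simp add: storm_def split_beta)

lemma storm_shift: "storm (u, t + h, \<theta>) s = storm (u, t, \<theta>) (s + h)"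
  by (simp add: storm_def add_ac)

lemma sets_intensity [measurable_cong]:
  "sets \<mu> = sets (restrict_space borel {0<..} \<Otimes>\<^sub>M (count_space UNIV \<Otimes>\<^sub>M nonneg_path_space))"
  unfolding intensity_def by (intro sets_pair_measure_cong sets_pareto_intensity refl) simp

lemma space_intensity: "space \<mu> = {0<..} \<times> UNIV \<times> space nonneg_path_space"
  by (simp add: intensity_def space_pair_measure)

lemma storm_nonneg: "p \<in> space \<mu> \<Longrightarrow> 0 \<le> storm p s $ j"
  by (auto simp: space_intensity space_nonneg_path_space storm_def)

lemma fst_intensity_measurable [measurable]: "fst \<in> borel_measurable \<mu>"
proof -
  have "fst \<in> \<mu> \<rightarrow>\<^sub>M restrict_space borel {0<..}"
    by (subst measurable_cong_sets[OF sets_intensity refl]) (rule measurable_fst)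
  then show ?thesis by (subst (asm) measurable_restrict_space2_iff) auto
qed

lemma snd_intensity_measurable [measurable]: "snd \<in> \<mu> \<rightarrow>\<^sub>M count_space UNIV \<Otimes>\<^sub>M nonneg_path_space"
  by (subst measurable_cong_sets[OF sets_intensity refl]) (rule measurable_snd)

lemma shifted_component_measurable [measurable]:
  "(\<lambda>q. snd q (s + fst q)) \<in> count_space (UNIV::int set) \<Otimes>\<^sub>M nonneg_path_space \<rightarrow>\<^sub>M (borel :: (real^'n) measure)"
proof -
  have "(\<lambda>q. snd q (s + t)) \<in> count_space (UNIV::int set) \<Otimes>\<^sub>M nonneg_path_space \<rightarrow>\<^sub>M (borel :: (real^'n) measure)" for t
    by measurable
  then show ?thesis
    by (rule measurable_compose_countable) measurable
qed

lemma unit_storm_component_measurable [measurable]: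
  "(\<lambda>q. storm (1, q) s) \<in> count_space UNIV \<Otimes>\<^sub>M nonneg_path_space \<rightarrow>\<^sub>M borel"
  unfolding storm_def split_beta fst_conv snd_conv
  by (intro borel_measurable_scaleR borel_measurable_divide borel_measurable_const
      measurable_compose[OF measurable_snd alpha_norm_measurable] shifted_component_measurable)

lemma storm_component_measurable [measurable]: "(\<lambda>p. storm p s) \<in> \<mu> \<rightarrow>\<^sub>M borel"
proof -
  have eq: "(\<lambda>p. storm p s) = (\<lambda>p. fst p *\<^sub>R storm (1, snd p) s)"
  proof
    fix p show "storm p s = fst p *\<^sub>R storm (1, snd p) s"
      using storm_scale[of "fst p" 1 "snd p" s] by simp
  qed
  show ?thesis unfolding eq
    by (intro borel_measurable_scaleR fst_intensity_measurable
        measurable_compose[OF snd_intensity_measurable unit_storm_component_measurable])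
qed

lemma storm_measurable_nonneg: "storm \<in> \<mu> \<rightarrow>\<^sub>M nonneg_path_space"
  by (rule measurable_nonneg_path_spaceI) (auto simp: storm_nonneg)

lemma storm_measurable [measurable]: "storm \<in> \<mu> \<rightarrow>\<^sub>M path_space"
  using measurable_compose[OF storm_measurable_nonneg measurable_nonneg_path_to_path] by simp

lemma intensity_scale_measurable:
  assumes "0 < c"
  shows "(\<lambda>p. (c * fst p, snd p)) \<in> \<mu> \<rightarrow>\<^sub>M \<mu>"
proof -
  have "(\<lambda>p. c * fst p) \<in> \<mu> \<rightarrow>\<^sub>M restrict_space borel {0<..}"
    using assms by (intro measurable_restrict_space2) (auto simp: space_intensity)
  then show ?thesis
    by (subst measurable_cong_sets[OF refl sets_intensity])
       (intro measurable_Pair snd_intensity_measurable)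
qed

lemma intensity_shift_measurable:
  "(\<lambda>p. (fst p, fst (snd p) + h, snd (snd p))) \<in> \<mu> \<rightarrow>\<^sub>M \<mu>"
proof -
  have "fst \<in> \<mu> \<rightarrow>\<^sub>M restrict_space borel {0<..}"
    by (subst measurable_cong_sets[OF sets_intensity refl]) (rule measurable_fst)
  moreover have "(\<lambda>q. (fst q + h, snd q)) \<in> count_space UNIV \<Otimes>\<^sub>M nonneg_path_space
      \<rightarrow>\<^sub>M count_space UNIV \<Otimes>\<^sub>M (nonneg_path_space :: (int \<Rightarrow> real ^ 'n) measure)"
    by measurable
  ultimately have "(\<lambda>p. (fst p, (\<lambda>q. (fst q + h, snd q)) (snd p)))
      \<in> \<mu> \<rightarrow>\<^sub>M restrict_space borel {0<..} \<Otimes>\<^sub>M (count_space UNIV \<Otimes>\<^sub>M nonneg_path_space)"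
    by (rule measurable_Pair[OF _ measurable_compose[OF snd_intensity_measurable]])
  then show ?thesis
    by (subst measurable_cong_sets[OF refl sets_intensity]) simp
qed

section \<open>Integration against the intensity: shift invariance, homogeneity, marginal
  tails\<close>

text \<open>The order of integration is chosen for the later computations: for a fixed path and
  shift the Pareto integral over u is explicit, and summing over t then meets the normalisation by
  the \<alpha>-norm.\<close>

lemma nn_integral_intensity:
  assumes [measurable]: "f \<in> borel_measurable \<mu>"
  shows "(\<integral>\<^sup>+p. f p \<partial>\<mu>)
    = (\<integral>\<^sup>+\<omega>. (\<integral>\<^sup>+t. (\<integral>\<^sup>+u. f (u, t, \<lambda>s. \<Theta> s \<omega>) \<partial>pareto_intensity \<alpha>) \<partial>count_space UNIV) \<partial>M)"
proof -
  let ?L = "distr M nonneg_path_space (\<lambda>\<omega> t. \<Theta> t \<omega>)"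
  interpret P: sigma_finite_measure "pareto_intensity \<alpha>" by (rule sigma_finite_pareto_intensity)
  interpret C: sigma_finite_measure "count_space UNIV :: int measure"
    by (rule sigma_finite_measure_count_space)
  interpret L: prob_space ?L by (rule M.prob_space_distr) measurable
  interpret CL: pair_sigma_finite "count_space UNIV :: int measure" ?L ..
  interpret CL': sigma_finite_measure "count_space (UNIV :: int set) \<Otimes>\<^sub>M ?L"
    by (rule CL.sigma_finite_measure_axioms)
  interpret A: pair_sigma_finite "pareto_intensity \<alpha>" "count_space (UNIV :: int set) \<Otimes>\<^sub>M ?L" ..
  have f: "f \<in> borel_measurable (pareto_intensity \<alpha> \<Otimes>\<^sub>M (count_space UNIV \<Otimes>\<^sub>M ?L))"
    using assms by (simp add: intensity_def)
  have g [measurable]: "(\<lambda>q. \<integral>\<^sup>+u. f (u, q) \<partial>pareto_intensity \<alpha>) \<in> borel_measurable (count_space UNIV \<Otimes>\<^sub>M ?L)"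
    using f by measurable
  have "(\<integral>\<^sup>+p. f p \<partial>\<mu>) = (\<integral>\<^sup>+q. (\<integral>\<^sup>+u. f (u, q) \<partial>pareto_intensity \<alpha>) \<partial>(count_space UNIV \<Otimes>\<^sub>M ?L))"
    unfolding intensity_def by (rule A.nn_integral_snd[symmetric]) (rule f)
  also have "\<dots> = (\<integral>\<^sup>+\<theta>. (\<integral>\<^sup>+t. (\<integral>\<^sup>+u. f (u, t, \<theta>) \<partial>pareto_intensity \<alpha>) \<partial>count_space UNIV) \<partial>?L)"
    by (rule CL.nn_integral_snd[symmetric]) measurable
  also have "\<dots> = (\<integral>\<^sup>+\<omega>. (\<integral>\<^sup>+t. (\<integral>\<^sup>+u. f (u, t, \<lambda>s. \<Theta> s \<omega>) \<partial>pareto_intensity \<alpha>) \<partial>count_space UNIV) \<partial>M)"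
  proof (rule nn_integral_distr)
    show "(\<lambda>\<theta>. \<integral>\<^sup>+t. (\<integral>\<^sup>+u. f (u, t, \<theta>) \<partial>pareto_intensity \<alpha>) \<partial>count_space UNIV) \<in> borel_measurable ?L"
    proof (rule borel_measurable_nn_integral_count_space)
      fix t
      show "(\<lambda>\<theta>. \<integral>\<^sup>+u. f (u, t, \<theta>) \<partial>pareto_intensity \<alpha>) \<in> borel_measurable ?L"
        using measurable_compose[OF _ g, of "\<lambda>\<theta>. (t, \<theta>)" ?L] by simp
    qed
  qed measurable
  finally show ?thesis .
qed

lemma nn_integral_intensity_shift:
  assumes [measurable]: "f \<in> borel_measurable \<mu>"
  shows "(\<integral>\<^sup>+p. (case p of (u, t, \<theta>) \<Rightarrow> f (u, t + h, \<theta>)) \<partial>\<mu>) = (\<integral>\<^sup>+p. f p \<partial>\<mu>)"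
proof -
  note [measurable] = intensity_shift_measurable[of h]
  have "(\<lambda>p. case p of (u, t, \<theta>) \<Rightarrow> f (u, t + h, \<theta>)) = (\<lambda>p. f (fst p, fst (snd p) + h, snd (snd p)))"
    by (auto simp: fun_eq_iff)
  then have [measurable]: "(\<lambda>p. case p of (u, t, \<theta>) \<Rightarrow> f (u, t + h, \<theta>)) \<in> borel_measurable \<mu>"
    by simp
  have sh: "(\<integral>\<^sup>+t. g (t + h) \<partial>count_space UNIV) = (\<integral>\<^sup>+t. g t \<partial>count_space UNIV)" for g :: "int \<Rightarrow> ennreal"
    by (rule nn_integral_bij_count_space[where g="\<lambda>t. t + h"])
       (auto intro!: bij_betw_byWitness[where f'="\<lambda>t. t - h"])
  show ?thesis
    by (simp add: nn_integral_intensity sh[of "\<lambda>t. \<integral>\<^sup>+u. f (u, t, _) \<partial>pareto_intensity \<alpha>"])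
qed

lemma nn_integral_intensity_scale:
  assumes [measurable]: "f \<in> borel_measurable \<mu>" and c: "0 < c"
  shows "(\<integral>\<^sup>+p. f (c * fst p, snd p) \<partial>\<mu>) = ennreal (c powr \<alpha>) * (\<integral>\<^sup>+p. f p \<partial>\<mu>)"
proof -
  have [measurable]: "(\<lambda>p. f (c * fst p, snd p)) \<in> borel_measurable \<mu>"
    using measurable_compose[OF intensity_scale_measurable[OF c] assms(1)] by simp
  have inner: "(\<integral>\<^sup>+u. f (c * u, t, \<theta>) \<partial>pareto_intensity \<alpha>) = ennreal (c powr \<alpha>) * (\<integral>\<^sup>+u. f (u, t, \<theta>) \<partial>pareto_intensity \<alpha>)"
    if "\<theta> \<in> space nonneg_path_space" for t \<theta>
  proof -
    have "(\<lambda>u. f (u, t, \<theta>)) \<in> borel_measurable (restrict_space borel {0<..})"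
      using that by (intro measurable_compose[OF _ assms(1)]) simp
    \<comment> \<open>The scaling rule for the Pareto intensity needs a Borel function on the whole
      line, whereas f is measurable only for u > 0; it is extended by 0.\<close>
    then have m: "(\<lambda>u. f (u, t, \<theta>) * indicator {0<..} u) \<in> borel_measurable borel"
      by (subst (asm) borel_measurable_restrict_space_iff_ennreal) auto
    have 1: "(\<integral>\<^sup>+u. f (u, t, \<theta>) \<partial>pareto_intensity \<alpha>) = (\<integral>\<^sup>+u. f (u, t, \<theta>) * indicator {0<..} u \<partial>pareto_intensity \<alpha>)"
      by (rule nn_integral_cong) simp
    have 2: "(\<integral>\<^sup>+u. f (c * u, t, \<theta>) \<partial>pareto_intensity \<alpha>) = (\<integral>\<^sup>+u. f (c * u, t, \<theta>) * indicator {0<..} (c * u) \<partial>pareto_intensity \<alpha>)"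
      using c by (intro nn_integral_cong) simp
    show ?thesis unfolding 1 2 by (rule nn_integral_pareto_intensity_scale[OF m c])
  qed
  have \<Theta>s: "(\<lambda>s. \<Theta> s \<omega>) \<in> space nonneg_path_space" if "\<omega> \<in> space M" for \<omega>
    using that measurable_space[OF \<Theta>_measurable] by auto
  have gm: "(\<lambda>\<omega>. \<integral>\<^sup>+u. f (u, t, \<lambda>s. \<Theta> s \<omega>) \<partial>pareto_intensity \<alpha>) \<in> borel_measurable M" for t
  proof -
    interpret P: sigma_finite_measure "pareto_intensity \<alpha>" by (rule sigma_finite_pareto_intensity)
    have "(\<lambda>p. (snd p, t, \<lambda>s. \<Theta> s (fst p))) \<in> M \<Otimes>\<^sub>M pareto_intensity \<alpha> \<rightarrow>\<^sub>M \<mu>"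
      by measurable
    from measurable_compose[OF this assms(1)] show ?thesis
      by (intro P.borel_measurable_nn_integral) (simp add: split_beta')
  qed
  have "(\<integral>\<^sup>+p. f (c * fst p, snd p) \<partial>\<mu>)
    = (\<integral>\<^sup>+\<omega>. (\<integral>\<^sup>+t. ennreal (c powr \<alpha>) * (\<integral>\<^sup>+u. f (u, t, \<lambda>s. \<Theta> s \<omega>) \<partial>pareto_intensity \<alpha>) \<partial>count_space UNIV) \<partial>M)"
    by (subst nn_integral_intensity, simp) (auto intro!: nn_integral_cong simp: inner \<Theta>s)
  also have "\<dots> = ennreal (c powr \<alpha>) * (\<integral>\<^sup>+p. f p \<partial>\<mu>)"
    by (subst nn_integral_intensity)
       (simp_all add: nn_integral_cmult borel_measurable_nn_integral_count_space gm)
  finally show ?thesis .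
qed

lemma emeasure_intensity_scale:
  assumes A: "A \<in> sets \<mu>" and c: "0 < c"
  shows "emeasure \<mu> {p \<in> space \<mu>. (c * fst p, snd p) \<in> A} = ennreal (c powr \<alpha>) * emeasure \<mu> A"
proof -
  have "{p \<in> space \<mu>. (c * fst p, snd p) \<in> A} \<in> sets \<mu>"
    using measurable_sets[OF intensity_scale_measurable[OF c] A]
    by (simp add: vimage_def Int_def conj_commute)
  then have "emeasure \<mu> {p \<in> space \<mu>. (c * fst p, snd p) \<in> A} = (\<integral>\<^sup>+p. indicator A (c * fst p, snd p) \<partial>\<mu>)"
    by (subst nn_integral_indicator[symmetric], simp, intro nn_integral_cong) (simp add: indicator_def)
  also have "\<dots> = ennreal (c powr \<alpha>) * emeasure \<mu> A"
    using A c by (subst nn_integral_intensity_scale) auto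
  finally show ?thesis .
qed

lemma emeasure_intensity_shift:
  assumes A: "A \<in> sets \<mu>"
  shows "emeasure \<mu> {(u, t, \<theta>) \<in> space \<mu>. (u, t + h, \<theta>) \<in> A} = emeasure \<mu> A"
proof -
  note [measurable] = intensity_shift_measurable[of h]
  have eq: "{(u, t, \<theta>) \<in> space \<mu>. (u, t + h, \<theta>) \<in> A} = (\<lambda>p. (fst p, fst (snd p) + h, snd (snd p))) -` A \<inter> space \<mu>"
    by auto
  have "emeasure \<mu> {(u, t, \<theta>) \<in> space \<mu>. (u, t + h, \<theta>) \<in> A} = (\<integral>\<^sup>+p. (case p of (u, t, \<theta>) \<Rightarrow> indicator A (u, t + h, \<theta>)) \<partial>\<mu>)"
    unfolding eq using measurable_sets[OF intensity_shift_measurable A]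
    by (subst nn_integral_indicator[symmetric], simp, intro nn_integral_cong)
       (auto simp: indicator_def split: prod.splits)
  also have "\<dots> = emeasure \<mu> A"
    using A by (subst nn_integral_intensity_shift) auto
  finally show ?thesis .
qed

text \<open>For fixed (t, \<theta>) at most one u solves the equation, namely r / b, and the Pareto
  intensity has no atoms. With r \<noteq> 0 there is no solution where b = 0.\<close>

lemma AE_intensity_radial_neq:
  assumes [measurable]: "b \<in> borel_measurable (count_space UNIV \<Otimes>\<^sub>M nonneg_path_space)" and r: "r \<noteq> 0"
  shows "AE p in \<mu>. fst p * b (snd p) \<noteq> (r::real)"
proof -
  let ?A = "{p \<in> space \<mu>. fst p * b (snd p) = r}"
  have A [measurable]: "?A \<in> sets \<mu>" by measurable
  have null: "(\<integral>\<^sup>+u. indicator ?A (u, t, \<theta>) \<partial>pareto_intensity \<alpha>) = 0" for t \<theta>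
  proof -
    have "(\<integral>\<^sup>+u. indicator ?A (u, t, \<theta>) \<partial>pareto_intensity \<alpha>) \<le> (\<integral>\<^sup>+u. indicator {r / b (t, \<theta>)} u \<partial>pareto_intensity \<alpha>)"
      using r by (intro nn_integral_mono) (auto simp: indicator_def field_simps)
    also have "\<dots> = 0"
    \<comment> \<open>Otherwise the point r / b, which is 0 by convention when b = 0, lies outside
      the space of the Pareto intensity.\<close>
    proof (cases "0 < r / b (t, \<theta>)")
      case True
      then have "{r / b (t, \<theta>)} \<in> sets (pareto_intensity \<alpha>)"
        unfolding sets_pareto_intensity by (subst sets_restrict_space_iff) auto
      then show ?thesis by (simp add: emeasure_pareto_intensity_singleton)
    next
      case False
      then have "(\<integral>\<^sup>+u. indicator {r / b (t, \<theta>)} u \<partial>pareto_intensity \<alpha>) = (\<integral>\<^sup>+u. 0 \<partial>pareto_intensity \<alpha>)"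
        by (intro nn_integral_cong) (auto simp: indicator_def)
      then show ?thesis by simp
    qed
    finally show ?thesis by simp
  qed
  have "emeasure \<mu> ?A = (\<integral>\<^sup>+p. indicator ?A p \<partial>\<mu>)" by simp
  also have "\<dots> = 0" by (subst nn_integral_intensity) (simp_all add: null)
  finally have "?A \<in> null_sets \<mu>" using A by auto
  then show ?thesis by (rule AE_I'[OF _]) auto
qed

text \<open>Integrating out u leaves (N(\<theta>(s + t)) / (r * \<alpha>-norm))^\<alpha>. The sum
  over t of the numerators is the \<alpha>-norm to the power \<alpha> and cancels, so the mass
  depends neither on s nor on the law of \<Theta>.\<close>

lemma emeasure_storm_norm_gt:
  assumes r: "0 < r"
  shows "emeasure \<mu> {p \<in> space \<mu>. r < N (storm p s)} = ennreal (r powr (- \<alpha>))"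
proof -
  let ?A = "{p \<in> space \<mu>. r < N (storm p s)}"
  have [measurable]: "?A \<in> sets \<mu>" by measurable
  have "emeasure \<mu> ?A = (\<integral>\<^sup>+p. indicator ?A p \<partial>\<mu>)" by simp
  also have "\<dots> = (\<integral>\<^sup>+\<omega>. (\<integral>\<^sup>+t. (\<integral>\<^sup>+u. indicator ?A (u, t, \<lambda>s. \<Theta> s \<omega>) \<partial>pareto_intensity \<alpha>) \<partial>count_space UNIV) \<partial>M)"
    by (rule nn_integral_intensity) measurable
  also have "\<dots> = (\<integral>\<^sup>+\<omega>. ennreal (r powr (- \<alpha>)) \<partial>M)"
  proof (rule nn_integral_cong_AE)
    show "AE \<omega> in M. (\<integral>\<^sup>+t. (\<integral>\<^sup>+u. indicator ?A (u, t, \<lambda>s. \<Theta> s \<omega>) \<partial>pareto_intensity \<alpha>) \<partial>count_space UNIV) = ennreal (r powr (- \<alpha>))"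
      using AE_alpha_sum AE_space
    proof eventually_elim
      case (elim \<omega>)
      let ?\<theta> = "\<lambda>s. \<Theta> s \<omega>"
      let ?S = "enn2real (alpha_sum ?\<theta>)"
      have S: "?S > 0" "ennreal ?S = alpha_sum ?\<theta>" using elim by (auto simp: enn2real_positive_iff)
      have \<theta>: "?\<theta> \<in> space nonneg_path_space"
        using measurable_space[OF \<Theta>_measurable elim(2)] by simp
      have inner: "(\<integral>\<^sup>+u. indicator ?A (u, t, ?\<theta>) \<partial>pareto_intensity \<alpha>)
          = ennreal (r powr (- \<alpha>) / ?S) * ennreal (N (\<Theta> (s + t) \<omega>) powr \<alpha>)" for t
      proof -
        have "(\<integral>\<^sup>+u. indicator ?A (u, t, ?\<theta>) \<partial>pareto_intensity \<alpha>)
          = (\<integral>\<^sup>+u. indicator {u. r < u * (N (\<Theta> (s + t) \<omega>) / alpha_norm N \<alpha> ?\<theta>)} u \<partial>pareto_intensity \<alpha>)"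
          using \<theta> by (intro nn_integral_cong) (auto simp: indicator_def space_intensity storm_def norm_scaleR)
        also have "\<dots> = ennreal ((N (\<Theta> (s + t) \<omega>) / alpha_norm N \<alpha> ?\<theta> / r) powr \<alpha>)"
          by (intro pareto_intensity_tail \<alpha> r) simp
        also have "(N (\<Theta> (s + t) \<omega>) / alpha_norm N \<alpha> ?\<theta> / r) powr \<alpha> = r powr (- \<alpha>) / ?S * N (\<Theta> (s + t) \<omega>) powr \<alpha>"
        proof -
          have "alpha_norm N \<alpha> ?\<theta> powr \<alpha> = ?S" using \<alpha> S by (simp add: alpha_norm_eq powr_powr)
          moreover have "(N (\<Theta> (s + t) \<omega>) / alpha_norm N \<alpha> ?\<theta> / r) powr \<alpha>
              = N (\<Theta> (s + t) \<omega>) powr \<alpha> / alpha_norm N \<alpha> ?\<theta> powr \<alpha> / r powr \<alpha>"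
            using r by (simp add: powr_divide powr_mult)
          ultimately show ?thesis by (simp add: powr_minus divide_inverse mult_ac)
        qed
        finally show ?thesis using S by (simp only: ennreal_mult'' powr_ge_zero)
      qed
      have "(\<integral>\<^sup>+t. (\<integral>\<^sup>+u. indicator ?A (u, t, ?\<theta>) \<partial>pareto_intensity \<alpha>) \<partial>count_space UNIV)
        = ennreal (r powr (- \<alpha>) / ?S) * alpha_sum ?\<theta>"
        unfolding inner by (subst nn_integral_cmult) (auto simp: alpha_sum_shift[of ?\<theta> s])
      also have "\<dots> = ennreal (r powr (- \<alpha>))"
        using S by (subst S(2)[symmetric], subst ennreal_mult[symmetric]) auto
      finally show ?case .
    qed
  qed
  also have "\<dots> = ennreal (r powr (- \<alpha>))" by (simp add: M.emeasure_space_1)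
  finally show ?thesis .
qed

text \<open>Size is measured by coordinates and not by N, because the supremum defining Z is taken
  coordinatewise.\<close>

definition large_storms :: "int set \<Rightarrow> real \<Rightarrow> (real \<times> int \<times> (int \<Rightarrow> real ^ 'n)) set" where
  "large_storms I r = {p \<in> space \<mu>. \<exists>s\<in>I. \<exists>j. r < storm p s $ j}"

lemma sets_large_storms [measurable]: "large_storms I r \<in> sets \<mu>"
proof -
  have "countable I" by simp
  then show ?thesis unfolding large_storms_def by measurable
qed

lemma emeasure_large_storms_finite:
  assumes "finite I" "0 < r"
  shows "emeasure \<mu> (large_storms I r) < \<infinity>"
proof -
  obtain c where c: "c > 0" "\<And>x j. \<bar>x $ j\<bar> \<le> c * N x"
    using is_norm_coordinate_le[OF norm] by blast
  have "emeasure \<mu> (large_storms I r) \<le> emeasure \<mu> (\<Union>s\<in>I. {p \<in> space \<mu>. r / c < N (storm p s)})"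
  proof (rule emeasure_mono)
    show "large_storms I r \<subseteq> (\<Union>s\<in>I. {p \<in> space \<mu>. r / c < N (storm p s)})"
    proof
      fix p assume "p \<in> large_storms I r"
      then obtain s j where *: "p \<in> space \<mu>" "s \<in> I" "r < storm p s $ j" by (auto simp: large_storms_def)
      then have "r < c * N (storm p s)" using c(2)[of "storm p s" j] by linarith
      then show "p \<in> (\<Union>s\<in>I. {p \<in> space \<mu>. r / c < N (storm p s)})"
        using * c by (auto simp: field_simps)
    qed
  qed (use assms in measurable)
  also have "\<dots> \<le> (\<Sum>s\<in>I. emeasure \<mu> {p \<in> space \<mu>. r / c < N (storm p s)})"
    using assms by (intro emeasure_subadditive_finite) auto
  also have "\<dots> < \<infinity>" using assms c by (simp add: emeasure_storm_norm_gt ennreal_mult_less_top of_nat_less_top)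
  finally show ?thesis .
qed

lemma emeasure_large_storms_scale:
  assumes "0 < x"
  shows "emeasure \<mu> (large_storms I (x * r)) = ennreal (x powr (- \<alpha>)) * emeasure \<mu> (large_storms I r)"
proof -
  have "{p \<in> space \<mu>. ((1 / x) * fst p, snd p) \<in> large_storms I r} = large_storms I (x * r)"
    using assms storm_scale[of "1 / x"]
    by (auto simp: large_storms_def space_intensity field_simps)
  then show ?thesis
    using emeasure_intensity_scale[OF sets_large_storms, of "1 / x" I r] assms
    by (simp add: powr_divide powr_minus field_simps)
qed

end

section \<open>The maximum process\<close>

lemma borel_measurable_vec_lambda:
  assumes "\<And>j. f j \<in> borel_measurable L"
  shows "(\<lambda>x. \<chi> j. f j x) \<in> L \<rightarrow>\<^sub>M (borel :: (real^'n) measure)"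
proof (subst borel_measurable_euclidean_space, rule ballI)
  fix b :: "real^'n" assume "b \<in> Basis"
  then obtain j where "b = axis j 1" by (auto simp: Basis_vec_def)
  then show "(\<lambda>x. (\<chi> j. f j x) \<bullet> b) \<in> borel_measurable L"
    using assms[of j] by (simp add: inner_axis)
qed

text \<open>Distribution functions of the whole path determine its law: the sets {y \<le> x} are
  closed under intersection, by taking the pointwise minimum of the bounds, and generate the product
  \<sigma>-algebra. Bounds equal to \<infinity> remove constraints.\<close>

lemma nonneg_path_measure_eqI:
  fixes A B :: "(int \<Rightarrow> real^'n) measure"
  assumes "prob_space A" "prob_space B"
    and sets: "sets A = sets nonneg_path_space" "sets B = sets nonneg_path_space"
    and eq: "\<And>x. emeasure A {y \<in> space nonneg_path_space. \<forall>t j. ennreal (y t $ j) \<le> x t j}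
      = emeasure B {y \<in> space nonneg_path_space. \<forall>t j. ennreal (y t $ j) \<le> x t j}"
  shows "A = B"
proof -
  let ?S = "space nonneg_path_space :: (int \<Rightarrow> real^'n) set"
  define G where "G x = {y \<in> ?S. \<forall>t j. ennreal (y t $ j) \<le> x t j}" for x :: "int \<Rightarrow> 'n \<Rightarrow> ennreal"
  interpret A: prob_space A by fact
  have gen: "sets nonneg_path_space = sigma_sets ?S (range G)"
  proof (rule antisym)
    have G_sets: "range G \<subseteq> sets nonneg_path_space"
      unfolding G_def by auto
    show "sigma_sets ?S (range G) \<subseteq> sets nonneg_path_space"
      using G_sets by (rule sets.sigma_sets_subset)
    have Gs: "G x \<in> sets (sigma ?S (range G))" for x
      by (subst sets_measure_of) (auto simp: G_def)
    have comp: "(\<lambda>y. y t $ j) \<in> borel_measurable (sigma ?S (range G))" for t j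
    proof (subst borel_measurable_iff_le, rule allI)
      fix a :: real
      show "{y \<in> space (sigma ?S (range G)). y t $ j \<le> a} \<in> sets (sigma ?S (range G))"
      proof (cases "0 \<le> a")
        case True
        \<comment> \<open>A half-line event for a single coordinate arises by leaving every other
          coordinate unconstrained.\<close>
        have "{y \<in> space (sigma ?S (range G)). y t $ j \<le> a}
          = G (\<lambda>t' j'. if t' = t \<and> j' = j then ennreal a else \<top>)"
          using True by (auto simp: G_def space_measure_of_conv)
        then show ?thesis using Gs by simp
      next
        case False
        have "\<not> y t $ j \<le> a" if "y \<in> ?S" for y
        proof -
          have "0 \<le> y t $ j" using that by (simp add: space_nonneg_path_space)
          then show ?thesis using False by linarith
        qed
        then have "{y \<in> space (sigma ?S (range G)). y t $ j \<le> a} = {}"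
          by (auto simp: space_measure_of_conv)
        then show ?thesis by (simp del: Collect_empty_eq)
      qed
    qed
    have "(\<lambda>y. \<chi> j. y t $ j) \<in> sigma ?S (range G) \<rightarrow>\<^sub>M (borel :: (real^'n) measure)" for t
      using comp by (rule borel_measurable_vec_lambda)
    \<comment> \<open>Measurable coordinates make the identity measurable into the product space,
      which is the remaining inclusion of \<sigma>-algebras.\<close>
    then have "(\<lambda>y. y) \<in> sigma ?S (range G) \<rightarrow>\<^sub>M nonneg_path_space"
      by (intro measurable_nonneg_path_spaceI) (auto simp: space_measure_of_conv space_nonneg_path_space)
    then have "sets nonneg_path_space \<subseteq> sets (sigma ?S (range G))"
      by (intro subsetI) (drule measurable_sets, assumption, auto simp: space_measure_of_conv
        dest: sets.sets_into_space intro: back_subst[where P="\<lambda>X. X \<in> sets _"])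
    then show "sets nonneg_path_space \<subseteq> sigma_sets ?S (range G)"
      by (subst (asm) sets_measure_of) (auto simp: G_def)
  qed
  show ?thesis
  proof (rule measure_eqI_generator_eq[where A="\<lambda>_. ?S"])
    show "Int_stable (range G)"
    proof (rule Int_stableI_image)
      fix x y
      have "G x \<inter> G y = G (\<lambda>t j. inf (x t j) (y t j))" by (auto simp: G_def)
      then show "\<exists>k\<in>UNIV. G x \<inter> G y = G k" by blast
    qed
    show "range G \<subseteq> Pow ?S" by (auto simp: G_def)
    show "emeasure A X = emeasure B X" if "X \<in> range G" for X
      using that eq by (auto simp: G_def)
    have "?S = G (\<lambda>_ _. \<top>)" by (simp add: G_def)
    then show "range (\<lambda>_::nat. ?S) \<subseteq> range G" by auto
  qed (use sets gen in auto)
qed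

locale max_storm_process = storm_process N \<alpha> M \<Theta>
  for N :: "real ^ 'n \<Rightarrow> real" and \<alpha> :: real and M :: "'a measure"
    and \<Theta> :: "int \<Rightarrow> 'a \<Rightarrow> real ^ 'n" +
  fixes \<Omega> :: "'b measure" and p :: "nat \<Rightarrow> 'b \<Rightarrow> real \<times> int \<times> (int \<Rightarrow> real ^ 'n)"
  assumes ppp: "poisson_point_process \<Omega> (intensity \<alpha> M \<Theta>) p"
begin

sublocale \<Omega>: prob_space \<Omega>
  using ppp by (simp add: poisson_point_process_def)

lemma p_measurable [measurable]: "p i \<in> \<Omega> \<rightarrow>\<^sub>M \<mu>"
  by (rule poisson_point_measurable[OF ppp])

lemma p_space: "\<omega> \<in> space \<Omega> \<Longrightarrow> p i \<omega> \<in> space \<mu>"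
  by (rule measurable_space[OF p_measurable])

lemma storm_p_measurable [measurable]: "(\<lambda>\<omega>. storm (p i \<omega>) s) \<in> \<Omega> \<rightarrow>\<^sub>M borel"
  by (rule measurable_compose[OF p_measurable storm_component_measurable])

definition Z_ext :: "int \<Rightarrow> 'b \<Rightarrow> 'n \<Rightarrow> ennreal" where
  "Z_ext s \<omega> j = (SUP i. ennreal (storm (p i \<omega>) s $ j))"

definition Z :: "int \<Rightarrow> 'b \<Rightarrow> real ^ 'n" where
  "Z s \<omega> = (\<chi> j. enn2real (Z_ext s \<omega> j))"

lemma Z_ext_measurable [measurable]: "(\<lambda>\<omega>. Z_ext s \<omega> j) \<in> borel_measurable \<Omega>"
  unfolding Z_ext_def by measurable

lemma Z_component_measurable [measurable]: "Z s \<in> \<Omega> \<rightarrow>\<^sub>M borel"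
  unfolding Z_def[abs_def] by (rule borel_measurable_vec_lambda) measurable

lemma Z_nonneg: "0 \<le> Z s \<omega> $ j"
  by (simp add: Z_def)

lemma nonneg_process_Z: "nonneg_process \<Omega> (\<lambda>t. Z (t + h))"
  unfolding nonneg_process_def
  by (intro conjI \<Omega>.prob_space_axioms measurable_nonneg_path_spaceI) (auto simp: Z_nonneg)

lemma process_Z: "process \<Omega> (\<lambda>t. Z (t + h))"
  using nonneg_process_Z[of h] measurable_compose[OF _ measurable_nonneg_path_to_path]
  unfolding nonneg_process_def process_def by auto

lemma Z_measurable [measurable]: "(\<lambda>\<omega> t. Z t \<omega>) \<in> \<Omega> \<rightarrow>\<^sub>M path_space"
  using process_Z[of 0] by (simp add: process_def)

section \<open>Void probabilities: finiteness, max-stability, stationarity\<close>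

text \<open>One bound in [0, \<infinity>] for each time and coordinate; finite-dimensional events
  are covered by setting the remaining bounds to \<infinity>.\<close>

definition exceed :: "(int \<Rightarrow> 'n \<Rightarrow> ennreal) \<Rightarrow> (real \<times> int \<times> (int \<Rightarrow> real ^ 'n)) set" where
  "exceed x = {q \<in> space \<mu>. \<exists>s j. \<not> ennreal (storm q s $ j) \<le> x s j}"

lemma sets_exceed [measurable]: "exceed x \<in> sets \<mu>"
  unfolding exceed_def by measurable

lemma prob_Z_ext_le:
  "\<Omega>.prob {\<omega> \<in> space \<Omega>. \<forall>s j. Z_ext s \<omega> j \<le> x s j} = void_prob (emeasure \<mu> (exceed x))"
proof -
  have "{\<omega> \<in> space \<Omega>. \<forall>s j. Z_ext s \<omega> j \<le> x s j} = {\<omega> \<in> space \<Omega>. \<forall>i. p i \<omega> \<notin> exceed x}"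
    using p_space by (auto simp: Z_ext_def exceed_def SUP_le_iff)
  then show ?thesis
    using prob_no_points[OF ppp sets_exceed] by simp
qed

text \<open>The event of a finite value contains the event of a value at most n, whose probability
  is at least exp(-n^(-\<alpha>) m) with m the finite mass of \<open>large_storms {s} 1\<close>.
  This tends to 1.\<close>

lemma AE_Z_ext_finite: "AE \<omega> in \<Omega>. \<forall>s j. Z_ext s \<omega> j < \<infinity>"
proof (subst AE_all_countable, intro allI, subst AE_all_countable, intro allI)
  fix s j
  let ?B = "{\<omega> \<in> space \<Omega>. Z_ext s \<omega> j < \<infinity>}"
  let ?m = "measure \<mu> (large_storms {s} 1)"
  have le: "exp (- (real n powr (- \<alpha>) * ?m)) \<le> \<Omega>.prob ?B" if n: "0 < n" for n :: nat
  proof -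
    define x where "x s' j' = (if s' = s \<and> j' = j then ennreal (real n) else \<top>)" for s' j'
    have sub: "exceed x \<subseteq> large_storms {s} (real n)"
      by (auto simp: exceed_def x_def large_storms_def not_le ennreal_less_iff split: if_splits)
    have "emeasure \<mu> (large_storms {s} (real n)) = ennreal (real n powr (- \<alpha>)) * emeasure \<mu> (large_storms {s} 1)"
      using emeasure_large_storms_scale[of "real n" "{s}" 1] n by simp
    also have "\<dots> = ennreal (real n powr (- \<alpha>) * ?m)"
      using emeasure_large_storms_finite[of "{s}" 1]
      by (simp add: emeasure_eq_ennreal_measure ennreal_mult less_top)
    finally have "emeasure \<mu> (exceed x) \<le> ennreal (real n powr (- \<alpha>) * ?m)"
      using emeasure_mono[OF sub, of \<mu>] by simp
    then have "emeasure \<mu> (exceed x) \<noteq> \<infinity>" "enn2real (emeasure \<mu> (exceed x)) \<le> real n powr (- \<alpha>) * ?m"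
      by (auto simp: top_unique enn2real_leI)
    then have "exp (- (real n powr (- \<alpha>) * ?m)) \<le> void_prob (emeasure \<mu> (exceed x))"
      by (simp add: void_prob_def)
    also have "\<dots> = \<Omega>.prob {\<omega> \<in> space \<Omega>. \<forall>s j. Z_ext s \<omega> j \<le> x s j}"
      by (simp add: prob_Z_ext_le)
    also have "\<dots> \<le> \<Omega>.prob ?B"
    proof (rule \<Omega>.finite_measure_mono)
      show "{\<omega> \<in> space \<Omega>. \<forall>s j. Z_ext s \<omega> j \<le> x s j} \<subseteq> ?B"
      proof safe
        fix \<omega> assume "\<forall>s j. Z_ext s \<omega> j \<le> x s j"
        then have "Z_ext s \<omega> j \<le> x s j" by blast
        also have "\<dots> < \<infinity>" by (simp add: x_def)
        finally show "Z_ext s \<omega> j < \<infinity>" .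
      qed
    qed measurable
    finally show ?thesis .
  qed
  have "(\<lambda>n. exp (- (real n powr (- \<alpha>) * ?m))) \<longlonglongrightarrow> exp (- (0 * ?m))"
    using \<alpha> by (intro tendsto_intros tendsto_neg_powr filterlim_real_sequentially) auto
  then have "1 \<le> \<Omega>.prob ?B"
    using le by (intro LIMSEQ_le_const2[where X="\<lambda>n. exp (- (real n powr (- \<alpha>) * ?m))"])
      (auto intro!: exI[of _ 1])
  then have "\<Omega>.prob ?B = 1" by (intro antisym \<Omega>.prob_le_1)
  then show "AE \<omega> in \<Omega>. Z_ext s \<omega> j < \<infinity>"
    by (subst (asm) \<Omega>.prob_Collect_eq_1) auto
qed

lemma AE_ennreal_Z: "AE \<omega> in \<Omega>. \<forall>s j. ennreal (Z s \<omega> $ j) = Z_ext s \<omega> j"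
  using AE_Z_ext_finite by eventually_elim (simp add: Z_def)

lemma prob_Z_le:
  "\<Omega>.prob {\<omega> \<in> space \<Omega>. \<forall>s j. ennreal (Z s \<omega> $ j) \<le> x s j} = void_prob (emeasure \<mu> (exceed x))"
proof -
  have "\<Omega>.prob {\<omega> \<in> space \<Omega>. \<forall>s j. ennreal (Z s \<omega> $ j) \<le> x s j}
    = \<Omega>.prob {\<omega> \<in> space \<Omega>. \<forall>s j. Z_ext s \<omega> j \<le> x s j}"
    using AE_ennreal_Z by (intro \<Omega>.finite_measure_eq_AE) (auto elim: eventually_mono)
  then show ?thesis by (simp add: prob_Z_ext_le)
qed

lemma emeasure_exceed_scale:
  assumes c: "0 < c"
  shows "emeasure \<mu> (exceed (\<lambda>s j. ennreal c * x s j)) = ennreal (c powr (- \<alpha>)) * emeasure \<mu> (exceed x)"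
proof -
  \<comment> \<open>Division by c in [0, \<infinity>]: the bound y = \<infinity> stays \<infinity>
    under multiplication because c is positive.\<close>
  have le_iff: "ennreal a \<le> ennreal c * y \<longleftrightarrow> ennreal (1 / c * a) \<le> y" if "0 \<le> a" for a y
    using c that
    by (cases y) (auto simp: ennreal_mult[symmetric] ennreal_mult_top field_simps)
  have "{q \<in> space \<mu>. ((1 / c) * fst q, snd q) \<in> exceed x} = exceed (\<lambda>s j. ennreal c * x s j)"
  proof (rule set_eqI)
    fix q
    have sc: "storm (1 / c * fst q, snd q) s $ j = 1 / c * storm q s $ j" for s j
      using storm_scale[of "1 / c" "fst q" "snd q" s] by simp
    have sp: "(1 / c * fst q, snd q) \<in> space \<mu> \<longleftrightarrow> q \<in> space \<mu>"
      using c by (cases q) (auto simp: space_intensity zero_less_divide_iff)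
    show "q \<in> {q \<in> space \<mu>. ((1 / c) * fst q, snd q) \<in> exceed x} \<longleftrightarrow> q \<in> exceed (\<lambda>s j. ennreal c * x s j)"
      unfolding exceed_def mem_Collect_eq sc sp
      by (simp only: le_iff[OF storm_nonneg] simp_thms cong: conj_cong)
  qed
  then show ?thesis
    using emeasure_intensity_scale[OF sets_exceed, of "1 / c" x] c
    by (simp add: powr_divide powr_minus field_simps)
qed

lemma emeasure_exceed_shift:
  "emeasure \<mu> (exceed (\<lambda>s j. x (s - h) j)) = emeasure \<mu> (exceed x)"
proof -
  have "{(u, t, \<theta>) \<in> space \<mu>. (u, t + h, \<theta>) \<in> exceed x} = exceed (\<lambda>s j. x (s - h) j)"
  proof (rule set_eqI)
    fix q :: "real \<times> int \<times> (int \<Rightarrow> real ^ 'n)"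
    obtain u t \<theta> where q: "q = (u, t, \<theta>)" by (cases q)
    have "(\<exists>s j. \<not> ennreal (storm (u, t, \<theta>) (s + h) $ j) \<le> x s j)
      \<longleftrightarrow> (\<exists>s j. \<not> ennreal (storm (u, t, \<theta>) s $ j) \<le> x (s - h) j)"
      by (metis add_diff_cancel_right' diff_add_cancel)
    then show "q \<in> {(u, t, \<theta>) \<in> space \<mu>. (u, t + h, \<theta>) \<in> exceed x} \<longleftrightarrow> q \<in> exceed (\<lambda>s j. x (s - h) j)"
      by (auto simp: q exceed_def storm_shift space_intensity)
  qed
  then show ?thesis using emeasure_intensity_shift[OF sets_exceed, of h x] by simp
qed

text \<open>The scale c = k^(-1/\<alpha>) satisfies c^(-\<alpha>) = k. Scaling the bounds by c
  therefore multiplies the mass of exceeding storms by k, and a void probability turns this into the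
  k-th power.\<close>

lemma max_stable_Z: "max_stable \<Omega> \<alpha> Z"
  unfolding max_stable_def
proof (intro conjI allI impI)
  show "nonneg_process \<Omega> Z" using nonneg_process_Z[of 0] by simp
  fix k :: nat and s t :: int and x :: "int \<Rightarrow> ennreal ^ 'n"
  assume k: "1 \<le> k \<and> s \<le> t"
  \<comment> \<open>Times outside s..t receive the bound \<infinity>, which is unaffected by the
    factor c.\<close>
  define y where "y u j = (if u \<in> {s..t} then x u $ j else \<top>)" for u j
  let ?c = "real k powr (- 1 / \<alpha>)"
  have c: "?c > 0" using k by simp
  have "\<Omega>.prob {\<omega> \<in> space \<Omega>. \<forall>u\<in>{s..t}. \<forall>j. ennreal (Z u \<omega> $ j) \<le> x u $ j} = void_prob (emeasure \<mu> (exceed y))"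
    by (subst prob_Z_le[symmetric], rule arg_cong[where f="\<Omega>.prob"]) (auto simp: y_def)
  moreover have "\<Omega>.prob {\<omega> \<in> space \<Omega>. \<forall>u\<in>{s..t}. \<forall>j. ennreal (Z u \<omega> $ j) \<le> ennreal ?c * (x u $ j)}
      = void_prob (emeasure \<mu> (exceed (\<lambda>u j. ennreal ?c * y u j)))"
    using c by (subst prob_Z_le[symmetric], intro arg_cong[where f="\<Omega>.prob"])
      (auto simp: y_def ennreal_mult_top)
  moreover have "emeasure \<mu> (exceed (\<lambda>u j. ennreal ?c * y u j)) = of_nat k * emeasure \<mu> (exceed y)"
    using emeasure_exceed_scale[OF c] k \<alpha> by (simp add: powr_powr ennreal_of_nat_eq_real_of_nat)
  ultimately show "\<Omega>.prob {\<omega> \<in> space \<Omega>. \<forall>u\<in>{s..t}. \<forall>j. ennreal (Z u \<omega> $ j) \<le> x u $ j} ^ k =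
        \<Omega>.prob {\<omega> \<in> space \<Omega>. \<forall>u\<in>{s..t}. \<forall>j. ennreal (Z u \<omega> $ j) \<le> ennreal ?c * (x u $ j)}"
    using k by (simp add: void_prob_of_nat_mult)
qed

text \<open>A time shift of Z moves the bounds x, and the mass of the exceeding storms is invariant
  under this because the counting measure in t is. Hence all shifts have the same distribution
  functions.\<close>

lemma stationary_Z: "stationary \<Omega> Z"
  unfolding stationary_def
proof (intro conjI allI)
  show "process \<Omega> Z" using process_Z[of 0] by simp
  fix h
  let ?A = "\<lambda>h. distr \<Omega> nonneg_path_space (\<lambda>\<omega> t. Z (t + h) \<omega>)"
  have m [measurable]: "(\<lambda>\<omega> t. Z (t + h) \<omega>) \<in> \<Omega> \<rightarrow>\<^sub>M nonneg_path_space" for h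
    using nonneg_process_Z[of h] by (simp add: nonneg_process_def)
  have "emeasure (?A h) {y \<in> space nonneg_path_space. \<forall>t j. ennreal (y t $ j) \<le> x t j}
      = ennreal (void_prob (emeasure \<mu> (exceed x)))" for h x
  proof -
    have "emeasure (?A h) {y \<in> space nonneg_path_space. \<forall>t j. ennreal (y t $ j) \<le> x t j}
      = emeasure \<Omega> {\<omega> \<in> space \<Omega>. \<forall>t j. ennreal (Z t \<omega> $ j) \<le> x (t - h) j}"
    proof (subst emeasure_distr)
      have "(\<forall>t j. ennreal (Z (t + h) \<omega> $ j) \<le> x t j) \<longleftrightarrow> (\<forall>t j. ennreal (Z t \<omega> $ j) \<le> x (t - h) j)" for \<omega>
        by (metis add_diff_cancel_right' diff_add_cancel)
      then have "(\<lambda>\<omega> t. Z (t + h) \<omega>) -` {y \<in> space nonneg_path_space. \<forall>t j. ennreal (y t $ j) \<le> x t j} \<inter> space \<Omega>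
        = {\<omega> \<in> space \<Omega>. \<forall>t j. ennreal (Z t \<omega> $ j) \<le> x (t - h) j}"
        by (auto simp: space_nonneg_path_space Z_nonneg)
      then show "emeasure \<Omega> ((\<lambda>\<omega> t. Z (t + h) \<omega>) -` {y \<in> space nonneg_path_space. \<forall>t j. ennreal (y t $ j) \<le> x t j} \<inter> space \<Omega>)
        = emeasure \<Omega> {\<omega> \<in> space \<Omega>. \<forall>t j. ennreal (Z t \<omega> $ j) \<le> x (t - h) j}"
        by simp
    qed measurable
    then show ?thesis
      by (simp add: \<Omega>.emeasure_eq_measure prob_Z_le emeasure_exceed_shift)
  qed
  note law = this
  have "?A h = ?A 0"
    by (rule nonneg_path_measure_eqI[OF \<Omega>.prob_space_distr[OF m] \<Omega>.prob_space_distr[OF m]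
        sets_distr sets_distr]) (simp only: law)
  \<comment> \<open>The laws agree on the nonnegative paths, where the sets {y \<le> x} generate;
    pushing forward along the inclusion gives the laws on all paths.\<close>
  then have "distr (?A h) path_space (\<lambda>y. y) = distr (?A 0) path_space (\<lambda>y. y)" by simp
  then show "process_law \<Omega> (\<lambda>t. Z (t + h)) = process_law \<Omega> Z"
    by (simp add: process_law_def distr_distr[OF measurable_nonneg_path_to_path m] comp_def
        distr_distr[OF measurable_nonneg_path_to_path m[of 0, simplified]])
qed

end

section \<open>The single big jump\<close>

definition near :: "int set \<Rightarrow> real \<Rightarrow> (int \<Rightarrow> real^'n) \<Rightarrow> (int \<Rightarrow> real^'n) \<Rightarrow> bool" where
  "near I e y' y \<longleftrightarrow> (\<forall>s\<in>I. \<forall>j. \<bar>y' s $ j - y s $ j\<bar> < e)"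

definition osc :: "int set \<Rightarrow> ((int \<Rightarrow> real^'n) \<Rightarrow> real) \<Rightarrow> real \<Rightarrow> (int \<Rightarrow> real^'n) \<Rightarrow> ennreal" where
  "osc I g e y = (SUP y'\<in>{y'. near I e y' y}. ennreal \<bar>g y' - g y\<bar>)"

text \<open>The neighbourhoods restrict only the coordinates in I and are uniform over all others;
  this is the notion for which \<open>osc I g e y\<close> tends to 0 with e.\<close>

definition continuous_in_coordinates :: "int set \<Rightarrow> ((int \<Rightarrow> real^'n) \<Rightarrow> real) \<Rightarrow> (int \<Rightarrow> real^'n) \<Rightarrow> bool" where
  "continuous_in_coordinates I g y \<longleftrightarrow> (\<forall>r>0. \<exists>e>0. \<forall>y'. near I e y' y \<longrightarrow> \<bar>g y' - g y\<bar> < r)"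

lemma near_sym: "near I e y y' \<longleftrightarrow> near I e y' y"
  by (simp add: near_def abs_minus_commute)

lemma sets_path_space_eq_borel: "sets path_space = sets (borel :: (int \<Rightarrow> real^'n) measure)"
  by (rule sets_PiM_equal_borel)

lemma continuous_on_coordinate: "continuous_on A (\<lambda>y::int \<Rightarrow> real^'n. y s $ j)"
  by (intro continuous_on_component continuous_on_subset[OF continuous_on_product_coordinates]) simp

lemma open_near:
  fixes y :: "int \<Rightarrow> real^'n"
  assumes "finite I"
  shows "open {z. near I e z y}"
proof -
  have "{z. near I e z y} = (\<Inter>s\<in>I. \<Inter>j\<in>UNIV. {z. \<bar>z s $ j - y s $ j\<bar> < e})"
    by (auto simp: near_def)
  also have "open \<dots>"
    using assms by (intro open_INT finite ballI open_Collect_less continuous_intros continuous_on_coordinate)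
  finally show ?thesis .
qed

text \<open>
  The oscillation is lower semicontinuous only where \<open>g\<close> is continuous; the value \<open>\<infinity>\<close> elsewhere keeps
  the majorant measurable and is harmless because \<open>D\<close> will have full measure.
\<close>

lemma osc_measurable:
  fixes g :: "(int \<Rightarrow> real^'n) \<Rightarrow> real"
  assumes I: "finite I" and D [measurable]: "D \<in> sets path_space"
    and cont: "\<And>y. y \<in> D \<Longrightarrow> continuous_in_coordinates I g y"
  shows "(\<lambda>y. if y \<in> D then osc I g e y else \<infinity>) \<in> borel_measurable path_space"
proof (rule borel_measurableI_greater)
  fix a :: ennreal
  \<comment> \<open>A triple in W certifies the oscillation: y' witnesses a value above a for every
    z that is r-close to y and has y' in its e-neighbourhood. V is a union of open cylinders, hence
    Borel, and on D it is exactly the set where the oscillation exceeds a.\<close>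
  define W where "W = {(y', y, r). \<forall>z. near I e y' z \<and> near I r z y \<longrightarrow> a < ennreal \<bar>g y' - g z\<bar>}"
  define V where "V = (\<Union>(y', y, r)\<in>W. {z. near I e z y'} \<inter> {z. near I r z y})"
  have "open V" unfolding V_def
    by (intro open_UN ballI) (auto intro!: open_Int open_near I)
  then have V [measurable]: "V \<in> sets path_space"
    unfolding sets_path_space_eq_borel by simp
  have eq: "{y \<in> space path_space. a < (if y \<in> D then osc I g e y else \<infinity>)}
      = (if a = \<infinity> then {} else (D \<inter> V) \<union> (space path_space - D))" (is "?L = ?R")
  proof (cases "a = \<infinity>")
    case False
    have "a < osc I g e y" if "y \<in> V" for y
    proof -
      from that obtain y' y0 r where "(y', y0, r) \<in> W" "near I e y y'" "near I r y y0"
        unfolding V_def by auto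
      then have "near I e y' y" "a < ennreal \<bar>g y' - g y\<bar>"
        by (auto simp: W_def near_sym)
      then show ?thesis by (auto simp: osc_def less_SUP_iff)
    qed
    moreover have "y \<in> V" if y: "y \<in> D" "a < osc I g e y" for y
    proof -
      obtain y' where y': "near I e y' y" "a < ennreal \<bar>g y' - g y\<bar>"
        using y(2) by (auto simp: osc_def less_SUP_iff)
      obtain b where b: "a = ennreal b" "0 \<le> b" using False by (cases a) auto
      have "0 < \<bar>g y' - g y\<bar> - b" using y'(2) b by (simp add: ennreal_less_iff)
      then obtain r where r: "r > 0" "\<And>z. near I r z y \<Longrightarrow> \<bar>g z - g y\<bar> < \<bar>g y' - g y\<bar> - b"
        using cont[OF y(1)] unfolding continuous_in_coordinates_def by blast
      have "(y', y, r) \<in> W"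
      proof -
        have "a < ennreal \<bar>g y' - g z\<bar>" if "near I r z y" for z
        proof -
          have "b < \<bar>g y' - g z\<bar>" using r(2)[OF that] by linarith
          then show ?thesis using b by (simp add: ennreal_less_iff)
        qed
        then show ?thesis by (auto simp: W_def)
      qed
      moreover have "near I r y y" using r(1) by (simp add: near_def)
      ultimately show ?thesis using y'(1) by (auto simp: V_def near_sym)
    qed
    ultimately show ?thesis using False by (auto simp: less_top[symmetric] space_PiM)
  qed (auto simp: space_PiM)
  show "?L \<in> sets path_space" unfolding eq using D V by (cases "a = \<infinity>") auto
qed

lemma osc_tendsto_0:
  assumes cont: "continuous_in_coordinates I g y" and e: "\<And>n. 0 < e n" "e \<longlonglongrightarrow> 0"
  shows "(\<lambda>n. osc I g (e n) y) \<longlonglongrightarrow> 0"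
proof (rule order_tendstoI)
  fix a :: ennreal assume "0 < a"
  then obtain b where b: "0 < b" "b < a" using dense by blast
  then obtain r where r: "b = ennreal r" "0 < r"
    by (cases b) (auto simp: top_unique)
  obtain d where d: "d > 0" "\<And>y'. near I d y' y \<Longrightarrow> \<bar>g y' - g y\<bar> < r"
    using cont r(2) unfolding continuous_in_coordinates_def by blast
  have "eventually (\<lambda>n. e n < d) sequentially" using e(2) d(1) by (rule order_tendstoD)
  then show "eventually (\<lambda>n. osc I g (e n) y < a) sequentially"
  proof eventually_elim
    case (elim n)
    have "osc I g (e n) y \<le> b" unfolding osc_def r(1)
    proof (rule SUP_least)
      fix y' assume "y' \<in> {y'. near I (e n) y' y}"
      then have "near I d y' y" using elim unfolding near_def mem_Collect_eq by (meson less_trans)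
      then show "ennreal \<bar>g y' - g y\<bar> \<le> ennreal r" using d(2) by (intro ennreal_leI less_imp_le)
    qed
    then show ?case using b by simp
  qed
qed simp

text \<open>
  Here \<open>z\<close> is the coordinatewise supremum of the \<open>y i\<close> and \<open>c\<close> counts the large ones. If only \<open>y k\<close>
  is large, then \<open>z\<close> is within \<open>e / 2\<close> of \<open>y k\<close>, which costs an oscillation of \<open>g\<close>; configurations
  with two or more large points are charged to the last term.
\<close>

lemma single_big_jump:
  fixes g :: "(int \<Rightarrow> real^'n) \<Rightarrow> real" and y :: "nat \<Rightarrow> int \<Rightarrow> real^'n"
  assumes g: "\<And>y. 0 \<le> g y" "\<And>y. g y \<le> C"
    and vanish: "\<And>y. (\<And>s j. s \<in> I \<Longrightarrow> \<bar>y s $ j\<bar> < \<delta>) \<Longrightarrow> g y = 0"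
    and e: "0 < e" "e \<le> \<delta>"
    and y: "\<And>i s j. 0 \<le> y i s $ j" "\<And>i s j. y i s $ j \<le> z s $ j"
    and z: "\<And>s j b. 0 \<le> b \<Longrightarrow> (\<And>i. y i s $ j \<le> b) \<Longrightarrow> z s $ j \<le> b"
    and w: "\<And>y. osc I g e y \<le> w y"
  defines "c \<equiv> \<Sum>i. indicator {i. \<exists>s\<in>I. \<exists>j. e / 2 < y i s $ j} i :: ennreal"
  shows "ennreal (g z) \<le> (\<Sum>i. ennreal (g (y i))) + (\<Sum>i. w (y i)) + ennreal C * (c * indicator {2..} c)"
    and "(\<Sum>i. ennreal (g (y i))) \<le> ennreal (g z) + (\<Sum>i. w (y i)) + ennreal C * (c * indicator {2..} c)"
proof -
  define P where "P = {i. \<exists>s\<in>I. \<exists>j. e / 2 < y i s $ j}"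
  have C: "0 \<le> C" using g order_trans by blast
  have small: "y i s $ j \<le> e / 2" if "i \<notin> P" "s \<in> I" for i s j
    using that unfolding P_def mem_Collect_eq by (meson not_less)
  \<comment> \<open>P is the set of large points. Outside it the coordinates over I are at most e /
    2, which is below \<delta>, where g vanishes.\<close>
  have g0: "g (y i) = 0" if "i \<notin> P" for i
  proof (rule vanish)
    fix s j assume "s \<in> I"
    then show "\<bar>y i s $ j\<bar> < \<delta>" using small[OF that, of s j] y(1)[of i s j] e by linarith
  qed
  consider (none) "P = {}" | (one) k where "P = {k}" | (two) k l where "k \<in> P" "l \<in> P" "k \<noteq> l"
    by blast
  then have "ennreal (g z) \<le> (\<Sum>i. ennreal (g (y i))) + (\<Sum>i. w (y i)) + ennreal C * (c * indicator {2..} c)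
    \<and> (\<Sum>i. ennreal (g (y i))) \<le> ennreal (g z) + (\<Sum>i. w (y i)) + ennreal C * (c * indicator {2..} c)"
  proof cases
    case none
    have "g z = 0"
    proof (rule vanish)
      fix s j assume "s \<in> I"
      then have "z s $ j \<le> e / 2" using e none small by (intro z) auto
      moreover have "0 \<le> z s $ j" using y[of 0 s j] by linarith
      ultimately show "\<bar>z s $ j\<bar> < \<delta>" using e by linarith
    qed
    moreover have "g (y i) = 0" for i using g0 none by simp
    ultimately show ?thesis by simp
  next
    case one
    have "near I e z (y k)"
      unfolding near_def
    proof (intro ballI allI)
      fix s j assume s: "s \<in> I"
      \<comment> \<open>By the least upper bound property: every other point is at most e / 2, and
        \<open>y k\<close> itself is nonnegative.\<close>
      have "z s $ j \<le> y k s $ j + e / 2"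
      proof (rule z)
        fix i show "y i s $ j \<le> y k s $ j + e / 2"
          using small[of i s j] s one y(1)[of k s j] e by (cases "i = k") auto
      qed (use y(1)[of k s j] e in simp)
      then show "\<bar>z s $ j - y k s $ j\<bar> < e" using y(2)[of k s j] e by linarith
    qed
    then have "ennreal \<bar>g z - g (y k)\<bar> \<le> osc I g e (y k)"
      unfolding osc_def by (intro SUP_upper) simp
    also have "\<dots> \<le> w (y k)" by (rule w)
    also have "w (y k) \<le> (\<Sum>i. w (y i))"
      using sum_le_suminf[OF summableI, of "{k}" "\<lambda>i. w (y i)"] by simp
    finally have d: "ennreal \<bar>g z - g (y k)\<bar> \<le> (\<Sum>i. w (y i))" .
    have s: "(\<Sum>i. ennreal (g (y i))) = ennreal (g (y k))"
      using one g0 by (subst suminf_finite[of "{k}"]) auto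
    have "ennreal (g z) \<le> ennreal (g (y k)) + ennreal \<bar>g z - g (y k)\<bar>"
      "ennreal (g (y k)) \<le> ennreal (g z) + ennreal \<bar>g z - g (y k)\<bar>"
      using g(1) by (auto simp: ennreal_plus[symmetric] simp del: ennreal_plus intro!: ennreal_leI)
    then have "ennreal (g z) \<le> ennreal (g (y k)) + (\<Sum>i. w (y i))"
      "ennreal (g (y k)) \<le> ennreal (g z) + (\<Sum>i. w (y i))"
      using d by (meson add_left_mono order_trans)+
    then show ?thesis unfolding s by (auto intro: add_increasing2)
  next
    case two
    have "(2::ennreal) = (\<Sum>i\<in>{k, l}. indicator P i)" using two by simp
    also have "\<dots> \<le> c" unfolding c_def P_def by (rule sum_le_suminf[OF summableI]) auto
    finally have c2: "2 \<le> c" .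
    then have ind: "c * indicator {2..} c = c" by simp
    \<comment> \<open>Both sides are dominated by C c: g is at most C at the supremum, and in the
      sum only the large points contribute, each at most C.\<close>
    have "1 \<le> c" using c2 by (rule order_trans[rotated]) simp
    then have "ennreal C * 1 \<le> ennreal C * c" by (intro mult_left_mono) auto
    then have "ennreal (g z) \<le> ennreal C * c" using g(2)[of z] by (auto intro: order_trans ennreal_leI)
    moreover have "(\<Sum>i. ennreal (g (y i))) \<le> ennreal C * c"
    proof -
      have "(\<Sum>i. ennreal (g (y i))) \<le> (\<Sum>i. ennreal C * indicator P i)"
        by (intro suminf_le summableI) (auto simp: g0 g(2) indicator_def intro!: ennreal_leI)
      also have "\<dots> = ennreal C * c" by (simp add: c_def P_def)
      finally show ?thesis .
    qed
    ultimately show ?thesis unfolding ind by (auto intro: add_increasing)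
  qed
  then show "ennreal (g z) \<le> (\<Sum>i. ennreal (g (y i))) + (\<Sum>i. w (y i)) + ennreal C * (c * indicator {2..} c)"
    and "(\<Sum>i. ennreal (g (y i))) \<le> ennreal (g z) + (\<Sum>i. w (y i)) + ennreal C * (c * indicator {2..} c)"
    by auto
qed

context max_storm_process
begin

section \<open>Tail asymptotics of expectations\<close>

text \<open>At the scale \<open>e n\<close>, the rescaled expectation differs from the limit by at
  most W n + R n x. Here W n is the integrated oscillation, independent of x, and R n x accounts for
  two or more large storms. R n x vanishes as x grows with n fixed, and W n vanishes by dominated
  convergence as n grows.\<close>

lemma tail_integral_tendsto_nonneg:
  assumes I: "finite I" and [measurable]: "g \<in> borel_measurable path_space"
    and g: "\<And>y. 0 \<le> g y" "\<And>y. g y \<le> C"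
    and \<delta>: "0 < \<delta>" and vanish: "\<And>y. (\<And>s j. s \<in> I \<Longrightarrow> \<bar>y s $ j\<bar> < \<delta>) \<Longrightarrow> g y = 0"
    and D [measurable]: "D \<in> sets path_space"
    and cont: "\<And>y. y \<in> D \<Longrightarrow> continuous_in_coordinates I g y"
    and AE_D: "AE q in \<mu>. storm q \<in> D"
  shows "integrable \<mu> (\<lambda>q. g (storm q))"
    and "((\<lambda>x. x powr \<alpha> * (\<integral>\<omega>. g (\<lambda>s. (1 / x) *\<^sub>R Z s \<omega>) \<partial>\<Omega>)) \<longlongrightarrow> (\<integral>q. g (storm q) \<partial>\<mu>)) at_top"
proof -
  have C: "0 \<le> C" using g order_trans by blast
  define A where "A = (\<integral>\<^sup>+q. ennreal (g (storm q)) \<partial>\<mu>)"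
  have fin: "emeasure \<mu> (large_storms I r) < \<infinity>" if "0 < r" for r
    by (rule emeasure_large_storms_finite[OF I that])
  \<comment> \<open>The majorant for dominated convergence, integrable since large storms have
    finite mass. The level \<delta> / 2 leaves room for perturbations of size \<delta> / 2.\<close>
  have g_large: "g (storm q) \<le> C * indicator (large_storms I (\<delta> / 2)) q" if "q \<in> space \<mu>" for q
  proof (cases "q \<in> large_storms I (\<delta> / 2)")
    case False
    have "g (storm q) = 0"
    proof (rule vanish)
      fix s j assume "s \<in> I"
      then have "storm q s $ j \<le> \<delta> / 2" using False that unfolding large_storms_def mem_Collect_eq by (meson not_less)
      then show "\<bar>storm q s $ j\<bar> < \<delta>" using storm_nonneg[OF that, of s j] \<delta> by linarith
    qed
    then show ?thesis using False by simp
  qed (use g in simp)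
  have "A \<le> (\<integral>\<^sup>+q. ennreal C * indicator (large_storms I (\<delta> / 2)) q \<partial>\<mu>)"
    unfolding A_def
  proof (rule nn_integral_mono)
    fix q assume "q \<in> space \<mu>"
    then have "ennreal (g (storm q)) \<le> ennreal (C * indicator (large_storms I (\<delta> / 2)) q)"
      by (intro ennreal_leI g_large)
    then show "ennreal (g (storm q)) \<le> ennreal C * indicator (large_storms I (\<delta> / 2)) q"
      by (cases "q \<in> large_storms I (\<delta> / 2)") simp_all
  qed
  also have "\<dots> < \<infinity>" using fin[of "\<delta> / 2"] \<delta>
    by (simp add: nn_integral_cmult ennreal_mult_less_top)
  finally have A_fin: "A < \<infinity>" .
  show int: "integrable \<mu> (\<lambda>q. g (storm q))"
    using A_fin g(1) by (intro integrableI_bounded) (auto simp: A_def)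
  have A_eq: "A = ennreal (\<integral>q. g (storm q) \<partial>\<mu>)"
    unfolding A_def using g(1) int by (intro nn_integral_eq_integral) auto
  \<comment> \<open>With e n \<le> \<delta> / 2, a path within e n of a storm outside
    \<open>large_storms I (\<delta> / 2)\<close> stays below \<delta> over I, so g vanishes at both
    and the oscillation has the same majorant.\<close>
  define e where "e n = \<delta> / 2 / real (Suc n)" for n
  have e: "0 < e n" "e n \<le> \<delta> / 2" for n
    using \<delta> by (auto simp: e_def divide_le_eq_1 field_simps)
  have e_lim: "e \<longlonglongrightarrow> 0"
    unfolding e_def by (rule LIMSEQ_Suc[OF lim_const_over_n])
  define w where "w n y = (if y \<in> D then osc I g (e n) y else \<infinity>)" for n y
  have w_meas [measurable]: "w n \<in> borel_measurable path_space" for n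
    unfolding w_def[abs_def] by (rule osc_measurable[OF I D cont])
  define W where "W n = (\<integral>\<^sup>+q. w n (storm q) \<partial>\<mu>)" for n
  have "W \<longlonglongrightarrow> (\<integral>\<^sup>+q. 0 \<partial>\<mu>)"
    unfolding W_def
  proof (rule nn_integral_dominated_convergence[where w="\<lambda>q. ennreal C * indicator (large_storms I (\<delta> / 2)) q"])
    show "AE q in \<mu>. w n (storm q) \<le> ennreal C * indicator (large_storms I (\<delta> / 2)) q" for n
      using AE_D AE_space
    proof eventually_elim
      case (elim q)
      have "osc I g (e n) (storm q) \<le> ennreal C * indicator (large_storms I (\<delta> / 2)) q"
        unfolding osc_def
      proof (rule SUP_least)
        fix y' assume "y' \<in> {y'. near I (e n) y' (storm q)}"
        then have y': "near I (e n) y' (storm q)" by simp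
        show "ennreal \<bar>g y' - g (storm q)\<bar> \<le> ennreal C * indicator (large_storms I (\<delta> / 2)) q"
        proof (cases "q \<in> large_storms I (\<delta> / 2)")
          case True
          have "\<bar>g y' - g (storm q)\<bar> \<le> C"
            using g(1)[of y'] g(2)[of y'] g(1)[of "storm q"] g(2)[of "storm q"] by linarith
          then show ?thesis using True by (auto intro: ennreal_leI)
        next
          case False
          have "g y' = 0"
          proof (rule vanish)
            fix s j assume s: "s \<in> I"
            then have "storm q s $ j \<le> \<delta> / 2" using False elim(2) unfolding large_storms_def mem_Collect_eq by (meson not_less)
            moreover have "\<bar>y' s $ j - storm q s $ j\<bar> < e n" using y' s by (simp add: near_def)
            ultimately show "\<bar>y' s $ j\<bar> < \<delta>"
              using storm_nonneg[OF elim(2), of s j] e(2)[of n] by linarith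
          qed
          moreover have "g (storm q) = 0" using g_large[OF elim(2)] g(1)[of "storm q"] False by simp
          ultimately show ?thesis by simp
        qed
      qed
      then show ?case using elim by (simp add: w_def)
    qed
    show "(\<integral>\<^sup>+q. ennreal C * indicator (large_storms I (\<delta> / 2)) q \<partial>\<mu>) < \<infinity>"
      using fin[of "\<delta> / 2"] \<delta> by (simp add: nn_integral_cmult ennreal_mult_less_top)
    show "AE q in \<mu>. (\<lambda>n. w n (storm q)) \<longlonglongrightarrow> 0"
      using AE_D by eventually_elim (simp add: w_def osc_tendsto_0 cont e e_lim)
  qed measurable
  then have W_lim: "W \<longlonglongrightarrow> 0" by simp
  \<comment> \<open>This is C x^\<alpha> E[c; c \<ge> 2] for a Poisson count c with mean
    x^(-\<alpha>) m, where m is the mass at level e n / 2: the factors x^\<alpha> and x^(-\<alpha>)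
    cancel in x^\<alpha> (mean - mean exp(-mean)).\<close>
  define R where "R n x = C * (measure \<mu> (large_storms I (e n / 2)) *
      (1 - exp (- (x powr (- \<alpha>) * measure \<mu> (large_storms I (e n / 2))))))" for n x
  have R_lim: "(R n \<longlongrightarrow> 0) at_top" for n
  proof -
    have "((\<lambda>x. x powr (- \<alpha>)) \<longlongrightarrow> 0) at_top"
      using \<alpha> by (intro tendsto_neg_powr filterlim_ident) simp
    then have "(R n \<longlongrightarrow> C * (measure \<mu> (large_storms I (e n / 2)) *
        (1 - exp (- (0 * measure \<mu> (large_storms I (e n / 2))))))) at_top"
      unfolding R_def by (intro tendsto_intros)
    then show ?thesis by simp
  qed
  define a where "a x = x powr \<alpha> * (\<integral>\<omega>. g (\<lambda>s. (1 / x) *\<^sub>R Z s \<omega>) \<partial>\<Omega>)" for x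
  have scaled_Z_meas [measurable]: "(\<lambda>\<omega>. g (\<lambda>s. (1 / x) *\<^sub>R Z s \<omega>)) \<in> borel_measurable \<Omega>" for x
    by (rule measurable_compose[OF _ assms(2)], rule measurable_PiM_single') auto
  have key: "ennreal (a x) \<le> A + W n + ennreal (R n x)" "A \<le> ennreal (a x) + W n + ennreal (R n x)"
    if x: "0 < x" for n x
  proof -
    let ?B = "large_storms I (x * (e n / 2))"
    let ?m1 = "measure \<mu> (large_storms I (e n / 2))"
    define c where "c = point_count p ?B"
    have c_meas [measurable]: "c \<in> borel_measurable \<Omega>"
      unfolding c_def by (rule point_count_measurable[OF ppp sets_large_storms])
    \<comment> \<open>The storms divided by x, written as a rescaling of u so that Campbell's
      formula and homogeneity produce the factor x^(-\<alpha>).\<close>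
    define y where "y i \<omega> = storm (1 / x * fst (p i \<omega>), snd (p i \<omega>))" for i \<omega>
    have sc: "(\<lambda>q. (1 / x * fst q, snd q)) \<in> \<mu> \<rightarrow>\<^sub>M \<mu>"
      using x by (intro intensity_scale_measurable) simp
    have campbell_scaled: "(\<integral>\<^sup>+\<omega>. (\<Sum>i. f (y i \<omega>)) \<partial>\<Omega>) = ennreal (x powr (- \<alpha>)) * (\<integral>\<^sup>+q. f (storm q) \<partial>\<mu>)"
      if f [measurable]: "f \<in> borel_measurable path_space" for f
    proof -
      have m: "(\<lambda>q. f (storm (1 / x * fst q, snd q))) \<in> borel_measurable \<mu>"
        by (rule measurable_compose[OF sc]) measurable
      have "(\<integral>\<^sup>+\<omega>. (\<Sum>i. f (y i \<omega>)) \<partial>\<Omega>) = (\<integral>\<^sup>+q. f (storm (1 / x * fst q, snd q)) \<partial>\<mu>)"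
        unfolding y_def by (rule campbell[OF ppp m])
      also have "\<dots> = ennreal ((1 / x) powr \<alpha>) * (\<integral>\<^sup>+q. f (storm q) \<partial>\<mu>)"
        using x by (intro nn_integral_intensity_scale[where f="\<lambda>q. f (storm q)"]) auto
      also have "(1 / x) powr \<alpha> = x powr (- \<alpha>)" using x by (simp add: powr_divide powr_minus_divide)
      finally show ?thesis .
    qed
    have y_meas: "(\<lambda>\<omega>. f (y i \<omega>)) \<in> borel_measurable \<Omega>"
      if f [measurable]: "f \<in> borel_measurable path_space" for f :: "_ \<Rightarrow> ennreal" and i
      unfolding y_def
      by (rule measurable_compose[OF p_measurable], rule measurable_compose[OF sc]) measurable
    have [measurable]: "(\<lambda>\<omega>. ennreal (g (y i \<omega>))) \<in> borel_measurable \<Omega>" "(\<lambda>\<omega>. w n (y i \<omega>)) \<in> borel_measurable \<Omega>" for i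
      by (auto intro!: y_meas)
    have y_eq: "y i \<omega> s $ j = storm (p i \<omega>) s $ j / x" for i \<omega> s j
      using storm_scale[of "1 / x" "fst (p i \<omega>)" "snd (p i \<omega>)" s] by (simp add: y_def)
    have pointwise: "AE \<omega> in \<Omega>.
        ennreal (g (\<lambda>s. (1 / x) *\<^sub>R Z s \<omega>)) \<le> (\<Sum>i. ennreal (g (y i \<omega>))) + (\<Sum>i. w n (y i \<omega>)) + ennreal C * (c \<omega> * indicator {2..} (c \<omega>))
      \<and> (\<Sum>i. ennreal (g (y i \<omega>))) \<le> ennreal (g (\<lambda>s. (1 / x) *\<^sub>R Z s \<omega>)) + (\<Sum>i. w n (y i \<omega>)) + ennreal C * (c \<omega> * indicator {2..} (c \<omega>))"
      using AE_ennreal_Z AE_space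
    proof eventually_elim
      case (elim \<omega>)
      let ?z = "\<lambda>s. (1 / x) *\<^sub>R Z s \<omega>"
      have Z_ub: "storm (p i \<omega>) s $ j \<le> Z s \<omega> $ j" for i s j
      proof -
        have "ennreal (storm (p i \<omega>) s $ j) \<le> ennreal (Z s \<omega> $ j)"
          using elim(1) by (simp add: Z_ext_def) (rule SUP_upper, simp)
        then show ?thesis by (simp add: ennreal_le_iff Z_nonneg)
      qed
      have Z_lub: "Z s \<omega> $ j \<le> b" if "0 \<le> b" "\<And>i. storm (p i \<omega>) s $ j \<le> b" for s j b
      proof -
        have "ennreal (Z s \<omega> $ j) \<le> ennreal b"
          using elim(1) that by (auto simp: Z_ext_def intro!: SUP_least ennreal_leI)
        then show ?thesis using that by (simp add: ennreal_le_iff)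
      qed
      have c_eq: "c \<omega> = (\<Sum>i. indicator {i. \<exists>s\<in>I. \<exists>j. e n / 2 < y i \<omega> s $ j} i)"
        unfolding c_def point_count_def
        using x p_space[OF elim(2)]
        by (intro arg_cong[where f=suminf] ext) (auto simp: indicator_def large_storms_def y_eq field_simps)
      have w_ge: "osc I g (e n) y \<le> w n y" for y by (simp add: w_def)
      have y0: "0 \<le> y i \<omega> s $ j" for i s j
        using storm_nonneg[OF p_space[OF elim(2)]] x by (simp add: y_eq)
      have yz: "y i \<omega> s $ j \<le> ?z s $ j" for i s j
        using Z_ub[of i s j] x by (simp add: y_eq divide_right_mono)
      have zb: "?z s $ j \<le> b" if "0 \<le> b" "\<And>i. y i \<omega> s $ j \<le> b" for s j b
        using Z_lub[of "b * x" s j] that x by (simp add: y_eq field_simps)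
      have "e n \<le> \<delta>" using e(2)[of n] \<delta> by linarith
      from single_big_jump[where I=I and g=g and C=C and \<delta>=\<delta> and e="e n" and y="\<lambda>i. y i \<omega>" and z="?z" and w="w n",
        OF g vanish e(1) this y0 yz zb w_ge]
      show ?case unfolding c_eq by blast
    qed
    have Eg: "(\<integral>\<^sup>+\<omega>. ennreal (g (\<lambda>s. (1 / x) *\<^sub>R Z s \<omega>)) \<partial>\<Omega>) = ennreal (\<integral>\<omega>. g (\<lambda>s. (1 / x) *\<^sub>R Z s \<omega>) \<partial>\<Omega>)"
      using g by (intro nn_integral_eq_integral \<Omega>.integrable_const_bound[where B=C]) auto
    have a_eq: "ennreal (x powr \<alpha>) * (\<integral>\<^sup>+\<omega>. ennreal (g (\<lambda>s. (1 / x) *\<^sub>R Z s \<omega>)) \<partial>\<Omega>) = ennreal (a x)"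
      using x g(1) unfolding Eg a_def by (subst ennreal_mult) (auto intro!: integral_nonneg_AE)
    have em: "emeasure \<mu> ?B = ennreal (x powr (- \<alpha>) * ?m1)"
      using emeasure_large_storms_scale[OF x, of I "e n / 2"] fin[of "e n / 2"] e(1)[of n]
      by (simp add: emeasure_eq_ennreal_measure ennreal_mult less_top)
    then have mB: "measure \<mu> ?B = x powr (- \<alpha>) * ?m1" by (simp add: measure_def)
    have xx: "x powr \<alpha> * x powr (- \<alpha>) = 1" using x by (simp add: powr_minus)
    have R_eq: "ennreal (x powr \<alpha>) * (\<integral>\<^sup>+\<omega>. ennreal C * (c \<omega> * indicator {2..} (c \<omega>)) \<partial>\<Omega>) = ennreal (R n x)"
    proof -
      have "(\<integral>\<^sup>+\<omega>. ennreal C * (c \<omega> * indicator {2..} (c \<omega>)) \<partial>\<Omega>)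
          = ennreal C * ennreal (measure \<mu> ?B - measure \<mu> ?B * exp (- measure \<mu> ?B))"
      proof -
        have "(\<lambda>\<omega>. c \<omega> * indicator {2..} (c \<omega>)) \<in> borel_measurable \<Omega>" by measurable
        then have "(\<integral>\<^sup>+\<omega>. ennreal C * (c \<omega> * indicator {2..} (c \<omega>)) \<partial>\<Omega>)
            = ennreal C * (\<integral>\<^sup>+\<omega>. c \<omega> * indicator {2..} (c \<omega>) \<partial>\<Omega>)"
          by (rule nn_integral_cmult)
        then show ?thesis
          using nn_integral_point_count_ge_2[OF ppp sets_large_storms, of I "x * (e n / 2)"] em
          by (simp add: c_def)
      qed
      also have "ennreal (x powr \<alpha>) * \<dots> = ennreal (x powr \<alpha> * (C * (measure \<mu> ?B - measure \<mu> ?B * exp (- measure \<mu> ?B))))"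
        using C by (simp add: ennreal_mult')
      also have "x powr \<alpha> * (C * (measure \<mu> ?B - measure \<mu> ?B * exp (- measure \<mu> ?B)))
          = (x powr \<alpha> * x powr (- \<alpha>)) * R n x"
        unfolding mB R_def by (simp add: algebra_simps)
      finally show ?thesis by (simp add: xx)
    qed
    have mult_cancel: "ennreal (x powr \<alpha>) * (ennreal (x powr (- \<alpha>)) * b) = b" for b
      using xx by (simp add: mult.assoc[symmetric] ennreal_mult[symmetric])
    have "(\<integral>\<^sup>+\<omega>. ennreal (g (\<lambda>s. (1 / x) *\<^sub>R Z s \<omega>)) \<partial>\<Omega>)
      \<le> (\<integral>\<^sup>+\<omega>. (\<Sum>i. ennreal (g (y i \<omega>))) + (\<Sum>i. w n (y i \<omega>)) + ennreal C * (c \<omega> * indicator {2..} (c \<omega>)) \<partial>\<Omega>)"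
      using pointwise by (intro nn_integral_mono_AE) (auto elim: eventually_mono)
    also have "\<dots> = ennreal (x powr (- \<alpha>)) * A + ennreal (x powr (- \<alpha>)) * W n
        + (\<integral>\<^sup>+\<omega>. ennreal C * (c \<omega> * indicator {2..} (c \<omega>)) \<partial>\<Omega>)"
      by (simp add: nn_integral_add campbell_scaled[of "\<lambda>y. ennreal (g y)"] campbell_scaled[of "w n"] A_def W_def)
    finally have "ennreal (x powr \<alpha>) * (\<integral>\<^sup>+\<omega>. ennreal (g (\<lambda>s. (1 / x) *\<^sub>R Z s \<omega>)) \<partial>\<Omega>)
      \<le> ennreal (x powr \<alpha>) * \<dots>" by (rule mult_left_mono) simp
    then show "ennreal (a x) \<le> A + W n + ennreal (R n x)"
      by (simp only: a_eq R_eq distrib_left mult_cancel)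
    have "ennreal (x powr (- \<alpha>)) * A = (\<integral>\<^sup>+\<omega>. (\<Sum>i. ennreal (g (y i \<omega>))) \<partial>\<Omega>)"
      by (simp add: campbell_scaled[of "\<lambda>y. ennreal (g y)"] A_def)
    also have "\<dots> \<le> (\<integral>\<^sup>+\<omega>. ennreal (g (\<lambda>s. (1 / x) *\<^sub>R Z s \<omega>)) + (\<Sum>i. w n (y i \<omega>)) + ennreal C * (c \<omega> * indicator {2..} (c \<omega>)) \<partial>\<Omega>)"
      using pointwise by (intro nn_integral_mono_AE) (auto elim: eventually_mono)
    also have "\<dots> = (\<integral>\<^sup>+\<omega>. ennreal (g (\<lambda>s. (1 / x) *\<^sub>R Z s \<omega>)) \<partial>\<Omega>) + ennreal (x powr (- \<alpha>)) * W n
        + (\<integral>\<^sup>+\<omega>. ennreal C * (c \<omega> * indicator {2..} (c \<omega>)) \<partial>\<Omega>)"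
      by (simp add: nn_integral_add campbell_scaled[of "w n"] W_def)
    finally have "ennreal (x powr \<alpha>) * (ennreal (x powr (- \<alpha>)) * A) \<le> ennreal (x powr \<alpha>) * \<dots>"
      by (rule mult_left_mono) simp
    then show "A \<le> ennreal (a x) + W n + ennreal (R n x)"
      by (simp only: a_eq R_eq distrib_left mult_cancel)
  qed
  have "(a \<longlongrightarrow> (\<integral>q. g (storm q) \<partial>\<mu>)) at_top"
  proof (rule tendstoI)
    fix r :: real assume r: "0 < r"
    \<comment> \<open>The scale n is fixed here, before x grows: R n x is small only for large x at
      a given n.\<close>
    have "eventually (\<lambda>n. W n < ennreal (r / 2)) sequentially"
      using W_lim r by (intro order_tendstoD(2)) auto
    then obtain n where n: "W n < ennreal (r / 2)" by (auto simp: eventually_sequentially)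
    then obtain v where v: "W n = ennreal v" "0 \<le> v" "v < r / 2"
      by (cases "W n") (auto simp: ennreal_less_iff)
    have "eventually (\<lambda>x. R n x < r / 2) at_top"
      using R_lim r by (intro order_tendstoD(2)[where y=0]) auto
    then show "eventually (\<lambda>x. dist (a x) (\<integral>q. g (storm q) \<partial>\<mu>) < r) at_top"
      using eventually_gt_at_top[of 0]
    proof eventually_elim
      case (elim x)
      let ?A = "\<integral>q. g (storm q) \<partial>\<mu>"
      have A0: "0 \<le> ?A" using g(1) by simp
      have a0: "0 \<le> a x" using g(1) by (simp add: a_def)
      have R0: "0 \<le> R n x" using C by (simp add: R_def)
      have nn: "0 \<le> ?A + v + R n x" "0 \<le> a x + v + R n x" using A0 a0 R0 v(2) by auto
      have "ennreal (a x) \<le> ennreal (?A + v + R n x)" "ennreal ?A \<le> ennreal (a x + v + R n x)"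
        using key[OF elim(2), of n] A0 a0 R0 v by (simp_all add: A_eq ennreal_plus)
      then have "a x \<le> ?A + v + R n x" "?A \<le> a x + v + R n x"
        by (simp_all only: ennreal_le_iff[OF nn(1)] ennreal_le_iff[OF nn(2)])
      then show ?case using v elim by (simp add: dist_real_def)
    qed
  qed
  then show "((\<lambda>x. x powr \<alpha> * (\<integral>\<omega>. g (\<lambda>s. (1 / x) *\<^sub>R Z s \<omega>) \<partial>\<Omega>)) \<longlongrightarrow> (\<integral>q. g (storm q) \<partial>\<mu>)) at_top"
    by (simp add: a_def[abs_def])
qed

text \<open>Positive and negative parts are treated separately; truncation at 0 preserves the bound,
  the vanishing near the origin and, being a contraction, the continuity.\<close>

lemma tail_integral_tendsto:
  assumes I: "finite I" and g [measurable]: "g \<in> borel_measurable path_space"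
    and bound: "\<And>y. \<bar>g y\<bar> \<le> C"
    and \<delta>: "0 < \<delta>" and vanish: "\<And>y. (\<And>s j. s \<in> I \<Longrightarrow> \<bar>y s $ j\<bar> < \<delta>) \<Longrightarrow> g y = 0"
    and D: "D \<in> sets path_space"
    and cont: "\<And>y. y \<in> D \<Longrightarrow> continuous_in_coordinates I g y"
    and AE_D: "AE q in \<mu>. storm q \<in> D"
  shows "((\<lambda>x. x powr \<alpha> * (\<integral>\<omega>. g (\<lambda>s. (1 / x) *\<^sub>R Z s \<omega>) \<partial>\<Omega>)) \<longlongrightarrow> (\<integral>q. g (storm q) \<partial>\<mu>)) at_top"
proof -
  have c1: "continuous_in_coordinates I (\<lambda>y. max (g y) 0) y" if "y \<in> D" for y
    using cont[OF that] unfolding continuous_in_coordinates_def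
    by (elim all_forward imp_forward ex_forward conj_forward) auto
  have c2: "continuous_in_coordinates I (\<lambda>y. max (- g y) 0) y" if "y \<in> D" for y
    using cont[OF that] unfolding continuous_in_coordinates_def
    by (elim all_forward imp_forward ex_forward conj_forward) auto
  have m: "(\<lambda>y. max (g y) 0) \<in> borel_measurable path_space" "(\<lambda>y. max (- g y) 0) \<in> borel_measurable path_space"
    by measurable
  have v: "max (g y) 0 = 0" "max (- g y) 0 = 0" if "\<And>s j. s \<in> I \<Longrightarrow> \<bar>y s $ j\<bar> < \<delta>" for y
    using vanish[OF that] by simp_all
  have b: "max (g y) 0 \<le> C" "max (- g y) 0 \<le> C" for y using bound[of y] by auto
  note L1 = tail_integral_tendsto_nonneg[OF I m(1) _ b(1) \<delta> v(1) D c1 AE_D]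
  note L2 = tail_integral_tendsto_nonneg[OF I m(2) _ b(2) \<delta> v(2) D c2 AE_D]
  have scaled_Z_meas [measurable]: "(\<lambda>\<omega>. g (\<lambda>s. (1 / x) *\<^sub>R Z s \<omega>)) \<in> borel_measurable \<Omega>" for x
    by (rule measurable_compose[OF _ g], rule measurable_PiM_single') auto
  have split: "r = max r 0 - max (- r) 0" for r :: real by simp
  have 1: "(\<integral>\<omega>. g (\<lambda>s. (1 / x) *\<^sub>R Z s \<omega>) \<partial>\<Omega>)
    = (\<integral>\<omega>. max (g (\<lambda>s. (1 / x) *\<^sub>R Z s \<omega>)) 0 \<partial>\<Omega>) - (\<integral>\<omega>. max (- g (\<lambda>s. (1 / x) *\<^sub>R Z s \<omega>)) 0 \<partial>\<Omega>)" for x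
    using b by (subst Bochner_Integration.integral_diff[symmetric])
      (auto intro!: \<Omega>.integrable_const_bound[where B=C] simp: split[symmetric])
  have 2: "(\<integral>q. g (storm q) \<partial>\<mu>) = (\<integral>q. max (g (storm q)) 0 \<partial>\<mu>) - (\<integral>q. max (- g (storm q)) 0 \<partial>\<mu>)"
    using L1(1) L2(1) by (subst Bochner_Integration.integral_diff[symmetric]) (auto simp: split[symmetric])
  show ?thesis
    unfolding 1 2 right_diff_distrib using L1(2) L2(2) by (intro tendsto_diff) auto
qed

end

section \<open>Block norms and directions\<close>

lemma tendsto_fun_coordinatewise:
  fixes f :: "'a \<Rightarrow> 'b \<Rightarrow> 'c::topological_space"
  assumes "\<And>i. ((\<lambda>n. f n i) \<longlongrightarrow> l i) F"
  shows "(f \<longlongrightarrow> l) F"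
proof -
  have "limitin (product_topology (\<lambda>_. euclidean) UNIV) f l F"
    unfolding limitin_componentwise using assms by (simp add: limitin_canonical_iff)
  then show ?thesis
    unfolding euclidean_product_topology limitin_canonical_iff .
qed

text \<open>By contradiction: counterexamples within 1 / (n + 1) of y over I are changed to agree
  with y outside I. They then converge to y in the product topology, while g is unaffected because
  it only sees I.\<close>

lemma continuous_in_coordinatesI:
  fixes g :: "(int \<Rightarrow> real^'n) \<Rightarrow> real"
  assumes cont: "isCont g y"
    and dep: "\<And>y y'. (\<And>s. s \<in> I \<Longrightarrow> y s = y' s) \<Longrightarrow> g y = g y'"
  shows "continuous_in_coordinates I g y"
proof (rule ccontr)
  assume "\<not> ?thesis"
  then obtain r where r: "r > 0" "\<And>e. e > 0 \<Longrightarrow> \<exists>y'. near I e y' y \<and> \<not> \<bar>g y' - g y\<bar> < r"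
    unfolding continuous_in_coordinates_def by blast
  have "\<forall>n. \<exists>y'. near I (1 / real (Suc n)) y' y \<and> \<not> \<bar>g y' - g y\<bar> < r"
    by (intro allI r(2)) simp
  then obtain Y where Y: "\<And>n. near I (1 / real (Suc n)) (Y n) y" "\<And>n. \<not> \<bar>g (Y n) - g y\<bar> < r"
    by metis
  define X where "X n s = (if s \<in> I then Y n s else y s)" for n s
  have "X \<longlonglongrightarrow> y"
  proof (rule tendsto_fun_coordinatewise, rule vec_tendstoI)
    fix s j
    have lim: "(\<lambda>n. 1 / real (Suc n)) \<longlonglongrightarrow> 0" by (rule LIMSEQ_Suc[OF lim_1_over_n])
    have "\<bar>X n s $ j - y s $ j\<bar> \<le> 1 / real (Suc n)" for n
    proof (cases "s \<in> I")
      case True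
      then show ?thesis using Y(1)[of n] by (auto simp: near_def X_def intro: less_imp_le)
    qed (simp add: X_def)
    then have "(\<lambda>n. X n s $ j - y s $ j) \<longlonglongrightarrow> 0"
      by (intro Lim_null_comparison[OF _ lim]) auto
    then show "(\<lambda>n. X n s $ j) \<longlonglongrightarrow> y s $ j" by (rule LIM_zero_cancel)
  qed
  then have "(\<lambda>n. g (X n)) \<longlonglongrightarrow> g y" by (rule isCont_tendsto_compose[OF cont])
  moreover have "g (X n) = g (Y n)" for n by (rule dep) (simp add: X_def)
  ultimately have "(\<lambda>n. g (Y n)) \<longlonglongrightarrow> g y" by simp
  then have "eventually (\<lambda>n. dist (g (Y n)) (g y) < r) sequentially" using r(1) by (rule tendstoD)
  then show False using Y(2) by (auto simp: dist_real_def eventually_sequentially)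
qed

lemma block_norm_less_iff:
  "finite I \<Longrightarrow> I \<noteq> {} \<Longrightarrow> r < block_norm N I y \<longleftrightarrow> (\<exists>u\<in>I. r < N (y u))"
  by (auto simp: block_norm_def Max_gr_iff)

lemma block_norm_singleton [simp]: "block_norm N {u} y = N (y u)"
  by (simp add: block_norm_def)

lemma block_norm_cong: "(\<And>u. u \<in> I \<Longrightarrow> y u = y' u) \<Longrightarrow> block_norm N I y = block_norm N I y'"
  unfolding block_norm_def by (auto cong: image_cong)

lemma block_norm_scaleR:
  assumes N: "is_norm N" and I: "finite I" "I \<noteq> {}" and c: "0 < c"
  shows "block_norm N I (\<lambda>u. c *\<^sub>R y u) = c * block_norm N I y"
proof -
  have "block_norm N I (\<lambda>u. c *\<^sub>R y u) = Max ((\<lambda>b. c * b) ` (\<lambda>u. N (y u)) ` I)"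
    using N c by (simp add: block_norm_def is_norm_def image_image)
  also have "\<dots> = c * Max ((\<lambda>u. N (y u)) ` I)"
    using I c by (intro mono_Max_commute[symmetric]) (auto intro!: monoI mult_left_mono)
  finally show ?thesis by (simp add: block_norm_def)
qed

lemma continuous_on_block_norm:
  fixes N :: "real^'n \<Rightarrow> real"
  assumes N: "is_norm N" and I: "finite I" "I \<noteq> {}"
  shows "continuous_on UNIV (block_norm N I)"
  using I
proof (induction I rule: finite_ne_induct)
  case (singleton u)
  show ?case unfolding block_norm_singleton[abs_def]
    by (rule continuous_on_compose2[OF is_norm_continuous_on[OF N, of UNIV] continuous_on_product_coordinates]) simp
next
  case (insert u F)
  have eq: "block_norm N (insert u F) = (\<lambda>y. max (N (y u)) (block_norm N F y))"
    using insert.hyps by (auto simp: block_norm_def fun_eq_iff)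
  show ?case unfolding eq
    by (intro continuous_on_max insert.IH
        continuous_on_compose2[OF is_norm_continuous_on[OF N, of UNIV] continuous_on_product_coordinates]) simp
qed

text \<open>Two windows: I supplies the norm, J the recorded coordinates. Regular variation uses I =
  J, the spectral tail process I = {0} and J = {s..t}. Restriction to J puts the value into the
  space of \<open>PiM J\<close>.\<close>

definition direction :: "(real^'n \<Rightarrow> real) \<Rightarrow> int set \<Rightarrow> int set \<Rightarrow> (int \<Rightarrow> real^'n) \<Rightarrow> int \<Rightarrow> real^'n" where
  "direction N I J y = (\<lambda>u\<in>J. (1 / block_norm N I y) *\<^sub>R y u)"

lemma direction_scaleR:
  assumes "is_norm N" "finite I" "I \<noteq> {}" "0 < c"
  shows "direction N I J (\<lambda>u. c *\<^sub>R y u) = direction N I J y"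
  using assms by (auto simp: direction_def block_norm_scaleR fun_eq_iff)

lemma direction_in_PiE: "direction N I J y \<in> (\<Pi>\<^sub>E i\<in>J. UNIV)"
  by (auto simp: direction_def)

text \<open>Continuity is only given on the functions that are undefined outside J. Composing with
  the restriction to J gives a continuous, hence Borel, function of full paths, where Borel sets and
  product sets agree.\<close>

lemma borel_measurable_continuous_on_PiE:
  fixes \<phi> :: "(int \<Rightarrow> real^'n) \<Rightarrow> real"
  assumes "continuous_on (\<Pi>\<^sub>E i\<in>J. UNIV) \<phi>"
  shows "\<phi> \<in> borel_measurable (PiM J (\<lambda>_. borel))"
proof -
  have "continuous_on UNIV (\<lambda>y::int \<Rightarrow> real^'n. restrict y J)"
  proof (rule continuous_on_coordinatewise_then_product)
    fix i show "continuous_on UNIV (\<lambda>y::int \<Rightarrow> real^'n. restrict y J i)"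
      by (cases "i \<in> J") (auto intro: continuous_on_product_coordinates)
  qed
  then have "continuous_on UNIV (\<lambda>y. \<phi> (restrict y J))"
    by (rule continuous_on_compose2[OF assms]) auto
  then have "(\<lambda>y. \<phi> (restrict y J)) \<in> borel_measurable borel"
    by (rule borel_measurable_continuous_onI)
  then have m: "(\<lambda>y. \<phi> (restrict y J)) \<in> borel_measurable path_space"
    by (subst measurable_cong_sets[OF sets_path_space_eq_borel refl])
  \<comment> \<open>Padding by 0 leads back from \<open>PiM J\<close> to full paths; the restriction
    in the composed function undoes it.\<close>
  have e: "(\<lambda>y i. if i \<in> J then y i else 0) \<in> PiM J (\<lambda>_. borel) \<rightarrow>\<^sub>M (path_space :: (int \<Rightarrow> real^'n) measure)"
  proof (rule measurable_PiM_single')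
    fix i show "(\<lambda>y. if i \<in> J then y i else 0) \<in> PiM J (\<lambda>_. borel) \<rightarrow>\<^sub>M (borel :: (real^'n) measure)"
      by (cases "i \<in> J") auto
  qed auto
  have "(\<lambda>y. \<phi> (restrict (\<lambda>i. if i \<in> J then y i else 0) J)) \<in> borel_measurable (PiM J (\<lambda>_. borel))"
    by (rule measurable_compose[OF e m])
  moreover have "restrict (\<lambda>i. if i \<in> J then y i else 0) J = y" if "y \<in> space (PiM J (\<lambda>_. borel))" for y :: "int \<Rightarrow> real^'n"
    using that by (auto simp: space_PiM PiE_def extensional_def fun_eq_iff)
  ultimately show ?thesis by (subst measurable_cong[symmetric]) auto
qed

context max_storm_process
begin

lemma block_norm_measurable [measurable]:
  assumes "finite I" "I \<noteq> {}"
  shows "block_norm N I \<in> borel_measurable path_space"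
  by (subst measurable_cong_sets[OF sets_path_space_eq_borel refl])
     (rule borel_measurable_continuous_onI[OF continuous_on_block_norm[OF norm assms]])

lemma direction_measurable:
  assumes "finite I" "I \<noteq> {}"
  shows "direction N I J \<in> path_space \<rightarrow>\<^sub>M PiM J (\<lambda>_. borel)"
proof -
  note [measurable] = block_norm_measurable[OF assms]
  show ?thesis unfolding direction_def[abs_def] by measurable
qed

section \<open>Functionals of the direction with a radial cut-off\<close>

text \<open>The cut-off is a sharp indicator, because conditioning on a norm exceeding x produces
  exactly this; rescaling the path then only changes r.\<close>

definition angular_tail :: "int set \<Rightarrow> int set \<Rightarrow> ((int \<Rightarrow> real ^ 'n) \<Rightarrow> real) \<Rightarrow> real \<Rightarrow> (int \<Rightarrow> real ^ 'n) \<Rightarrow> real" where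
  "angular_tail I J \<phi> r y = (if r < block_norm N I y then \<phi> (direction N I J y) else 0)"

lemma angular_tail_measurable:
  assumes "finite I" "I \<noteq> {}" and "\<phi> \<in> borel_measurable (PiM J (\<lambda>_. borel))"
  shows "angular_tail I J \<phi> r \<in> borel_measurable path_space"
proof -
  note [measurable] = block_norm_measurable[OF assms(1,2)] measurable_compose[OF direction_measurable[OF assms(1,2)] assms(3)]
  show ?thesis unfolding angular_tail_def[abs_def] by measurable
qed

lemma angular_tail_scaleR:
  assumes "finite I" "I \<noteq> {}" "0 < c"
  shows "angular_tail I J \<phi> r (\<lambda>s. c *\<^sub>R y s) = angular_tail I J \<phi> (r / c) y"
  using assms by (simp add: angular_tail_def block_norm_scaleR[OF norm] direction_scaleR[OF norm] field_simps)

text \<open>The block norm of a storm is u times a function of (t, \<theta>), so the absence of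
  atoms in u applies. This is what makes the jump of \<open>angular_tail\<close> harmless.\<close>

lemma AE_block_norm_storm_neq:
  assumes I: "finite I" "I \<noteq> {}" and r: "r \<noteq> 0"
  shows "AE q in \<mu>. block_norm N I (storm q) \<noteq> r"
proof -
  have "(\<lambda>q. storm (1, q)) \<in> count_space UNIV \<Otimes>\<^sub>M nonneg_path_space \<rightarrow>\<^sub>M path_space"
    by (rule measurable_PiM_single') auto
  from AE_intensity_radial_neq[OF measurable_compose[OF this block_norm_measurable[OF I]] r] AE_space
  show ?thesis
  proof eventually_elim
    case (elim q)
    have "storm q = (\<lambda>s. fst q *\<^sub>R storm (1, snd q) s)"
      using storm_scale[of "fst q" 1 "snd q"] by (auto simp: fun_eq_iff)
    moreover have "0 < fst q" using elim(2) by (auto simp: space_intensity)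
    ultimately have "block_norm N I (storm q) = fst q * block_norm N I (storm (1, snd q))"
      using block_norm_scaleR[OF norm I, of "fst q" "storm (1, snd q)"] by simp
    then show ?case using elim(1) by simp
  qed
qed

text \<open>Off the sphere of radius r the path lies in one of two open sets: inside, the functional
  is constantly 0; outside, the norm exceeds r > 0 and normalising is continuous.\<close>

lemma isCont_angular_tail:
  assumes I: "finite I" "I \<noteq> {}" and r: "0 < r"
    and \<phi>: "continuous_on (\<Pi>\<^sub>E i\<in>J. UNIV) \<phi>" and y: "block_norm N I y \<noteq> r"
  shows "isCont (angular_tail I J \<phi> r) y"
proof -
  note cont = continuous_on_block_norm[OF norm I]
  consider "r < block_norm N I y" | "block_norm N I y < r" using y by linarith
  then show ?thesis
  proof cases
    case 1
    let ?S = "{y. r < block_norm N I y}"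
    have op: "open ?S" by (intro open_Collect_less cont continuous_on_const)
    have "continuous_on ?S (direction N I J)"
    proof (rule continuous_on_coordinatewise_then_product)
      fix i show "continuous_on ?S (\<lambda>y. direction N I J y i)"
      proof (cases "i \<in> J")
        case True
        have "continuous_on ?S (\<lambda>y. (1 / block_norm N I y) *\<^sub>R y i)"
          using r by (intro continuous_intros continuous_on_subset[OF cont]
            continuous_on_subset[OF continuous_on_product_coordinates]) auto
        then show ?thesis using True by (simp add: direction_def)
      qed (simp add: direction_def)
    qed
    then have "continuous_on ?S (\<lambda>y. \<phi> (direction N I J y))"
      by (rule continuous_on_compose2[OF \<phi>]) (use direction_in_PiE in blast)
    then have "continuous_on ?S (angular_tail I J \<phi> r)"
      by (rule continuous_on_eq) (simp add: angular_tail_def)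
    then show ?thesis using op 1 by (simp add: continuous_on_eq_continuous_at)
  next
    case 2
    let ?S = "{y. block_norm N I y < r}"
    have op: "open ?S" by (intro open_Collect_less cont continuous_on_const)
    have "continuous_on ?S (angular_tail I J \<phi> r)"
      by (rule continuous_on_eq[OF continuous_on_const[of _ 0]]) (simp add: angular_tail_def)
    then show ?thesis using op 2 by (simp add: continuous_on_eq_continuous_at)
  qed
qed

lemma angular_tail_tendsto:
  assumes I: "finite I" "I \<noteq> {}" and J: "finite J" and r: "0 < r"
    and \<phi>: "continuous_on (\<Pi>\<^sub>E i\<in>J. UNIV) \<phi>" "bounded (\<phi> ` (\<Pi>\<^sub>E i\<in>J. UNIV))"
  shows "((\<lambda>x. x powr \<alpha> * (\<integral>\<omega>. angular_tail I J \<phi> (r * x) (\<lambda>s. Z s \<omega>) \<partial>\<Omega>))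
      \<longlongrightarrow> (\<integral>q. angular_tail I J \<phi> r (storm q) \<partial>\<mu>)) at_top"
proof -
  obtain B where B: "\<And>y. y \<in> (\<Pi>\<^sub>E i\<in>J. UNIV) \<Longrightarrow> \<bar>\<phi> y\<bar> \<le> B"
    using \<phi>(2) by (auto simp: bounded_iff)
  obtain C where C: "C > 0" "\<And>(x::real^'n) d. (\<forall>j. \<bar>x $ j\<bar> \<le> d) \<Longrightarrow> N x \<le> C * d"
    using is_norm_le_Sup_coordinates[OF norm] by blast
  have "((\<lambda>x. x powr \<alpha> * (\<integral>\<omega>. angular_tail I J \<phi> r (\<lambda>s. (1 / x) *\<^sub>R Z s \<omega>) \<partial>\<Omega>))
      \<longlongrightarrow> (\<integral>q. angular_tail I J \<phi> r (storm q) \<partial>\<mu>)) at_top"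
  \<comment> \<open>The functional reads the coordinates in I and J. If all of these are below r /
    C, then N is at most r over I and the cut-off gives 0. D removes the sphere where the functional
    jumps.\<close>
  proof (rule tail_integral_tendsto[where I="I \<union> J" and C="\<bar>B\<bar>" and \<delta>="r / C" and D="{y. block_norm N I y \<noteq> r}"])
    show "finite (I \<union> J)" using I J by simp
    show "angular_tail I J \<phi> r \<in> borel_measurable path_space"
      using I \<phi> by (intro angular_tail_measurable borel_measurable_continuous_on_PiE)
    show "\<bar>angular_tail I J \<phi> r y\<bar> \<le> \<bar>B\<bar>" for y
      using B[OF direction_in_PiE] by (auto simp: angular_tail_def intro: order_trans[OF _ abs_ge_self])
    show "0 < r / C" using r C by simp
    show "angular_tail I J \<phi> r y = 0" if y: "\<And>s j. s \<in> I \<union> J \<Longrightarrow> \<bar>y s $ j\<bar> < r / C" for y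
    proof -
      have "N (y u) \<le> r" if "u \<in> I" for u
      proof -
        have "N (y u) \<le> C * (r / C)" using y[of u] that by (intro C(2)) (auto intro: less_imp_le)
        then show ?thesis using C(1) by simp
      qed
      then have "\<not> r < block_norm N I y" using I by (auto simp: block_norm_less_iff not_less)
      then show ?thesis by (simp add: angular_tail_def)
    qed
    show "{y. block_norm N I y \<noteq> r} \<in> sets path_space"
      using measurable_sets[OF block_norm_measurable[OF I], of "- {r}"]
      by (simp add: vimage_def space_PiM)
    show "continuous_in_coordinates (I \<union> J) (angular_tail I J \<phi> r) y" if "y \<in> {y. block_norm N I y \<noteq> r}" for y
    proof (rule continuous_in_coordinatesI)
      show "isCont (angular_tail I J \<phi> r) y" using that by (intro isCont_angular_tail I r \<phi>) simp
      fix y y' :: "int \<Rightarrow> real ^ 'n" assume eq: "\<And>s. s \<in> I \<union> J \<Longrightarrow> y s = y' s"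
      have "block_norm N I y = block_norm N I y'" using eq by (intro block_norm_cong) auto
      moreover from this have "direction N I J y = direction N I J y'"
        using eq by (auto simp: direction_def fun_eq_iff)
      ultimately show "angular_tail I J \<phi> r y = angular_tail I J \<phi> r y'"
        by (simp add: angular_tail_def)
    qed
    show "AE q in \<mu>. storm q \<in> {y. block_norm N I y \<noteq> r}"
      using AE_block_norm_storm_neq[OF I, of r] r by simp
  qed
  \<comment> \<open>For x > 0, dividing the path by x amounts to raising the threshold from r to r
    x.\<close>
  then show ?thesis
    by (rule Lim_transform_eventually)
       (use eventually_gt_at_top[of 0] in eventually_elim, simp add: angular_tail_scaleR I)
qed

lemma integral_angular_tail_scale:
  assumes I: "finite I" "I \<noteq> {}" and r: "0 < r" and \<phi>: "\<phi> \<in> borel_measurable (PiM J (\<lambda>_. borel))"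
  shows "(\<integral>q. angular_tail I J \<phi> r (storm q) \<partial>\<mu>) = r powr (- \<alpha>) * (\<integral>q. angular_tail I J \<phi> 1 (storm q) \<partial>\<mu>)"
proof -
  let ?s = "\<lambda>q. (1 / r * fst q, snd q)"
  have m: "?s \<in> \<mu> \<rightarrow>\<^sub>M \<mu>" using r by (intro intensity_scale_measurable) simp
  have f: "(\<lambda>q. angular_tail I J \<phi> 1 (storm q)) \<in> borel_measurable \<mu>"
    by (rule measurable_compose[OF storm_measurable angular_tail_measurable[OF I \<phi>]])
  have sub: "angular_tail I J \<phi> 1 (storm (?s q)) = angular_tail I J \<phi> r (storm q)" for q
  proof -
    have "storm (?s q) = (\<lambda>s. (1 / r) *\<^sub>R storm q s)"
      using storm_scale[of "1 / r" "fst q" "snd q"] by (auto simp: fun_eq_iff)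
    then show ?thesis using r by (simp add: angular_tail_scaleR I)
  qed
  \<comment> \<open>Homogeneity is stated as an equality of measures, so that it carries over to
    Bochner integrals of signed functions.\<close>
  have "distr \<mu> \<mu> ?s = density \<mu> (\<lambda>_. ennreal (r powr (- \<alpha>)))"
  proof (rule measure_eqI)
    fix A assume "A \<in> sets (distr \<mu> \<mu> ?s)"
    then have A: "A \<in> sets \<mu>" by simp
    have "?s -` A \<inter> space \<mu> = {q \<in> space \<mu>. ?s q \<in> A}" by auto
    then have "emeasure (distr \<mu> \<mu> ?s) A = ennreal ((1 / r) powr \<alpha>) * emeasure \<mu> A"
      using r by (simp only: emeasure_distr[OF m A]) (rule emeasure_intensity_scale[OF A], simp)
    also have "(1 / r) powr \<alpha> = r powr (- \<alpha>)" using r by (simp add: powr_divide powr_minus_divide)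
    finally show "emeasure (distr \<mu> \<mu> ?s) A = emeasure (density \<mu> (\<lambda>_. ennreal (r powr (- \<alpha>)))) A"
      using A by (simp add: emeasure_density_const)
  qed simp
  then have "(\<integral>q. angular_tail I J \<phi> 1 (storm (?s q)) \<partial>\<mu>)
      = (\<integral>q. angular_tail I J \<phi> 1 (storm q) \<partial>density \<mu> (\<lambda>_. ennreal (r powr (- \<alpha>))))"
    using integral_distr[OF m f] by simp
  also have "\<dots> = r powr (- \<alpha>) * (\<integral>q. angular_tail I J \<phi> 1 (storm q) \<partial>\<mu>)"
    by (subst integral_density[OF f]) auto
  finally show ?thesis by (simp only: sub)
qed

section \<open>Limit constants and tail probabilities\<close>

definition tail_mass :: "int set \<Rightarrow> real" where
  "tail_mass I = measure \<mu> {q \<in> space \<mu>. 1 < block_norm N I (storm q)}"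

lemma tail_set_measurable [measurable]:
  assumes "finite I" "I \<noteq> {}"
  shows "{q \<in> space \<mu>. 1 < block_norm N I (storm q)} \<in> sets \<mu>"
  using measurable_compose[OF storm_measurable block_norm_measurable[OF assms]] by measurable

lemma emeasure_tail_set_finite:
  assumes I: "finite I" "I \<noteq> {}"
  shows "emeasure \<mu> {q \<in> space \<mu>. 1 < block_norm N I (storm q)} < \<infinity>"
proof -
  have "emeasure \<mu> {q \<in> space \<mu>. 1 < block_norm N I (storm q)} \<le> emeasure \<mu> (\<Union>s\<in>I. {q \<in> space \<mu>. 1 < N (storm q s)})"
    using I by (intro emeasure_mono) (auto simp: block_norm_less_iff)
  also have "\<dots> \<le> (\<Sum>s\<in>I. emeasure \<mu> {q \<in> space \<mu>. 1 < N (storm q s)})"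
    using I by (intro emeasure_subadditive_finite) auto
  also have "\<dots> < \<infinity>" by (simp add: emeasure_storm_norm_gt of_nat_less_top)
  finally show ?thesis .
qed

lemma tail_mass_singleton: "tail_mass {u} = 1"
  using emeasure_storm_norm_gt[of 1 u] by (simp add: tail_mass_def measure_def)

text \<open>For any time u in I the event contains the storms with norm above 1 at u, which have
  mass 1.\<close>

lemma tail_mass_pos:
  assumes I: "finite I" "I \<noteq> {}"
  shows "0 < tail_mass I"
proof -
  obtain u where u: "u \<in> I" using I by auto
  have "emeasure \<mu> {q \<in> space \<mu>. 1 < N (storm q u)} \<le> emeasure \<mu> {q \<in> space \<mu>. 1 < block_norm N I (storm q)}"
    using I u by (intro emeasure_mono tail_set_measurable) (auto simp: block_norm_less_iff)
  then have "1 \<le> emeasure \<mu> {q \<in> space \<mu>. 1 < block_norm N I (storm q)}"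
    using emeasure_storm_norm_gt[of 1 u] by simp
  then show ?thesis
    using emeasure_tail_set_finite[OF I]
    by (simp add: tail_mass_def emeasure_eq_ennreal_measure less_top ennreal_1[symmetric] ennreal_le_iff del: ennreal_1)
qed

abbreviation (input) tail_prob :: "int set \<Rightarrow> real \<Rightarrow> real" where
  "tail_prob I x \<equiv> \<Omega>.prob {\<omega> \<in> space \<Omega>. x < block_norm N I (\<lambda>s. Z s \<omega>)}"

lemma Z_block_norm_measurable [measurable]:
  assumes "finite I" "I \<noteq> {}"
  shows "(\<lambda>\<omega>. block_norm N I (\<lambda>s. Z s \<omega>)) \<in> borel_measurable \<Omega>"
  by (rule measurable_compose[OF Z_measurable block_norm_measurable[OF assms]])

lemma tail_prob_tendsto:
  assumes I: "finite I" "I \<noteq> {}"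
  shows "((\<lambda>x. x powr \<alpha> * tail_prob I x) \<longlongrightarrow> tail_mass I) at_top"
proof -
  have 1: "(\<integral>\<omega>. angular_tail I {} (\<lambda>_. 1) (1 * x) (\<lambda>s. Z s \<omega>) \<partial>\<Omega>) = tail_prob I x" for x
  proof -
    have "(\<integral>\<omega>. angular_tail I {} (\<lambda>_. 1) (1 * x) (\<lambda>s. Z s \<omega>) \<partial>\<Omega>)
        = (\<integral>\<omega>. indicator {\<omega> \<in> space \<Omega>. x < block_norm N I (\<lambda>s. Z s \<omega>)} \<omega> \<partial>\<Omega>)"
      by (rule Bochner_Integration.integral_cong) (auto simp: angular_tail_def indicator_def)
    then show ?thesis using Z_block_norm_measurable[OF I] by simp
  qed
  have 2: "(\<integral>q. angular_tail I {} (\<lambda>_. 1) 1 (storm q) \<partial>\<mu>) = tail_mass I"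
  proof -
    have "(\<integral>q. angular_tail I {} (\<lambda>_. 1) 1 (storm q) \<partial>\<mu>)
        = (\<integral>q. indicator {q \<in> space \<mu>. 1 < block_norm N I (storm q)} q \<partial>\<mu>)"
      by (rule Bochner_Integration.integral_cong) (auto simp: angular_tail_def indicator_def)
    then show ?thesis using tail_set_measurable[OF I] by (simp add: tail_mass_def)
  qed
  \<comment> \<open>The constant test function does not see the direction, which is recorded over
    the empty window.\<close>
  show ?thesis
    using angular_tail_tendsto[OF I, of "{}" 1 "\<lambda>_. 1"] by (simp add: 1[simplified] 2)
qed

text \<open>The positive limit of the rescaled tail gives positive probabilities at large
  thresholds; monotonicity extends this to every x.\<close>

lemma tail_prob_pos:
  assumes I: "finite I" "I \<noteq> {}"
  shows "0 < tail_prob I x"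
proof -
  have "eventually (\<lambda>x. 0 < x powr \<alpha> * tail_prob I x) at_top"
    using tail_prob_tendsto[OF I] tail_mass_pos[OF I] by (rule order_tendstoD)
  then have "eventually (\<lambda>y. x \<le> y \<and> 0 < y powr \<alpha> * tail_prob I y) at_top"
    using eventually_ge_at_top[of x] by eventually_elim simp
  then obtain y where y: "x \<le> y" "0 < y powr \<alpha> * tail_prob I y"
    by (auto simp: eventually_at_top_linorder)
  have "0 < tail_prob I y" using y(2) by (simp add: zero_less_mult_iff)
  also have "\<dots> \<le> tail_prob I x"
    using y(1) Z_block_norm_measurable[OF I] by (intro \<Omega>.finite_measure_mono) auto
  finally show ?thesis .
qed

lemma angular_tail_ratio_tendsto:
  assumes I: "finite I" "I \<noteq> {}" and J: "finite J" and r: "0 < r"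
    and \<phi>: "continuous_on (\<Pi>\<^sub>E i\<in>J. UNIV) \<phi>" "bounded (\<phi> ` (\<Pi>\<^sub>E i\<in>J. UNIV))"
  shows "((\<lambda>x. (\<integral>\<omega>. angular_tail I J \<phi> (r * x) (\<lambda>s. Z s \<omega>) \<partial>\<Omega>) / tail_prob I x)
      \<longlongrightarrow> r powr (- \<alpha>) * ((\<integral>q. angular_tail I J \<phi> 1 (storm q) \<partial>\<mu>) / tail_mass I)) at_top"
proof -
  have "((\<lambda>x. (x powr \<alpha> * (\<integral>\<omega>. angular_tail I J \<phi> (r * x) (\<lambda>s. Z s \<omega>) \<partial>\<Omega>)) / (x powr \<alpha> * tail_prob I x))
      \<longlongrightarrow> (\<integral>q. angular_tail I J \<phi> r (storm q) \<partial>\<mu>) / tail_mass I) at_top"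
    using tail_mass_pos[OF I] by (intro tendsto_divide angular_tail_tendsto tail_prob_tendsto assms) simp
  then have "((\<lambda>x. (\<integral>\<omega>. angular_tail I J \<phi> (r * x) (\<lambda>s. Z s \<omega>) \<partial>\<Omega>) / tail_prob I x)
      \<longlongrightarrow> (\<integral>q. angular_tail I J \<phi> r (storm q) \<partial>\<mu>) / tail_mass I) at_top"
    by (rule Lim_transform_eventually)
       (use eventually_gt_at_top[of 0] in eventually_elim, simp)
  then show ?thesis
    by (simp add: integral_angular_tail_scale[OF I r borel_measurable_continuous_on_PiE[OF \<phi>(1)]])
qed

section \<open>Angular measures and regular variation\<close>

text \<open>The law of the direction under \<mu> conditioned on norm above 1 over I. For I = J it is
  the spectral measure of the block; for I = {0} it will be the law of the spectral tail process on
  J.\<close>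

definition angular_measure :: "int set \<Rightarrow> int set \<Rightarrow> (int \<Rightarrow> real ^ 'n) measure" where
  "angular_measure I J = distr (density \<mu> (\<lambda>q. ennreal
      (indicator {q \<in> space \<mu>. 1 < block_norm N I (storm q)} q / tail_mass I)))
     (PiM J (\<lambda>_. borel)) (\<lambda>q. direction N I J (storm q))"

lemma storm_direction_measurable:
  assumes I: "finite I" "I \<noteq> {}"
  shows "(\<lambda>q. direction N I J (storm q)) \<in> \<mu> \<rightarrow>\<^sub>M PiM J (\<lambda>_. borel)"
  by (rule measurable_compose[OF storm_measurable direction_measurable[OF I]])

lemma prob_space_angular_measure:
  assumes I: "finite I" "I \<noteq> {}"
  shows "prob_space (angular_measure I J)"
proof -
  note [measurable] = tail_set_measurable[OF I] storm_direction_measurable[OF I]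
  have "prob_space (density \<mu> (\<lambda>q. ennreal (indicator {q \<in> space \<mu>. 1 < block_norm N I (storm q)} q / tail_mass I)))"
  proof (rule prob_spaceI, subst emeasure_density)
    have "(\<integral>\<^sup>+q. ennreal (indicator {q \<in> space \<mu>. 1 < block_norm N I (storm q)} q / tail_mass I) * indicator (space \<mu>) q \<partial>\<mu>)
      = (\<integral>\<^sup>+q. ennreal (1 / tail_mass I) * indicator {q \<in> space \<mu>. 1 < block_norm N I (storm q)} q \<partial>\<mu>)"
      by (intro nn_integral_cong) (auto simp: indicator_def)
    also have "\<dots> = ennreal (1 / tail_mass I) * ennreal (tail_mass I)"
      using emeasure_tail_set_finite[OF I]
      by (simp add: nn_integral_cmult tail_mass_def emeasure_eq_ennreal_measure less_top)
    also have "\<dots> = 1" using tail_mass_pos[OF I] by (simp add: ennreal_mult[symmetric])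
    finally show "(\<integral>\<^sup>+q. ennreal (indicator {q \<in> space \<mu>. 1 < block_norm N I (storm q)} q / tail_mass I)
      * indicator (space (density \<mu> (\<lambda>q. ennreal (indicator {q \<in> space \<mu>. 1 < block_norm N I (storm q)} q / tail_mass I)))) q \<partial>\<mu>) = 1"
      by simp
  qed auto
  then show ?thesis
    unfolding angular_measure_def by (rule prob_space.prob_space_distr) measurable
qed

lemma integral_angular_measure:
  assumes I: "finite I" "I \<noteq> {}" and \<phi>: "\<phi> \<in> borel_measurable (PiM J (\<lambda>_. borel))"
  shows "(\<integral>y. \<phi> y \<partial>angular_measure I J) = (\<integral>q. angular_tail I J \<phi> 1 (storm q) \<partial>\<mu>) / tail_mass I"
proof -
  note [measurable] = tail_set_measurable[OF I] storm_direction_measurable[OF I]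
    measurable_compose[OF storm_direction_measurable[OF I] \<phi>]
  have "(\<integral>y. \<phi> y \<partial>angular_measure I J)
      = (\<integral>q. (indicator {q \<in> space \<mu>. 1 < block_norm N I (storm q)} q / tail_mass I) *\<^sub>R \<phi> (direction N I J (storm q)) \<partial>\<mu>)"
    unfolding angular_measure_def using tail_mass_pos[OF I]
    by (subst integral_distr[OF _ \<phi>], simp, subst integral_density) auto
  also have "\<dots> = (\<integral>q. angular_tail I J \<phi> 1 (storm q) / tail_mass I \<partial>\<mu>)"
    by (rule Bochner_Integration.integral_cong) (auto simp: angular_tail_def indicator_def)
  finally show ?thesis by simp
qed

lemma AE_angular_measure:
  assumes I: "finite I" "I \<noteq> {}"
  shows "AE y in angular_measure I I. block_norm N I y = 1"
proof -
  note [measurable] = tail_set_measurable[OF I] storm_direction_measurable[OF I]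
  have e: "(\<lambda>y i. if i \<in> I then y i else 0) \<in> PiM I (\<lambda>_. borel) \<rightarrow>\<^sub>M (path_space :: (int \<Rightarrow> real^'n) measure)"
  proof (rule measurable_PiM_single')
    fix i show "(\<lambda>y. if i \<in> I then y i else 0) \<in> PiM I (\<lambda>_. borel) \<rightarrow>\<^sub>M (borel :: (real^'n) measure)"
      by (cases "i \<in> I") auto
  qed auto
  have "block_norm N I = (\<lambda>y. block_norm N I (\<lambda>i. if i \<in> I then y i else 0))"
    by (intro ext block_norm_cong) simp
  then have [measurable]: "block_norm N I \<in> borel_measurable (PiM I (\<lambda>_. borel))"
    using measurable_compose[OF e block_norm_measurable[OF I]] by simp
  have "block_norm N I (direction N I I (storm q)) = 1" if "1 < block_norm N I (storm q)" for q
  proof -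
    have "block_norm N I (direction N I I (storm q)) = block_norm N I (\<lambda>u. (1 / block_norm N I (storm q)) *\<^sub>R storm q u)"
      by (rule block_norm_cong) (simp add: direction_def)
    then show ?thesis using that by (simp add: block_norm_scaleR[OF norm I])
  qed
  then show ?thesis
    unfolding angular_measure_def
    by (subst AE_distr_iff, simp, measurable, subst AE_density) (auto simp: indicator_def)
qed

text \<open>The spectral measure is \<open>angular_measure I I\<close>. Integrals against the
  rescaled tail laws are ratios of \<open>angular_tail\<close> expectations, and the factor
  r^(-\<alpha>) in their limit comes from homogeneity.\<close>

lemma regularly_varying_Z: "regularly_varying \<Omega> N \<alpha> Z"
  unfolding regularly_varying_def
proof (intro conjI allI impI)
  show "process \<Omega> Z" using process_Z[of 0] by simp
  fix I :: "int set" assume I': "finite I \<and> I \<noteq> {}"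
  then have I: "finite I" "I \<noteq> {}" by auto
  interpret S: prob_space "angular_measure I I" by (rule prob_space_angular_measure[OF I])
  note [measurable] = Z_block_norm_measurable[OF I]
  have sets_S: "sets (angular_measure I I) = sets (PiM I (\<lambda>_. borel))"
    by (simp add: angular_measure_def)
  have space_S: "space (angular_measure I I) = (\<Pi>\<^sub>E i\<in>I. UNIV)"
    using sets_eq_imp_space_eq[OF sets_S] by (simp add: space_PiM)
  have dir: "(\<lambda>\<omega>. direction N I I (\<lambda>s. Z s \<omega>)) \<in> \<Omega> \<rightarrow>\<^sub>M PiM I (\<lambda>_. borel)"
    by (rule measurable_compose[OF Z_measurable direction_measurable[OF I]])
  have conv: "weakly_converges
       (\<lambda>x. distr (density \<Omega> (\<lambda>\<omega>. ennreal
           (indicator {\<omega> \<in> space \<Omega>. r * x < block_norm N I (\<lambda>u. Z u \<omega>)} \<omega> / tail_prob I x)))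
          (PiM I (\<lambda>_. borel)) (\<lambda>\<omega>. \<lambda>u\<in>I. (1 / block_norm N I (\<lambda>u. Z u \<omega>)) *\<^sub>R Z u \<omega>))
       (density (angular_measure I I) (\<lambda>_. ennreal (r powr (- \<alpha>)))) at_top"
    if r: "0 < r" for r
    unfolding weakly_converges_def
  proof (intro allI impI)
    fix \<phi> :: "(int \<Rightarrow> real ^ 'n) \<Rightarrow> real"
    assume "continuous_on (space (density (angular_measure I I) (\<lambda>_. ennreal (r powr (- \<alpha>))))) \<phi> \<and>
      bounded (\<phi> ` space (density (angular_measure I I) (\<lambda>_. ennreal (r powr (- \<alpha>)))))"
    then have \<phi>: "continuous_on (\<Pi>\<^sub>E i\<in>I. UNIV) \<phi>" "bounded (\<phi> ` (\<Pi>\<^sub>E i\<in>I. UNIV))"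
      by (auto simp: space_S)
    note m = borel_measurable_continuous_on_PiE[OF \<phi>(1)]
    have mS: "\<phi> \<in> borel_measurable (angular_measure I I)"
      using m by (subst measurable_cong_sets[OF sets_S refl])
    have "(\<integral>y. \<phi> y \<partial>distr (density \<Omega> (\<lambda>\<omega>. ennreal
           (indicator {\<omega> \<in> space \<Omega>. r * x < block_norm N I (\<lambda>u. Z u \<omega>)} \<omega> / tail_prob I x)))
          (PiM I (\<lambda>_. borel)) (\<lambda>\<omega>. \<lambda>u\<in>I. (1 / block_norm N I (\<lambda>u. Z u \<omega>)) *\<^sub>R Z u \<omega>))
        = (\<integral>\<omega>. angular_tail I I \<phi> (r * x) (\<lambda>s. Z s \<omega>) \<partial>\<Omega>) / tail_prob I x" (is "?L = _") for x
    proof -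
      have "?L = (\<integral>\<omega>. (indicator {\<omega> \<in> space \<Omega>. r * x < block_norm N I (\<lambda>u. Z u \<omega>)} \<omega> / tail_prob I x)
          *\<^sub>R \<phi> (direction N I I (\<lambda>s. Z s \<omega>)) \<partial>\<Omega>)"
        unfolding direction_def[symmetric] using dir measurable_compose[OF dir m]
        by (subst integral_distr[OF _ m], simp, subst integral_density) auto
      also have "\<dots> = (\<integral>\<omega>. angular_tail I I \<phi> (r * x) (\<lambda>s. Z s \<omega>) / tail_prob I x \<partial>\<Omega>)"
        by (rule Bochner_Integration.integral_cong) (auto simp: angular_tail_def indicator_def)
      finally show ?thesis by simp
    qed
    moreover have "(\<integral>y. \<phi> y \<partial>density (angular_measure I I) (\<lambda>_. ennreal (r powr (- \<alpha>))))
        = r powr (- \<alpha>) * ((\<integral>q. angular_tail I I \<phi> 1 (storm q) \<partial>\<mu>) / tail_mass I)"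
      using integral_angular_measure[OF I m] by (subst integral_density[OF mS]) auto
    ultimately show "((\<lambda>x. \<integral>y. \<phi> y \<partial>distr (density \<Omega> (\<lambda>\<omega>. ennreal
           (indicator {\<omega> \<in> space \<Omega>. r * x < block_norm N I (\<lambda>u. Z u \<omega>)} \<omega> / tail_prob I x)))
          (PiM I (\<lambda>_. borel)) (\<lambda>\<omega>. \<lambda>u\<in>I. (1 / block_norm N I (\<lambda>u. Z u \<omega>)) *\<^sub>R Z u \<omega>))
        \<longlongrightarrow> (\<integral>y. \<phi> y \<partial>density (angular_measure I I) (\<lambda>_. ennreal (r powr (- \<alpha>))))) at_top"
      using angular_tail_ratio_tendsto[OF I I(1) r \<phi>] by simp
  qed
  show "mv_regularly_varying \<Omega> N \<alpha> I Z"
    unfolding mv_regularly_varying_def Let_def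
    using tail_prob_pos[OF I] S.prob_space_axioms sets_S AE_angular_measure[OF I] conv
    by blast
qed

end

section \<open>The spectral tail process\<close>

context max_storm_process
begin

definition shift_weight :: "int \<Rightarrow> (int \<Rightarrow> real ^ 'n) \<Rightarrow> real" where
  "shift_weight k \<theta> = N (\<theta> k) powr \<alpha> / (\<Sum>\<^sub>\<infinity>t. N (\<theta> t) powr \<alpha>)"

lemma shift_weight_nonneg [simp]: "0 \<le> shift_weight k \<theta>"
  by (simp add: shift_weight_def infsum_nonneg)

lemma shift_weight_measurable [measurable]: "shift_weight k \<in> borel_measurable path_space"
  unfolding shift_weight_def[abs_def] infsum_eq_alpha_sum by measurable

text \<open>The path recentred at k and divided by N(\<theta> k), restricted to J: the value of the
  randomly shifted process when the random index equals k.\<close>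

definition shifted_direction :: "int set \<Rightarrow> int \<Rightarrow> (int \<Rightarrow> real ^ 'n) \<Rightarrow> int \<Rightarrow> real ^ 'n" where
  "shifted_direction J k \<theta> = direction N {0} J (\<lambda>s. \<theta> (s + k))"

lemma shifted_direction_measurable [measurable]:
  "shifted_direction J k \<in> path_space \<rightarrow>\<^sub>M PiM J (\<lambda>_. borel)"
proof -
  have "(\<lambda>\<theta> s. \<theta> (s + k)) \<in> path_space \<rightarrow>\<^sub>M (path_space :: (int \<Rightarrow> real^'n) measure)"
    by (rule measurable_PiM_single') auto
  from measurable_compose[OF this direction_measurable[of "{0}" J]]
  show ?thesis by (simp add: shifted_direction_def[abs_def])
qed

lemma weighted_indicator_measurable:
  assumes [measurable]: "A \<in> sets (PiM J (\<lambda>_. borel))"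
  shows "(\<lambda>\<theta>. indicator A (shifted_direction J k \<theta>) * ennreal (shift_weight k \<theta>)) \<in> borel_measurable path_space"
  by measurable

text \<open>The direction of a storm does not depend on u, so the integral over u only sees the
  cut-off and gives (N(\<theta> t) / \<alpha>-norm)^\<alpha>, the shift weight. The time coordinate
  t of the point takes the role of the random index, and no further normalisation appears because
  \<open>tail_mass {0} = 1\<close>.\<close>

lemma emeasure_angular_measure_0:
  assumes A [measurable]: "A \<in> sets (PiM J (\<lambda>_. borel))"
  shows "emeasure (angular_measure {0} J) A = (\<integral>\<^sup>+k. (\<integral>\<^sup>+\<omega>.
    indicator A (shifted_direction J k (\<lambda>t. \<Theta> t \<omega>)) * ennreal (shift_weight k (\<lambda>t. \<Theta> t \<omega>)) \<partial>M) \<partial>count_space UNIV)"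
proof -
  let ?E = "{q \<in> space \<mu>. 1 < N (storm q 0)}"
  have dir [measurable]: "(\<lambda>q. direction N {0} J (storm q)) \<in> \<mu> \<rightarrow>\<^sub>M PiM J (\<lambda>_. borel)"
    by (rule storm_direction_measurable) auto
  have [measurable]: "?E \<in> sets \<mu>" by measurable
  have \<Theta>_path [measurable]: "(\<lambda>\<omega> t. \<Theta> t \<omega>) \<in> M \<rightarrow>\<^sub>M path_space"
    using measurable_compose[OF \<Theta>_measurable measurable_nonneg_path_to_path] by simp
  have "emeasure (angular_measure {0} J) A
      = (\<integral>\<^sup>+q. indicator ?E q * indicator A (direction N {0} J (storm q)) \<partial>\<mu>)"
  proof -
    have "emeasure (angular_measure {0} J) A
      = emeasure (density \<mu> (\<lambda>q. ennreal (indicator ?E q))) ((\<lambda>q. direction N {0} J (storm q)) -` A \<inter> space \<mu>)"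
      by (simp add: angular_measure_def tail_mass_singleton emeasure_distr)
    also have "\<dots> = (\<integral>\<^sup>+q. ennreal (indicator ?E q) * indicator ((\<lambda>q. direction N {0} J (storm q)) -` A \<inter> space \<mu>) q \<partial>\<mu>)"
      by (rule emeasure_density) measurable
    also have "\<dots> = (\<integral>\<^sup>+q. indicator ?E q * indicator A (direction N {0} J (storm q)) \<partial>\<mu>)"
      by (rule nn_integral_cong) (auto simp: indicator_def)
    finally show ?thesis .
  qed
  also have "\<dots> = (\<integral>\<^sup>+\<omega>. (\<integral>\<^sup>+t. (\<integral>\<^sup>+u. indicator ?E (u, t, \<lambda>s. \<Theta> s \<omega>)
      * indicator A (direction N {0} J (storm (u, t, \<lambda>s. \<Theta> s \<omega>))) \<partial>pareto_intensity \<alpha>) \<partial>count_space UNIV) \<partial>M)"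
    by (rule nn_integral_intensity) measurable
  also have "\<dots> = (\<integral>\<^sup>+\<omega>. (\<integral>\<^sup>+t. indicator A (shifted_direction J t (\<lambda>s. \<Theta> s \<omega>))
      * ennreal (shift_weight t (\<lambda>s. \<Theta> s \<omega>)) \<partial>count_space UNIV) \<partial>M)"
  proof (rule nn_integral_cong_AE)
    show "AE \<omega> in M. (\<integral>\<^sup>+t. (\<integral>\<^sup>+u. indicator ?E (u, t, \<lambda>s. \<Theta> s \<omega>)
        * indicator A (direction N {0} J (storm (u, t, \<lambda>s. \<Theta> s \<omega>))) \<partial>pareto_intensity \<alpha>) \<partial>count_space UNIV)
      = (\<integral>\<^sup>+t. indicator A (shifted_direction J t (\<lambda>s. \<Theta> s \<omega>))
      * ennreal (shift_weight t (\<lambda>s. \<Theta> s \<omega>)) \<partial>count_space UNIV)"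
      using AE_alpha_sum AE_space
    proof eventually_elim
      case (elim \<omega>)
      let ?\<theta> = "\<lambda>s. \<Theta> s \<omega>"
      let ?S = "enn2real (alpha_sum ?\<theta>)" and ?n = "alpha_norm N \<alpha> ?\<theta>"
      have S: "?S > 0" using elim by (auto simp: enn2real_positive_iff)
      have n: "?n > 0" "?n powr \<alpha> = ?S" using S \<alpha> by (simp_all add: alpha_norm_eq powr_powr)
      have \<theta>: "?\<theta> \<in> space nonneg_path_space"
        using measurable_space[OF \<Theta>_measurable elim(2)] by simp
      show ?case
      proof (rule nn_integral_cong)
        fix t :: int
        have "(\<integral>\<^sup>+u. indicator ?E (u, t, ?\<theta>) * indicator A (direction N {0} J (storm (u, t, ?\<theta>))) \<partial>pareto_intensity \<alpha>)
          = (\<integral>\<^sup>+u. indicator A (shifted_direction J t ?\<theta>) * indicator {u. 1 < u * (N (\<Theta> t \<omega>) / ?n)} u \<partial>pareto_intensity \<alpha>)"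
        proof (rule nn_integral_cong)
          fix u assume "u \<in> space (pareto_intensity \<alpha>)"
          then have u: "0 < u" by simp
          have "storm (u, t, ?\<theta>) = (\<lambda>s. (u / ?n) *\<^sub>R \<Theta> (s + t) \<omega>)"
            by (simp add: storm_def fun_eq_iff)
          then have "direction N {0} J (storm (u, t, ?\<theta>)) = shifted_direction J t ?\<theta>"
            using direction_scaleR[OF norm, of "{0}" "u / ?n" J "\<lambda>s. \<Theta> (s + t) \<omega>"] u n
            by (simp add: shifted_direction_def)
          moreover have "(u, t, ?\<theta>) \<in> ?E \<longleftrightarrow> 1 < u * (N (\<Theta> t \<omega>) / ?n)"
            using u n \<theta> by (simp add: storm_def space_intensity norm_scaleR)
          ultimately show "indicator ?E (u, t, ?\<theta>) * indicator A (direction N {0} J (storm (u, t, ?\<theta>)))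
            = indicator A (shifted_direction J t ?\<theta>) * (indicator {u. 1 < u * (N (\<Theta> t \<omega>) / ?n)} u :: ennreal)"
            by (simp add: indicator_def)
        qed
        also have "\<dots> = indicator A (shifted_direction J t ?\<theta>)
            * (\<integral>\<^sup>+u. indicator {u. 1 < u * (N (\<Theta> t \<omega>) / ?n)} u \<partial>pareto_intensity \<alpha>)"
          by (intro nn_integral_cmult measurable_pareto_intensity_borel) measurable
        also have "(\<integral>\<^sup>+u. indicator {u. 1 < u * (N (\<Theta> t \<omega>) / ?n)} u \<partial>pareto_intensity \<alpha>)
            = ennreal ((N (\<Theta> t \<omega>) / ?n / 1) powr \<alpha>)"
          using n by (intro pareto_intensity_tail \<alpha>) auto
        also have "(N (\<Theta> t \<omega>) / ?n / 1) powr \<alpha> = shift_weight t ?\<theta>"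
          using n by (simp add: powr_divide shift_weight_def infsum_eq_alpha_sum[of ?\<theta>])
        finally show "(\<integral>\<^sup>+u. indicator ?E (u, t, ?\<theta>) * indicator A (direction N {0} J (storm (u, t, ?\<theta>))) \<partial>pareto_intensity \<alpha>)
          = indicator A (shifted_direction J t ?\<theta>) * ennreal (shift_weight t ?\<theta>)" .
      qed
    qed
  qed
  \<comment> \<open>Tonelli moves the sum over k outside, so that each k can be matched with the
    event that the random index equals k.\<close>
  also have "\<dots> = (\<integral>\<^sup>+k. (\<integral>\<^sup>+\<omega>. indicator A (shifted_direction J k (\<lambda>t. \<Theta> t \<omega>))
      * ennreal (shift_weight k (\<lambda>t. \<Theta> t \<omega>)) \<partial>M) \<partial>count_space UNIV)"
  proof (rule nn_integral_count_space_nn_integral)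
    fix k :: int
    show "(\<lambda>\<omega>. indicator A (shifted_direction J k (\<lambda>t. \<Theta> t \<omega>)) * ennreal (shift_weight k (\<lambda>t. \<Theta> t \<omega>)))
        \<in> borel_measurable M"
      by (rule measurable_compose[OF \<Theta>_path weighted_indicator_measurable[OF A]])
  qed simp
  finally show ?thesis .
qed

text \<open>The event is split according to the value k of K. For fixed k the shifted direction is a
  function of the path \<Theta>', so its indicator factors out of the conditional expectation and
  the indicator of K = k is replaced by its conditional probability.\<close>

lemma emeasure_random_shift:
  assumes Q: "nonneg_process Q \<Theta>'" and shift: "random_shift Q N \<alpha> \<Theta>' K"
    and A [measurable]: "A \<in> sets (PiM J (\<lambda>_. borel))"
  shows "emeasure Q {\<omega> \<in> space Q. shifted_direction J (K \<omega>) (\<lambda>t. \<Theta>' t \<omega>) \<in> A}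
    = (\<integral>\<^sup>+k. (\<integral>\<^sup>+\<omega>. indicator A (shifted_direction J k (\<lambda>t. \<Theta>' t \<omega>))
        * ennreal (shift_weight k (\<lambda>t. \<Theta>' t \<omega>)) \<partial>Q) \<partial>count_space UNIV)"
proof -
  interpret Q: prob_space Q using Q by (simp add: nonneg_process_def)
  have \<Theta>': "(\<lambda>\<omega> t. \<Theta>' t \<omega>) \<in> Q \<rightarrow>\<^sub>M nonneg_path_space" using Q by (simp add: nonneg_process_def)
  have \<Theta>'_path: "(\<lambda>\<omega> t. \<Theta>' t \<omega>) \<in> Q \<rightarrow>\<^sub>M path_space"
    using measurable_compose[OF \<Theta>' measurable_nonneg_path_to_path] by simp
  have K [measurable]: "K \<in> Q \<rightarrow>\<^sub>M count_space UNIV" using shift by (simp add: random_shift_def)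
  let ?F = "vimage_algebra (space Q) (\<lambda>\<omega> t. \<Theta>' t \<omega>) nonneg_path_space"
  have "sets ?F \<subseteq> sets Q"
    using measurable_sets[OF \<Theta>'] measurable_space[OF \<Theta>']
    by (subst sets_vimage_algebra2) auto
  then interpret F: finite_measure_subalgebra Q ?F
    by unfold_locales (simp add: subalgebra_def)
  have "(\<lambda>\<omega> t. \<Theta>' t \<omega>) \<in> ?F \<rightarrow>\<^sub>M nonneg_path_space"
    by (rule measurable_vimage_algebra1) (use measurable_space[OF \<Theta>'] in auto)
  then have \<Theta>'_F: "(\<lambda>\<omega> t. \<Theta>' t \<omega>) \<in> ?F \<rightarrow>\<^sub>M path_space"
    by (rule measurable_compose[OF _ measurable_nonneg_path_to_path])
  let ?f = "\<lambda>k \<omega>. indicator A (shifted_direction J k (\<lambda>t. \<Theta>' t \<omega>)) :: real"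
  let ?X = "\<lambda>k. {\<omega> \<in> space Q. shifted_direction J k (\<lambda>t. \<Theta>' t \<omega>) \<in> A \<and> K \<omega> = k}"
  have f_F: "?f k \<in> borel_measurable ?F" for k
    by (intro measurable_compose[OF measurable_compose[OF \<Theta>'_F shifted_direction_measurable] borel_measurable_indicator[OF A]])
  have f_Q [measurable]: "?f k \<in> borel_measurable Q" for k
    by (intro measurable_compose[OF measurable_compose[OF \<Theta>'_path shifted_direction_measurable] borel_measurable_indicator[OF A]])
  have w_Q [measurable]: "(\<lambda>\<omega>. shift_weight k (\<lambda>t. \<Theta>' t \<omega>)) \<in> borel_measurable Q" for k
    by (rule measurable_compose[OF \<Theta>'_path shift_weight_measurable])
  have Kk [measurable]: "{\<omega> \<in> space Q. K \<omega> = k} \<in> sets Q" for k by measurable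
  have dir_Q [measurable]: "(\<lambda>\<omega>. shifted_direction J k (\<lambda>t. \<Theta>' t \<omega>)) \<in> Q \<rightarrow>\<^sub>M PiM J (\<lambda>_. borel)" for k
    by (rule measurable_compose[OF \<Theta>'_path shifted_direction_measurable])
  have X [measurable]: "?X k \<in> sets Q" for k by measurable
  have cond: "emeasure Q (?X k) = (\<integral>\<^sup>+\<omega>. indicator A (shifted_direction J k (\<lambda>t. \<Theta>' t \<omega>))
      * ennreal (shift_weight k (\<lambda>t. \<Theta>' t \<omega>)) \<partial>Q)" for k
  proof -
    let ?g = "indicator {\<omega> \<in> space Q. K \<omega> = k} :: _ \<Rightarrow> real"
    have int: "integrable Q (\<lambda>\<omega>. ?f k \<omega> * ?g \<omega>)"
      by (intro Q.integrable_const_bound[where B=1]) (auto simp: indicator_def)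
    note ce = F.real_cond_exp_intg[OF int f_F]
    have "AE \<omega> in Q. real_cond_exp Q ?F ?g \<omega> = shift_weight k (\<lambda>t. \<Theta>' t \<omega>)"
      using shift by (simp add: random_shift_def shift_weight_def)
    then have AE: "AE \<omega> in Q. ?f k \<omega> * real_cond_exp Q ?F ?g \<omega> = ?f k \<omega> * shift_weight k (\<lambda>t. \<Theta>' t \<omega>)"
      by eventually_elim simp
    have int': "integrable Q (\<lambda>\<omega>. ?f k \<omega> * shift_weight k (\<lambda>t. \<Theta>' t \<omega>))"
      using ce(1) by (rule integrable_cong_AE_imp) (use AE in \<open>auto elim: eventually_mono\<close>)
    have "emeasure Q (?X k) = ennreal (\<integral>\<omega>. ?f k \<omega> * ?g \<omega> \<partial>Q)"
    proof -
      have "(\<integral>\<omega>. ?f k \<omega> * ?g \<omega> \<partial>Q) = (\<integral>\<omega>. indicator (?X k) \<omega> \<partial>Q)"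
        by (rule Bochner_Integration.integral_cong) (auto simp: indicator_def)
      then show ?thesis by (simp add: Q.emeasure_eq_measure)
    qed
    also have "(\<integral>\<omega>. ?f k \<omega> * ?g \<omega> \<partial>Q) = (\<integral>\<omega>. ?f k \<omega> * real_cond_exp Q ?F ?g \<omega> \<partial>Q)"
      using ce(2) by simp
    also have "\<dots> = (\<integral>\<omega>. ?f k \<omega> * shift_weight k (\<lambda>t. \<Theta>' t \<omega>) \<partial>Q)"
      using AE by (intro integral_cong_AE) auto
    also have "ennreal \<dots> = (\<integral>\<^sup>+\<omega>. ennreal (?f k \<omega> * shift_weight k (\<lambda>t. \<Theta>' t \<omega>)) \<partial>Q)"
      using int' by (intro nn_integral_eq_integral[symmetric]) auto
    also have "\<dots> = (\<integral>\<^sup>+\<omega>. indicator A (shifted_direction J k (\<lambda>t. \<Theta>' t \<omega>))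
      * ennreal (shift_weight k (\<lambda>t. \<Theta>' t \<omega>)) \<partial>Q)"
      by (intro nn_integral_cong) (auto simp: indicator_def)
    finally show ?thesis .
  qed
  have "{\<omega> \<in> space Q. shifted_direction J (K \<omega>) (\<lambda>t. \<Theta>' t \<omega>) \<in> A} = (\<Union>k. ?X k)" by auto
  also have "emeasure Q \<dots> = (\<integral>\<^sup>+k. emeasure Q (?X k) \<partial>count_space UNIV)"
    by (rule emeasure_UN_countable) (auto simp: disjoint_family_on_def)
  finally show ?thesis by (simp only: cond)
qed

text \<open>Both sides reduce to the same weighted sum, an integral of one path functional under the
  laws of \<Theta> and \<Theta>', which agree. A copy on a separate space Q is used because M need
  not carry the extra randomness of K; for the same reason only the law of \<Theta>RS
  matters.\<close>

lemma angular_measure_eq_spectral: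
  assumes Q: "nonneg_process Q \<Theta>'" and law: "process_law Q \<Theta>' = process_law M \<Theta>"
    and shift: "random_shift Q N \<alpha> \<Theta>' K"
    and R: "process R \<Theta>RS"
    and RS: "process_law R \<Theta>RS = process_law Q (\<lambda>t \<omega>. (1 / N (\<Theta>' (K \<omega>) \<omega>)) *\<^sub>R \<Theta>' (t + K \<omega>) \<omega>)"
  shows "angular_measure {0} J = distr R (PiM J (\<lambda>_. borel)) (\<lambda>\<omega>. \<lambda>u\<in>J. \<Theta>RS u \<omega>)"
proof (rule measure_eqI)
  show "sets (angular_measure {0} J) = sets (distr R (PiM J (\<lambda>_. borel)) (\<lambda>\<omega>. \<lambda>u\<in>J. \<Theta>RS u \<omega>))"
    by (simp add: angular_measure_def)
  fix A assume "A \<in> sets (angular_measure {0} J)"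
  then have A: "A \<in> sets (PiM J (\<lambda>_. borel))" by (simp add: angular_measure_def)
  have \<Theta>_path: "(\<lambda>\<omega> t. \<Theta> t \<omega>) \<in> M \<rightarrow>\<^sub>M path_space"
    using measurable_compose[OF \<Theta>_measurable measurable_nonneg_path_to_path] by simp
  have \<Theta>'_path: "(\<lambda>\<omega> t. \<Theta>' t \<omega>) \<in> Q \<rightarrow>\<^sub>M path_space"
    using Q measurable_compose[OF _ measurable_nonneg_path_to_path] by (auto simp: nonneg_process_def)
  have K: "K \<in> Q \<rightarrow>\<^sub>M count_space UNIV" using shift by (simp add: random_shift_def)
  have R_path: "(\<lambda>\<omega> t. \<Theta>RS t \<omega>) \<in> R \<rightarrow>\<^sub>M path_space" using R by (simp add: process_def)
  define Y where "Y \<omega> = (\<lambda>t. (1 / N (\<Theta>' (K \<omega>) \<omega>)) *\<^sub>R \<Theta>' (t + K \<omega>) \<omega>)" for \<omega>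
  have Y: "Y \<in> Q \<rightarrow>\<^sub>M path_space"
  proof -
    have "(\<lambda>\<theta> t. (1 / N (\<theta> k)) *\<^sub>R \<theta> (t + k)) \<in> path_space \<rightarrow>\<^sub>M (path_space :: (int \<Rightarrow> real^'n) measure)" for k
      by (rule measurable_PiM_single') auto
    from measurable_compose[OF \<Theta>'_path this]
    have "(\<lambda>\<omega> t. (1 / N (\<Theta>' k \<omega>)) *\<^sub>R \<Theta>' (t + k) \<omega>) \<in> Q \<rightarrow>\<^sub>M path_space" for k .
    \<comment> \<open>K takes countably many values, so measurability for each constant shift
      suffices.\<close>
    from measurable_compose_countable[OF this K] show ?thesis by (simp add: Y_def[abs_def])
  qed
  have restr: "(\<lambda>y. restrict y J) \<in> path_space \<rightarrow>\<^sub>M PiM J (\<lambda>_. borel :: (real^'n) measure)"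
    by measurable
  have restr_A: "(\<lambda>y. restrict y J) -` A \<in> sets path_space"
    using measurable_sets[OF restr A] by (simp add: space_PiM)
  note h_meas = weighted_indicator_measurable[OF A]
  have transfer: "(\<integral>\<^sup>+\<omega>. indicator A (shifted_direction J k (\<lambda>t. \<Theta> t \<omega>)) * ennreal (shift_weight k (\<lambda>t. \<Theta> t \<omega>)) \<partial>M)
      = (\<integral>\<^sup>+\<omega>. indicator A (shifted_direction J k (\<lambda>t. \<Theta>' t \<omega>)) * ennreal (shift_weight k (\<lambda>t. \<Theta>' t \<omega>)) \<partial>Q)" for k
  proof -
    let ?h = "\<lambda>\<theta>. indicator A (shifted_direction J k \<theta>) * ennreal (shift_weight k \<theta>)"
    have "(\<integral>\<^sup>+\<omega>. ?h (\<lambda>t. \<Theta> t \<omega>) \<partial>M) = (\<integral>\<^sup>+\<theta>. ?h \<theta> \<partial>process_law M \<Theta>)"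
      unfolding process_law_def using h_meas by (intro nn_integral_distr[symmetric] \<Theta>_path) simp
    also have "\<dots> = (\<integral>\<^sup>+\<theta>. ?h \<theta> \<partial>process_law Q \<Theta>')" by (simp only: law)
    also have "\<dots> = (\<integral>\<^sup>+\<omega>. ?h (\<lambda>t. \<Theta>' t \<omega>) \<partial>Q)"
      unfolding process_law_def using h_meas by (intro nn_integral_distr \<Theta>'_path) simp
    finally show ?thesis .
  qed
  have "emeasure (angular_measure {0} J) A = emeasure Q {\<omega> \<in> space Q. shifted_direction J (K \<omega>) (\<lambda>t. \<Theta>' t \<omega>) \<in> A}"
    by (simp only: emeasure_angular_measure_0[OF A] transfer emeasure_random_shift[OF Q shift A])
  \<comment> \<open>Restricting the shifted and normalised path Y to J gives the shifted direction
    at K, since the norm over {0} after the shift is N(\<Theta>' K).\<close>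
  also have "{\<omega> \<in> space Q. shifted_direction J (K \<omega>) (\<lambda>t. \<Theta>' t \<omega>) \<in> A} = Y -` ((\<lambda>y. restrict y J) -` A) \<inter> space Q"
    by (auto simp: Y_def shifted_direction_def direction_def)
  also have "emeasure Q \<dots> = emeasure (distr Q path_space Y) ((\<lambda>y. restrict y J) -` A)"
    by (rule emeasure_distr[OF Y restr_A, symmetric])
  also have "distr Q path_space Y = distr R path_space (\<lambda>\<omega> t. \<Theta>RS t \<omega>)"
    using RS unfolding process_law_def Y_def[abs_def] by simp
  also have "emeasure \<dots> ((\<lambda>y. restrict y J) -` A) = emeasure R ((\<lambda>\<omega> t. \<Theta>RS t \<omega>) -` ((\<lambda>y. restrict y J) -` A) \<inter> space R)"
    by (rule emeasure_distr[OF R_path restr_A])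
  also have "\<dots> = emeasure R ((\<lambda>\<omega>. \<lambda>u\<in>J. \<Theta>RS u \<omega>) -` A \<inter> space R)"
    by (rule arg_cong[where f="emeasure R"]) auto
  also have "\<dots> = emeasure (distr R (PiM J (\<lambda>_. borel)) (\<lambda>\<omega>. \<lambda>u\<in>J. \<Theta>RS u \<omega>)) A"
    using measurable_compose[OF R_path restr] by (intro emeasure_distr[symmetric] A) simp
  finally show "emeasure (angular_measure {0} J) A = emeasure (distr R (PiM J (\<lambda>_. borel)) (\<lambda>\<omega>. \<lambda>u\<in>J. \<Theta>RS u \<omega>)) A" .
qed

text \<open>The ratio limit with norm window {0}, recording window {s..t} and r = 1; its limit
  measure has just been identified with the law of \<Theta>RS on that window.\<close>

lemma spectral_tail_process_Z:
  assumes Q: "nonneg_process Q \<Theta>'" and law: "process_law Q \<Theta>' = process_law M \<Theta>"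
    and shift: "random_shift Q N \<alpha> \<Theta>' K"
    and R: "process R \<Theta>RS"
    and RS: "process_law R \<Theta>RS = process_law Q (\<lambda>t \<omega>. (1 / N (\<Theta>' (K \<omega>) \<omega>)) *\<^sub>R \<Theta>' (t + K \<omega>) \<omega>)"
  shows "spectral_tail_process \<Omega> N Z R \<Theta>RS"
  unfolding spectral_tail_process_def
proof (intro conjI allI impI stationary_Z R)
  show pos: "0 < \<Omega>.prob {\<omega> \<in> space \<Omega>. x < N (Z 0 \<omega>)}" for x
    using tail_prob_pos[of "{0}" x] by simp
  fix s t :: int assume "s \<le> t"
  let ?J = "{s..t}"
  show "weakly_converges
          (\<lambda>x. distr (uniform_measure \<Omega> {\<omega> \<in> space \<Omega>. x < N (Z 0 \<omega>)})
             (PiM ?J (\<lambda>_. borel)) (\<lambda>\<omega>. \<lambda>u\<in>?J. (1 / N (Z 0 \<omega>)) *\<^sub>R Z u \<omega>))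
          (distr R (PiM ?J (\<lambda>_. borel)) (\<lambda>\<omega>. \<lambda>u\<in>?J. \<Theta>RS u \<omega>)) at_top"
    unfolding weakly_converges_def angular_measure_eq_spectral[OF assms, symmetric]
  proof (intro allI impI)
    fix \<phi> :: "(int \<Rightarrow> real ^ 'n) \<Rightarrow> real"
    assume "continuous_on (space (angular_measure {0} ?J)) \<phi> \<and> bounded (\<phi> ` space (angular_measure {0} ?J))"
    then have \<phi>: "continuous_on (\<Pi>\<^sub>E i\<in>?J. UNIV) \<phi>" "bounded (\<phi> ` (\<Pi>\<^sub>E i\<in>?J. UNIV))"
      by (auto simp: angular_measure_def space_PiM)
    note m = borel_measurable_continuous_on_PiE[OF \<phi>(1)]
    have dir: "(\<lambda>\<omega>. direction N {0} ?J (\<lambda>s. Z s \<omega>)) \<in> \<Omega> \<rightarrow>\<^sub>M PiM ?J (\<lambda>_. borel)"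
      by (rule measurable_compose[OF Z_measurable direction_measurable]) auto
    have "(\<integral>y. \<phi> y \<partial>distr (uniform_measure \<Omega> {\<omega> \<in> space \<Omega>. x < N (Z 0 \<omega>)})
             (PiM ?J (\<lambda>_. borel)) (\<lambda>\<omega>. \<lambda>u\<in>?J. (1 / N (Z 0 \<omega>)) *\<^sub>R Z u \<omega>))
      = (\<integral>\<omega>. angular_tail {0} ?J \<phi> (1 * x) (\<lambda>s. Z s \<omega>) \<partial>\<Omega>) / \<Omega>.prob {\<omega> \<in> space \<Omega>. x < block_norm N {0} (\<lambda>s. Z s \<omega>)}"
      (is "?L = _") for x
    proof -
      let ?E = "{\<omega> \<in> space \<Omega>. x < N (Z 0 \<omega>)}"
      have E [measurable]: "?E \<in> sets \<Omega>" by measurable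
      \<comment> \<open>Positivity of the conditioning probability lets the quotient in
        [0, \<infinity>] be rewritten as a real quotient, giving a real density for the Bochner
        integral.\<close>
      have um: "uniform_measure \<Omega> ?E = density \<Omega> (\<lambda>\<omega>. ennreal (indicator ?E \<omega> / \<Omega>.prob ?E))"
        unfolding uniform_measure_def using pos[of x]
        by (intro density_cong) (auto simp: \<Omega>.emeasure_eq_measure indicator_def divide_ennreal ennreal_1[symmetric] simp del: ennreal_1)
      have d: "(\<lambda>\<omega>. \<lambda>u\<in>?J. (1 / N (Z 0 \<omega>)) *\<^sub>R Z u \<omega>) = (\<lambda>\<omega>. direction N {0} ?J (\<lambda>s. Z s \<omega>))"
        by (simp add: direction_def)
      have "?L = (\<integral>\<omega>. (indicator ?E \<omega> / \<Omega>.prob ?E) *\<^sub>R \<phi> (direction N {0} ?J (\<lambda>s. Z s \<omega>)) \<partial>\<Omega>)"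
        unfolding um d using dir measurable_compose[OF dir m]
        by (subst integral_distr[OF _ m], simp, subst integral_density) auto
      also have "\<dots> = (\<integral>\<omega>. angular_tail {0} ?J \<phi> (1 * x) (\<lambda>s. Z s \<omega>) / \<Omega>.prob ?E \<partial>\<Omega>)"
        by (rule Bochner_Integration.integral_cong) (auto simp: angular_tail_def indicator_def)
      finally show ?thesis by simp
    qed
    moreover have "(\<integral>y. \<phi> y \<partial>angular_measure {0} ?J)
        = 1 powr (- \<alpha>) * ((\<integral>q. angular_tail {0} ?J \<phi> 1 (storm q) \<partial>\<mu>) / tail_mass {0})"
      using integral_angular_measure[of "{0}" \<phi> ?J] m by simp
    ultimately show "((\<lambda>x. \<integral>y. \<phi> y \<partial>distr (uniform_measure \<Omega> {\<omega> \<in> space \<Omega>. x < N (Z 0 \<omega>)})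
             (PiM ?J (\<lambda>_. borel)) (\<lambda>\<omega>. \<lambda>u\<in>?J. (1 / N (Z 0 \<omega>)) *\<^sub>R Z u \<omega>))
        \<longlongrightarrow> (\<integral>y. \<phi> y \<partial>angular_measure {0} ?J)) at_top"
      using angular_tail_ratio_tendsto[of "{0}" ?J 1 \<phi>] \<phi> by simp
  qed
qed

end

theorem theorem3p2:
  fixes N :: "real ^ 'n \<Rightarrow> real"
    and \<alpha> :: real
    and M :: "'a measure"
    and \<Theta> :: "int \<Rightarrow> 'a \<Rightarrow> real ^ 'n"
    and \<Omega> :: "'b measure"
    and U :: "nat \<Rightarrow> 'b \<Rightarrow> real"
    and T :: "nat \<Rightarrow> 'b \<Rightarrow> int"
    and \<theta> :: "nat \<Rightarrow> 'b \<Rightarrow> int \<Rightarrow> real ^ 'n"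
    and Z :: "int \<Rightarrow> 'b \<Rightarrow> real ^ 'n"
  assumes "is_norm N"
    and "0 < \<alpha>"
    and "nonneg_process M \<Theta>"
    and "AE \<omega> in M. (\<lambda>t. N (\<Theta> t \<omega>) powr \<alpha>) summable_on UNIV \<and>
                     0 < (\<Sum>\<^sub>\<infinity>t. N (\<Theta> t \<omega>) powr \<alpha>)"
    and "poisson_point_process \<Omega> (intensity \<alpha> M \<Theta>) (\<lambda>i \<omega>. (U i \<omega>, T i \<omega>, \<theta> i \<omega>))"
  defines "Z \<equiv> max_process N \<alpha> U T \<theta>"
  shows "(AE \<omega> in \<Omega>. \<forall>t j. max_process_ext N \<alpha> U T \<theta> t \<omega> $ j < \<infinity>)
    \<and> stationary \<Omega> Z
    \<and> max_stable \<Omega> \<alpha> Z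
    \<and> regularly_varying \<Omega> N \<alpha> Z
    \<and> (\<forall>(Q :: 'c measure) \<Theta>' K (R :: 'd measure) \<Theta>RS.
          nonneg_process Q \<Theta>' \<and> process_law Q \<Theta>' = process_law M \<Theta> \<and>
          random_shift Q N \<alpha> \<Theta>' K \<and>
          process R \<Theta>RS \<and>
          process_law R \<Theta>RS =
            process_law Q (\<lambda>t \<omega>. (1 / N (\<Theta>' (K \<omega>) \<omega>)) *\<^sub>R \<Theta>' (t + K \<omega>) \<omega>)
          \<longrightarrow> spectral_tail_process \<Omega> N Z R \<Theta>RS)"
proof -
  interpret S: max_storm_process N \<alpha> M \<Theta> \<Omega> "\<lambda>i \<omega>. (U i \<omega>, T i \<omega>, \<theta> i \<omega>)"
    using assms(1-5) by unfold_locales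
  have ext: "max_process_ext N \<alpha> U T \<theta> t \<omega> $ j = S.Z_ext t \<omega> j" for t \<omega> j
    by (simp add: max_process_ext_def S.Z_ext_def S.storm_def)
  have Z: "Z = S.Z"
    by (simp add: Z_def max_process_def S.Z_def ext fun_eq_iff)
  show ?thesis
    unfolding Z ext
    using S.AE_Z_ext_finite S.stationary_Z S.max_stable_Z S.regularly_varying_Z S.spectral_tail_process_Z
    by blast
qed

end
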